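(* Let $\mathcal{A}$ be a weak alternating automaton with monotone transitions over a signature whose constants all have type $o$ or $o\to o\to o$, with maximal rank $m$, and consider its intersection type system and its stratified models $\mathcal{D}^k$ as described in the context. For every $k=0,\dots,m$, every $\lambda Y$-term $M$ of simple type $A$, every environment $\Gamma$ declaring all free variables of $M$, and every $S\subseteq\mathcal{T}^k_A$: $[\![M]\!]^k_{[\![\Gamma]\!]^k}\geq [\![S]\!]^k$ holds in $\mathcal{D}^k_A$ if and only if $\Gamma\vdash M\geq S$ is derivable.
   Context: Simple types are generated from $o$ by $\to$. $\lambda Y$-terms are simply typed $\lambda$-terms built from variables, signature constants, and constants $Y^A:(A\to A)\to A$, $\Omega^A:A$; $Yx.M$ abbreviates $Y(\lambda x.M)$; $\Omega^A$ is regarded as an abbreviation of $Y^A(\lambda x^A.x)$. Automaton $\mathcal{A}=\langle Q,\Sigma,q^0,\delta_o,\delta_{o^2\to o},\rho\rangle$: $Q$ finite, $\rho:Q\to\mathbb{N}$, $m=\max\rho$, $Q_k=\{q:\rho(q)=k\}$, $Q_{\le k}=\{q:\rho(q)\le k\}$; $\delta_o(q,c)\in\{\emptyset,\{()\}\}$; $\delta_{o^2\to o}(q,a)\subseteq\mathcal{P}(Q)^2$, weak (elements $(S_0,S_1)$ satisfy $S_0,S_1\subseteq Q_{\le\rho(q)}$) and monotone (closed under enlarging $S_0,S_1$ within $Q_{\le\rho(q)}$). Types: $\tau^k_o=Q_k$, $\tau^k_{A\to B}=\{T\to s: T\subseteq\mathcal{T}^k_A, s\in\tau^k_B\}$, $\mathcal{T}^k_A=\bigcup_{l\le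 k}\tau^l_A$, $\mathcal{T}^{-1}_A=\emptyset$, $\mathcal{T}_A=\mathcal{T}^m_A$; $S\to T=\{S\to t:t\in T\}$; $S_0\to S_1\to q$ denotes $S_0\to\{S_1\to q\}$. Order $\sqsubseteq$: least relations with $S\sqsubseteq_o T$ if $S\subseteq T\subseteq Q$; $s\sqsubseteq_o t$ if $s=t$; $S\sqsubseteq_A T$ if every $s\in S$ has some $t\in T$ with $s\sqsubseteq_A t$; $S\to s\sqsubseteq T\to t$ if $T\sqsubseteq S$ and $s\sqsubseteq t$. $S(T)=\{t:(U\to t)\in S, U\sqsubseteq T\}$. Environments $\Gamma=x_1\geq S_1,\dots,x_n\geq S_n$ with $S_i\subseteq\mathcal{T}_{A_i}$. Rules: (1) $\Gamma,x\geq S\vdash x\geq S$; (2) from $\Gamma\vdash M\geq S$, $\Gamma\vdash M\geq T$ infer $\Gamma\vdash M\geq S\cup T$; (3) from $\Gamma\vdash M\geq S$, $T\sqsubseteq S$ infer $\Gamma\vdash M\geq T$; (4) $\Gamma\vdash c\geq\{q:\delta_o(q,c)\ne\emptyset\}$; (5) for $(S_0,S_1)\in\delta(q,a)$: $\Gamma\vdash a\geq\{S_0\to S_1\to q\}$; (6) from $\Gamma\vdash M\geq S$, $\Gamma\vdash N\geq T$ infer $\Gamma\vdash MN\geq S(T)$; (7) for $S\subseteq\mathcal{T}^k_A$, $T\subseteq\tau^k_B$: from $\Gamma,x\geq S\vdash M\geq T$ infer $\Gamma\vdash\lambda x.M\geq S\to T$; (8) from $\Gamma\vdash\lambda x.M\geq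 S$, $\Gamma\vdash Yx.M\geq T$ infer $\Gamma\vdash Yx.M\geq S(T)$; (9) for $S\subseteq\tau^{2k}_A$, $T\subseteq\mathcal{T}^{2k-1}_A$: from $\Gamma\vdash\lambda x.M\geq(S\cup T)\to S$ and $\Gamma\vdash Yx.M\geq T$ infer $\Gamma\vdash Yx.M\geq S\cup T$. Stratified model: $\mathcal{D}^0_o=\mathcal{P}(Q_0)$, $\mathcal{D}^0_{A\to B}$ = monotone maps $\mathcal{D}^0_A\to\mathcal{D}^0_B$; for $k>0$: $\mathcal{D}^k_o=\mathcal{P}(Q_{\le k})$, $\mathcal{L}^k_o=\{(R,P):R=P\cap Q_{\le k-1}\}$, $\mathcal{L}^k_{A\to B}=\{(f_1,f_2): f_1\in\mathcal{D}^{k-1}_{A\to B}$, $f_2$ monotone $\mathcal{D}^k_A\to\mathcal{D}^k_B$, $(f_1(g_1),f_2(g_2))\in\mathcal{L}^k_B$ for all $(g_1,g_2)\in\mathcal{L}^k_A\}$, $\mathcal{D}^k_{A\to B}=\{f_2:\exists f_1,(f_1,f_2)\in\mathcal{L}^k_{A\to B}\}$; orders are inclusion at $o$ and pointwise otherwise. Each $\mathcal{D}^k_A$ is a finite lattice with least/greatest elements $\bot^k_A,\top^k_A$; for $k>0$ each $e\in\mathcal{D}^k_A$ has a unique $e^\downarrow$ with $(e^\downarrow,e)\in\mathcal{L}^k_A$, and for $d\in\mathcal{D}^{k-1}_A$, $d^{\uparrow\top}$, $d^{\uparrow\bot}$ are the greatest and least $e$ with $(d,e)\in\mathcal{L}^k_A$.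 $\mathrm{fix}^0_A(f)=\bigwedge_n f^n(\top^0_A)$; $\mathrm{fix}^{2k}_A(f)=\bigwedge_n f^n((\mathrm{fix}^{2k-1}_A(f^\downarrow))^{\uparrow\top})$ for $2k>0$; $\mathrm{fix}^{2k+1}_A(f)=\bigvee_n f^n((\mathrm{fix}^{2k}_A(f^\downarrow))^{\uparrow\bot})$. Terms are interpreted in $\mathcal{D}^k$ standardly, with $Y^A\mapsto\mathrm{fix}^k_A$, $[\![c]\!]^k=\{q\in Q_{\le k}:\delta_o(q,c)\ne\emptyset\}$, $[\![a]\!]^k(S_0,S_1)=\{q\in Q_{\le k}:(S_0,S_1)\in\delta(q,a)\}$. Type interpretation: for $d\in\mathcal{D}^k_A$, $e\in\mathcal{D}^k_B$, the step function $d\Rightarrow e$ maps $h$ to $e$ if $d\le h$ and to $\bot^k_B$ otherwise. $[\![q]\!]^k=\{q\}$ if $\rho(q)\le k$ and $\emptyset$ otherwise; $[\![S]\!]^k=\bigvee\{[\![t]\!]^k:t\in S\}$; $[\![T\to s]\!]^k=[\![T]\!]^k\Rightarrow[\![s]\!]^k$. $[\![\Gamma]\!]^k$ is the valuation $x\mapsto[\![\Gamma(x)]\!]^k$.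
   Formalization: Mended: the rule Γ ⊢ M ≥ ∅ is added (else no Yx.M is typable); [[a]]^k(S0,S1) tests (S0∩Q_{≤ρ(q)}, S1∩Q_{≤ρ(q)}) ∈ δ(q,a), as the printed formula is not monotone; in derivations a Y not applied to an abstraction is read as λf.Yx.fx, since no rule types it. *)

theory Defs
  imports "HOL-Algebra.Lattice" "HOL-Library.FSet"
begin

section \<open>Simple types and \<lambda>Y-terms\<close>

datatype ty = TO | Fn ty ty  (infixr "\<rightarrow>\<^sub>t" 65)

text \<open>Terms are in Church style: every type \<open>A\<close> has its own countable set of variables
  \<open>Var x A\<close>, and \<open>YC A\<close> is the constant of type \<open>(A \<rightarrow> A) \<rightarrow> A\<close>.\<close>

datatype 'c tm =
    Var nat ty
  | Cst 'c
  | YC ty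
  | App "'c tm" "'c tm"
  | Lam nat ty "'c tm"

abbreviation Yb :: "nat \<Rightarrow> ty \<Rightarrow> 'c tm \<Rightarrow> 'c tm" where
  "Yb x A M \<equiv> App (YC A) (Lam x A M)"

abbreviation Omega :: "ty \<Rightarrow> 'c tm" where
  "Omega A \<equiv> Yb 0 A (Var 0 A)"

primrec fv :: "'c tm \<Rightarrow> (nat \<times> ty) set" where
  "fv (Var x A) = {(x, A)}"
| "fv (Cst c) = {}"
| "fv (YC A) = {}"
| "fv (App M N) = fv M \<union> fv N"
| "fv (Lam x A M) = fv M - {(x, A)}"

inductive has_type :: "('c \<rightharpoonup> ty) \<Rightarrow> 'c tm \<Rightarrow> ty \<Rightarrow> bool" for \<Sigma> where
  ht_Var: "has_type \<Sigma> (Var x A) A"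
| ht_Cst: "\<Sigma> c = Some A \<Longrightarrow> has_type \<Sigma> (Cst c) A"
| ht_Y:   "has_type \<Sigma> (YC A) ((A \<rightarrow>\<^sub>t A) \<rightarrow>\<^sub>t A)"
| ht_App: "has_type \<Sigma> M (A \<rightarrow>\<^sub>t B) \<Longrightarrow> has_type \<Sigma> N A \<Longrightarrow> has_type \<Sigma> (App M N) B"
| ht_Lam: "has_type \<Sigma> M B \<Longrightarrow> has_type \<Sigma> (Lam x A M) (A \<rightarrow>\<^sub>t B)"

text \<open>The typing rules for fixpoints speak only about terms of the form \<open>Yx.M\<close>. A \<open>Y\<close> that is not
  applied to an abstraction is read as its \<open>\<eta>\<close>-long form \<open>\<lambda>f. Yx. f x\<close>; a term in which
  every \<open>Y\<close> occurs as \<open>Yx.M\<close> is left unchanged.\<close>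

fun expand_Y :: "'c tm \<Rightarrow> 'c tm" where
  "expand_Y (App (YC A) (Lam x B M)) = App (YC A) (Lam x B (expand_Y M))"
| "expand_Y (App M N) = App (expand_Y M) (expand_Y N)"
| "expand_Y (YC A) = Lam 0 (A \<rightarrow>\<^sub>t A) (Yb 1 A (App (Var 0 (A \<rightarrow>\<^sub>t A)) (Var 1 A)))"
| "expand_Y (Lam x A M) = Lam x A (expand_Y M)"
| "expand_Y (Var x A) = Var x A"
| "expand_Y (Cst c) = Cst c"


section \<open>Weak alternating automata\<close>

record ('q, 'c) automaton =
  states :: "'q set"
  sig    :: "'c \<rightharpoonup> ty"
  init   :: "'q"
  delta0 :: "'q \<Rightarrow> 'c \<Rightarrow> unit set"
  delta2 :: "'q \<Rightarrow> 'c \<Rightarrow> ('q set \<times> 'q set) set"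
  rank   :: "'q \<Rightarrow> nat"

definition states_le :: "('q, 'c) automaton \<Rightarrow> nat \<Rightarrow> 'q set" where
  "states_le \<A> k = {q \<in> states \<A>. rank \<A> q \<le> k}"

definition max_rank :: "('q, 'c) automaton \<Rightarrow> nat" where
  "max_rank \<A> = Max (rank \<A> ` states \<A>)"

definition weak_transitions :: "('q, 'c) automaton \<Rightarrow> bool" where
  "weak_transitions \<A> \<longleftrightarrow>
    (\<forall>q \<in> states \<A>. \<forall>a S0 S1. sig \<A> a = Some (TO \<rightarrow>\<^sub>t TO \<rightarrow>\<^sub>t TO) \<longrightarrow> (S0, S1) \<in> delta2 \<A> q a \<longrightarrow>
       S0 \<subseteq> states_le \<A> (rank \<A> q) \<and> S1 \<subseteq> states_le \<A> (rank \<A> q))"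

definition monotone_transitions :: "('q, 'c) automaton \<Rightarrow> bool" where
  "monotone_transitions \<A> \<longleftrightarrow>
    (\<forall>q \<in> states \<A>. \<forall>a S0 S1 S0' S1'. sig \<A> a = Some (TO \<rightarrow>\<^sub>t TO \<rightarrow>\<^sub>t TO) \<longrightarrow>
       (S0, S1) \<in> delta2 \<A> q a \<longrightarrow>
       S0 \<subseteq> S0' \<longrightarrow> S0' \<subseteq> states_le \<A> (rank \<A> q) \<longrightarrow>
       S1 \<subseteq> S1' \<longrightarrow> S1' \<subseteq> states_le \<A> (rank \<A> q) \<longrightarrow>
       (S0', S1') \<in> delta2 \<A> q a)"

definition weak_automaton :: "('q, 'c) automaton \<Rightarrow> bool" where
  "weak_automaton \<A> \<longleftrightarrow>
     finite (states \<A>) \<and> init \<A> \<in> states \<A> \<and>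
     ran (sig \<A>) \<subseteq> {TO, TO \<rightarrow>\<^sub>t TO \<rightarrow>\<^sub>t TO} \<and>
     weak_transitions \<A> \<and> monotone_transitions \<A>"


section \<open>Intersection types\<close>

datatype 'q ity = St 'q | Arr "'q ity fset" "'q ity"

fun tau :: "('q, 'c) automaton \<Rightarrow> nat \<Rightarrow> ty \<Rightarrow> 'q ity set" where
  "tau \<A> k TO = {St q | q. q \<in> states \<A> \<and> rank \<A> q = k}"
| "tau \<A> k (A \<rightarrow>\<^sub>t B) = {Arr T s | T s. fset T \<subseteq> (\<Union>l\<le>k. tau \<A> l A) \<and> s \<in> tau \<A> k B}"

definition itypes :: "('q, 'c) automaton \<Rightarrow> nat \<Rightarrow> ty \<Rightarrow> 'q ity set" where
  "itypes \<A> k A = (\<Union>l\<le>k. tau \<A> l A)"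

text \<open>\<open>itypes_below \<A> k A\<close> is \<open>\<T>\<close> at level \<open>k - 1\<close>, which is empty for \<open>k = 0\<close>.\<close>

definition itypes_below :: "('q, 'c) automaton \<Rightarrow> nat \<Rightarrow> ty \<Rightarrow> 'q ity set" where
  "itypes_below \<A> k A = (\<Union>l<k. tau \<A> l A)"

text \<open>\<open>S \<rightarrow> T = {S \<rightarrow> t | t \<in> T}\<close>; the sets \<open>S\<close> to which this is applied are finite.\<close>

definition arrs :: "'q ity set \<Rightarrow> 'q ity set \<Rightarrow> 'q ity set" where
  "arrs S T = {Arr U t | U t. fset U = S \<and> t \<in> T}"

text \<open>The simple type indexing the order is left implicit: it is only used between elements and
  subsets of one \<open>\<T>\<^sub>A\<close>, and \<open>d_sub\<close> below enforces this. At type \<open>o\<close>, \<open>sle\<close> is inclusion.\<close>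

inductive tle :: "'q ity \<Rightarrow> 'q ity \<Rightarrow> bool"
  and sle :: "'q ity set \<Rightarrow> 'q ity set \<Rightarrow> bool" where
  tle_St: "tle (St q) (St q)"
| tle_Arr: "sle (fset T) (fset S) \<Longrightarrow> tle s t \<Longrightarrow> tle (Arr S s) (Arr T t)"
| sle_set: "\<forall>s \<in> S. \<exists>t \<in> T. tle s t \<Longrightarrow> sle S T"

definition appl :: "'q ity set \<Rightarrow> 'q ity set \<Rightarrow> 'q ity set" where
  "appl S T = {t. \<exists>U. Arr U t \<in> S \<and> sle (fset U) T}"

type_synonym 'q env = "nat \<times> ty \<rightharpoonup> 'q ity set"

definition environment :: "('q, 'c) automaton \<Rightarrow> 'q env \<Rightarrow> bool" where
  "environment \<A> \<Gamma> \<longleftrightarrow> finite (dom \<Gamma>) \<and>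
     (\<forall>x A S. \<Gamma> (x, A) = Some S \<longrightarrow> S \<subseteq> itypes \<A> (max_rank \<A>) A)"

text \<open>\<open>d_empty\<close> is the nullary instance of the union rule. It is needed to start any derivation for
  \<open>Yx.M\<close>, since both fixpoint rules have a premise about \<open>Yx.M\<close> itself.\<close>

inductive derivable :: "('q, 'c) automaton \<Rightarrow> 'q env \<Rightarrow> 'c tm \<Rightarrow> 'q ity set \<Rightarrow> bool" for \<A> where
  d_var: "\<Gamma> (x, A) = Some S \<Longrightarrow> derivable \<A> \<Gamma> (Var x A) S"
| d_empty: "derivable \<A> \<Gamma> M {}"
| d_union: "derivable \<A> \<Gamma> M S \<Longrightarrow> derivable \<A> \<Gamma> M T \<Longrightarrow> derivable \<A> \<Gamma> M (S \<union> T)"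
| d_sub: "derivable \<A> \<Gamma> M S \<Longrightarrow> has_type (sig \<A>) M A \<Longrightarrow> T \<subseteq> itypes \<A> (max_rank \<A>) A \<Longrightarrow>
    sle T S \<Longrightarrow> derivable \<A> \<Gamma> M T"
| d_const0: "sig \<A> c = Some TO \<Longrightarrow>
    derivable \<A> \<Gamma> (Cst c) {St q | q. q \<in> states \<A> \<and> delta0 \<A> q c \<noteq> {}}"
| d_const2: "sig \<A> a = Some (TO \<rightarrow>\<^sub>t TO \<rightarrow>\<^sub>t TO) \<Longrightarrow> q \<in> states \<A> \<Longrightarrow> (S0, S1) \<in> delta2 \<A> q a \<Longrightarrow>
    derivable \<A> \<Gamma> (Cst a) (arrs (St ` S0) (arrs (St ` S1) {St q}))"
| d_app: "derivable \<A> \<Gamma> M S \<Longrightarrow> derivable \<A> \<Gamma> N T \<Longrightarrow> derivable \<A> \<Gamma> (App M N) (appl S T)"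
| d_lam: "has_type (sig \<A>) M B \<Longrightarrow> S \<subseteq> itypes \<A> k A \<Longrightarrow> T \<subseteq> tau \<A> k B \<Longrightarrow>
    derivable \<A> (\<Gamma>((x, A) \<mapsto> S)) M T \<Longrightarrow> derivable \<A> \<Gamma> (Lam x A M) (arrs S T)"
| d_Y_odd: "derivable \<A> \<Gamma> (Lam x A M) S \<Longrightarrow> derivable \<A> \<Gamma> (Yb x A M) T \<Longrightarrow>
    derivable \<A> \<Gamma> (Yb x A M) (appl S T)"
| d_Y_even: "S \<subseteq> tau \<A> (2 * k) A \<Longrightarrow> T \<subseteq> itypes_below \<A> (2 * k) A \<Longrightarrow>
    derivable \<A> \<Gamma> (Lam x A M) (arrs (S \<union> T) S) \<Longrightarrow> derivable \<A> \<Gamma> (Yb x A M) T \<Longrightarrow>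
    derivable \<A> \<Gamma> (Yb x A M) (S \<union> T)"


section \<open>The stratified models\<close>

text \<open>A semantic value is a set of states or a function given by its graph. Graphs are finite because
  all domains of the models are.\<close>

datatype 'q val = VO (base: "'q set") | VF (graph: "('q val \<times> 'q val) fset")

definition vlam :: "'q val set \<Rightarrow> ('q val \<Rightarrow> 'q val) \<Rightarrow> 'q val" where
  "vlam X h = VF (Abs_fset ((\<lambda>x. (x, h x)) ` X))"

definition vapp :: "'q val \<Rightarrow> 'q val \<Rightarrow> 'q val" where
  "vapp f x = (THE y. (x, y) \<in> fset (graph f))"

definition vdom :: "'q val \<Rightarrow> 'q val set" where
  "vdom f = fst ` fset (graph f)"

fun vle :: "ty \<Rightarrow> 'q val \<Rightarrow> 'q val \<Rightarrow> bool" where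
  "vle TO u v \<longleftrightarrow> base u \<subseteq> base v"
| "vle (A \<rightarrow>\<^sub>t B) f g \<longleftrightarrow> (\<forall>x \<in> vdom f. vle B (vapp f x) (vapp g x))"

definition mono_maps :: "ty \<Rightarrow> ty \<Rightarrow> 'q val set \<Rightarrow> 'q val set \<Rightarrow> 'q val set" where
  "mono_maps A B X Y = {vlam X h | h. h ` X \<subseteq> Y \<and>
     (\<forall>x \<in> X. \<forall>x' \<in> X. vle A x x' \<longrightarrow> vle B (h x) (h x'))}"

text \<open>\<open>Lrel \<A> k A\<close> relates \<open>Dom \<A> (k - 1) A\<close> and \<open>Dom \<A> k A\<close>; it is meaningful for \<open>k > 0\<close> only.\<close>

function (sequential) Dom :: "('q, 'c) automaton \<Rightarrow> nat \<Rightarrow> ty \<Rightarrow> 'q val set"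
  and Lrel :: "('q, 'c) automaton \<Rightarrow> nat \<Rightarrow> ty \<Rightarrow> ('q val \<times> 'q val) set" where
  "Dom \<A> k TO = {VO P | P. P \<subseteq> states_le \<A> k}"
| "Dom \<A> 0 (A \<rightarrow>\<^sub>t B) = mono_maps A B (Dom \<A> 0 A) (Dom \<A> 0 B)"
| "Dom \<A> (Suc k) (A \<rightarrow>\<^sub>t B) = {f2. \<exists>f1. (f1, f2) \<in> Lrel \<A> (Suc k) (A \<rightarrow>\<^sub>t B)}"
| "Lrel \<A> 0 A = {}"
| "Lrel \<A> (Suc k) TO =
    {(VO R, VO P) | R P. P \<subseteq> states_le \<A> (Suc k) \<and> R = P \<inter> states_le \<A> k}"
| "Lrel \<A> (Suc k) (A \<rightarrow>\<^sub>t B) =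
    {(f1, f2). f1 \<in> Dom \<A> k (A \<rightarrow>\<^sub>t B) \<and>
       f2 \<in> mono_maps A B (Dom \<A> (Suc k) A) (Dom \<A> (Suc k) B) \<and>
       (\<forall>(g1, g2) \<in> Lrel \<A> (Suc k) A. (vapp f1 g1, vapp f2 g2) \<in> Lrel \<A> (Suc k) B)}"
  by pat_completeness auto
termination
  by (relation "measures
        [\<lambda>x. case x of Inl (\<A>, k, A) \<Rightarrow> k | Inr (\<A>, k, A) \<Rightarrow> k,
         \<lambda>x. case x of Inl (\<A>, k, A) \<Rightarrow> size A | Inr (\<A>, k, A) \<Rightarrow> size A,
         \<lambda>x. case x of Inl _ \<Rightarrow> 1 | Inr _ \<Rightarrow> 0]") auto

abbreviation DL :: "('q, 'c) automaton \<Rightarrow> nat \<Rightarrow> ty \<Rightarrow> 'q val gorder" where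
  "DL \<A> k A \<equiv> \<lparr>carrier = Dom \<A> k A, eq = (=), le = vle A\<rparr>"

definition down :: "('q, 'c) automaton \<Rightarrow> nat \<Rightarrow> ty \<Rightarrow> 'q val \<Rightarrow> 'q val" where
  "down \<A> k A e = (THE d. (d, e) \<in> Lrel \<A> k A)"

definition up_top :: "('q, 'c) automaton \<Rightarrow> nat \<Rightarrow> ty \<Rightarrow> 'q val \<Rightarrow> 'q val" where
  "up_top \<A> k A d = (THE e. greatest (DL \<A> k A) e {e. (d, e) \<in> Lrel \<A> k A})"

definition up_bot :: "('q, 'c) automaton \<Rightarrow> nat \<Rightarrow> ty \<Rightarrow> 'q val \<Rightarrow> 'q val" where
  "up_bot \<A> k A d = (THE e. least (DL \<A> k A) e {e. (d, e) \<in> Lrel \<A> k A})"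

fun fixp :: "('q, 'c) automaton \<Rightarrow> nat \<Rightarrow> ty \<Rightarrow> 'q val \<Rightarrow> 'q val" where
  "fixp \<A> 0 A f = \<Sqinter>\<^bsub>DL \<A> 0 A\<^esub> (range (\<lambda>n. (vapp f ^^ n) \<top>\<^bsub>DL \<A> 0 A\<^esub>))"
| "fixp \<A> (Suc k) A f =
    (let p = fixp \<A> k A (down \<A> (Suc k) (A \<rightarrow>\<^sub>t A) f) in
     if even (Suc k)
     then \<Sqinter>\<^bsub>DL \<A> (Suc k) A\<^esub> (range (\<lambda>n. (vapp f ^^ n) (up_top \<A> (Suc k) A p)))
     else \<Squnion>\<^bsub>DL \<A> (Suc k) A\<^esub> (range (\<lambda>n. (vapp f ^^ n) (up_bot \<A> (Suc k) A p))))"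

text \<open>In \<open>const2_val\<close> the arguments are truncated to \<open>states_le \<A> (rank \<A> q)\<close>, the states that a weak
  transition from \<open>q\<close> can mention. Without this the function is not monotone (and so not in the
  model) at levels above the rank of \<open>q\<close>: \<open>({}, {}) \<in> delta2 \<A> q a\<close> would put \<open>q\<close> in the value at
  \<open>({}, {})\<close>, but never in the value at \<open>({q'}, {})\<close> with \<open>rank \<A> q' > rank \<A> q\<close>.\<close>

definition const0_val :: "('q, 'c) automaton \<Rightarrow> nat \<Rightarrow> 'c \<Rightarrow> 'q val" where
  "const0_val \<A> k c = VO {q \<in> states_le \<A> k. delta0 \<A> q c \<noteq> {}}"

definition const2_val :: "('q, 'c) automaton \<Rightarrow> nat \<Rightarrow> 'c \<Rightarrow> 'q val" where
  "const2_val \<A> k a =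
     vlam (Dom \<A> k TO) (\<lambda>u0. vlam (Dom \<A> k TO) (\<lambda>u1.
       VO {q \<in> states_le \<A> k.
         (base u0 \<inter> states_le \<A> (rank \<A> q), base u1 \<inter> states_le \<A> (rank \<A> q)) \<in> delta2 \<A> q a}))"

primrec interp :: "('q, 'c) automaton \<Rightarrow> nat \<Rightarrow> 'c tm \<Rightarrow> (nat \<times> ty \<Rightarrow> 'q val) \<Rightarrow> 'q val" where
  "interp \<A> k (Var x A) v = v (x, A)"
| "interp \<A> k (Cst c) v = (if sig \<A> c = Some TO then const0_val \<A> k c else const2_val \<A> k c)"
| "interp \<A> k (YC A) v = vlam (Dom \<A> k (A \<rightarrow>\<^sub>t A)) (fixp \<A> k A)"
| "interp \<A> k (App M N) v = vapp (interp \<A> k M v) (interp \<A> k N v)"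
| "interp \<A> k (Lam x A M) v = vlam (Dom \<A> k A) (\<lambda>d. interp \<A> k M (v((x, A) := d)))"


section \<open>Interpretation of intersection types\<close>

definition step :: "('q, 'c) automaton \<Rightarrow> nat \<Rightarrow> ty \<Rightarrow> ty \<Rightarrow> 'q val \<Rightarrow> 'q val \<Rightarrow> 'q val" where
  "step \<A> k A B d e = vlam (Dom \<A> k A) (\<lambda>h. if vle A d h then e else \<bottom>\<^bsub>DL \<A> k B\<^esub>)"

fun type_val :: "('q, 'c) automaton \<Rightarrow> nat \<Rightarrow> ty \<Rightarrow> 'q ity \<Rightarrow> 'q val" where
  "type_val \<A> k TO (St q) = VO (if rank \<A> q \<le> k then {q} else {})"
| "type_val \<A> k (A \<rightarrow>\<^sub>t B) (Arr T s) =
     step \<A> k A B (\<Squnion>\<^bsub>DL \<A> k A\<^esub> (type_val \<A> k A ` fset T)) (type_val \<A> k B s)"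
| "type_val \<A> k _ _ = undefined"

definition types_val :: "('q, 'c) automaton \<Rightarrow> nat \<Rightarrow> ty \<Rightarrow> 'q ity set \<Rightarrow> 'q val" where
  "types_val \<A> k A S = \<Squnion>\<^bsub>DL \<A> k A\<^esub> (type_val \<A> k A ` S)"

text \<open>Only the values at variables declared in \<open>\<Gamma>\<close> are meaningful.\<close>

definition env_val :: "('q, 'c) automaton \<Rightarrow> nat \<Rightarrow> 'q env \<Rightarrow> nat \<times> ty \<Rightarrow> 'q val" where
  "env_val \<A> k \<Gamma> = (\<lambda>(x, A). types_val \<A> k A (the (\<Gamma> (x, A))))"

end

theory Submission
  imports Defs
begin

text \<open>For \<open>(d, e)\<close> in the logical relation between levels \<open>k\<close> and \<open>k + 1\<close>, the map \<open>e \<mapsto> d\<close> is a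
  function with both a left adjoint \<open>up_bot\<close> and a right adjoint \<open>up_top\<close>. An intersection type of
  level at most \<open>k\<close> is interpreted at level \<open>k + 1\<close> by the left adjoint of its interpretation at
  level \<open>k\<close>, and a type of higher level is interpreted by bottom. Hence the order on types coincides
  with the semantic order, every element of the model is the join of the types below it, and the
  application of sets of types computes the application of the model.

  The fixpoint at an even level is the greatest post-fixpoint whose projection is below the fixpoint
  of the previous level, which is what rule (9) expresses; at an odd level it is reached from the
  lifting of the previous fixpoint by finitely many unfoldings, which are instances of rule (8).
  Soundness is an induction on derivations, for all levels at once. Completeness is an induction on
  terms and, for \<open>Yx.M\<close>, on the level; it derives the set of all types below the value of the term.\<close>

section \<open>Simple typing\<close>

text \<open>Above level 0 a monotone map belongs to the model only if it lies over some map of the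
  level below, so monotonicity never suffices for membership. Joins, constants, fixpoints, terms and
  types are all treated by one scheme: from membership at level \<open>k\<close>, the constructions
  at \<open>k\<close> and \<open>Suc k\<close> are shown to be related by \<open>Lrel\<close>, and
  membership at \<open>Suc k\<close> is read off the pair. The lifted fixpoint is a good starting
  point because one application of the function stays in the fibre over the previous fixpoint. The
  lifting is extremal in that fibre, so the iterates form a chain, which stabilises in a finite
  domain. The delicate point in definability is that an arrow type has the level of its target and
  its premise may not exceed that level. An arrow with a low target cannot list all types of its
  argument; such targets are handled one level lower, where the projection of the function is
  already definable.\<close>

inductive_cases has_type_VarE: "has_type \<Sigma> (Var x A) B"
inductive_cases has_type_CstE: "has_type \<Sigma> (Cst c) B"
inductive_cases has_type_YE: "has_type \<Sigma> (YC A) B"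
inductive_cases has_type_AppE: "has_type \<Sigma> (App M N) B"
inductive_cases has_type_LamE: "has_type \<Sigma> (Lam x A M) B"

lemma has_type_unique: "has_type \<Sigma> M A \<Longrightarrow> has_type \<Sigma> M B \<Longrightarrow> A = B"
proof (induction arbitrary: B rule: has_type.induct)
  case (ht_App M A C N)
  from ht_App.prems obtain A' where "has_type \<Sigma> M (A' \<rightarrow>\<^sub>t B)" by (rule has_type_AppE)
  from ht_App.IH(1)[OF this] show ?case by simp
next
  case (ht_Lam M C x A)
  from ht_Lam.prems obtain C' where "B = A \<rightarrow>\<^sub>t C'" "has_type \<Sigma> M C'" by (rule has_type_LamE)
  with ht_Lam.IH show ?case by simp
qed (auto elim: has_type_VarE has_type_CstE has_type_YE)


section \<open>Function values\<close>

lemma fset_Abs_fset: "finite X \<Longrightarrow> fset (Abs_fset X) = X"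
  by (simp add: Abs_fset_inverse)

lemma vdom_vlam: "finite X \<Longrightarrow> vdom (vlam X h) = X"
  by (force simp: vdom_def vlam_def fset_Abs_fset)

lemma vapp_vlam: "finite X \<Longrightarrow> x \<in> X \<Longrightarrow> vapp (vlam X h) x = h x"
  unfolding vapp_def vlam_def by (rule the_equality) (auto simp: fset_Abs_fset)

lemma vlam_cong: "(\<And>x. x \<in> X \<Longrightarrow> h x = h' x) \<Longrightarrow> vlam X h = vlam X h'"
  by (simp add: vlam_def cong: image_cong)

text \<open>Graphs over a finite domain are extensional, so a member is recovered from its own
  application and the function that built it can be forgotten.\<close>

lemma mono_maps_iff:
  assumes "finite X"
  shows "f \<in> mono_maps A B X Y \<longleftrightarrow> f = vlam X (vapp f) \<and> (\<forall>x \<in> X. vapp f x \<in> Y) \<and>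
    (\<forall>x \<in> X. \<forall>x' \<in> X. vle A x x' \<longrightarrow> vle B (vapp f x) (vapp f x'))"
proof
  assume "f \<in> mono_maps A B X Y"
  then obtain h where "f = vlam X h" "h ` X \<subseteq> Y"
      "\<forall>x \<in> X. \<forall>x' \<in> X. vle A x x' \<longrightarrow> vle B (h x) (h x')"
    by (auto simp: mono_maps_def)
  then show "f = vlam X (vapp f) \<and> (\<forall>x \<in> X. vapp f x \<in> Y) \<and>
      (\<forall>x \<in> X. \<forall>x' \<in> X. vle A x x' \<longrightarrow> vle B (vapp f x) (vapp f x'))"
    using assms by (auto simp: vapp_vlam intro: vlam_cong)
qed (auto simp: mono_maps_def)

lemma vlam_in_mono_maps:
  assumes "finite X" "\<And>x. x \<in> X \<Longrightarrow> h x \<in> Y"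
    and "\<And>x x'. x \<in> X \<Longrightarrow> x' \<in> X \<Longrightarrow> vle A x x' \<Longrightarrow> vle B (h x) (h x')"
  shows "vlam X h \<in> mono_maps A B X Y"
  using assms by (auto simp: mono_maps_def)

lemma finite_mono_maps:
  assumes "finite X" "finite Y"
  shows "finite (mono_maps A B X Y)"
proof (rule finite_subset)
  show "mono_maps A B X Y \<subseteq> (\<lambda>G. VF (Abs_fset G)) ` Pow (X \<times> Y)"
    by (auto simp: mono_maps_def vlam_def)
qed (use assms in simp)

text \<open>Taking \<open>r\<close> to be the order or its converse covers both kinds of fixpoint.\<close>

lemma iterate_stabilises:
  assumes "finite X" "a \<in> X" and closed: "\<And>x. x \<in> X \<Longrightarrow> g x \<in> X"
    and refl: "\<And>x. x \<in> X \<Longrightarrow> r x x"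
    and trans: "\<And>x y z. x \<in> X \<Longrightarrow> y \<in> X \<Longrightarrow> z \<in> X \<Longrightarrow> r x y \<Longrightarrow> r y z \<Longrightarrow> r x z"
    and antisym: "\<And>x y. x \<in> X \<Longrightarrow> y \<in> X \<Longrightarrow> r x y \<Longrightarrow> r y x \<Longrightarrow> x = y"
    and mono: "\<And>x y. x \<in> X \<Longrightarrow> y \<in> X \<Longrightarrow> r x y \<Longrightarrow> r (g x) (g y)"
    and start: "r (g a) a"
  obtains N where "g ((g ^^ N) a) = (g ^^ N) a" "\<And>n. r ((g ^^ N) a) ((g ^^ n) a)"
proof -
  have X: "(g ^^ n) a \<in> X" for n
    by (induction n) (auto simp: assms)
  have step: "r ((g ^^ Suc n) a) ((g ^^ n) a)" for n
  proof (induction n)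
    case (Suc n)
    show ?case using mono[OF X[of "Suc n"] X[of n] Suc] by simp
  qed (simp add: start)
  have chain: "r ((g ^^ (i + n)) a) ((g ^^ i) a)" for i n
  proof (induction n)
    case (Suc n)
    show ?case using trans[OF X X X step Suc] by simp
  qed (simp add: refl X)
  have "finite (range (\<lambda>n. (g ^^ n) a))"
    by (rule finite_subset[OF _ assms(1)]) (use X in auto)
  then have "\<not> inj (\<lambda>n. (g ^^ n) a)"
    using finite_imageD infinite_UNIV_nat by blast
  then obtain i j where "i \<noteq> j" "(g ^^ i) a = (g ^^ j) a"
    by (auto simp: inj_on_def)
  then obtain i j where ij: "i < j" "(g ^^ i) a = (g ^^ j) a"
    by (metis linorder_neqE_nat)
  \<comment> \<open>Position \<open>j\<close> is at least \<open>Suc i\<close> and carries the value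
    of position \<open>i\<close>, so the descending chain closes up between \<open>i\<close> and
    \<open>Suc i\<close>.\<close>
  have "r ((g ^^ i) a) ((g ^^ Suc i) a)"
    using chain[of "Suc i" "j - Suc i"] ij by (simp del: funpow.simps)
  then have fixed: "g ((g ^^ i) a) = (g ^^ i) a"
    using antisym[OF X[of "Suc i"] X[of i] step] by simp
  have stable: "(g ^^ (i + n)) a = (g ^^ i) a" for n
    by (induction n) (simp_all add: fixed)
  have "r ((g ^^ i) a) ((g ^^ n) a)" for n
    using chain[of n "i - n"] stable[of "n - i"] refl[OF X]
    by (cases "n \<le> i") simp_all
  with fixed show thesis by (rule that)
qed


section \<open>The stratified model\<close>

locale automaton_model =
  fixes \<A> :: "('q, 'c) automaton"
  assumes weak: "weak_automaton \<A>"
begin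

abbreviation D :: "nat \<Rightarrow> ty \<Rightarrow> 'q val set" where "D \<equiv> Dom \<A>"

abbreviation L :: "nat \<Rightarrow> ty \<Rightarrow> ('q val \<times> 'q val) set" where "L k \<equiv> Lrel \<A> (Suc k)"

lemma finite_states: "finite (states \<A>)"
  using weak by (simp add: weak_automaton_def)

lemma finite_states_le: "finite (states_le \<A> k)"
  using finite_states by (simp add: states_le_def)

text \<open>Only an inclusion: from level 1 on, \<open>Dom\<close> also asks for a related function
  one level lower.\<close>

lemma D_fun_subset: "D k (A \<rightarrow>\<^sub>t B) \<subseteq> mono_maps A B (D k A) (D k B)"
  by (cases k) auto

lemma finite_D: "finite (D k A)"
proof (induction A)
  case TO
  have "D k TO = VO ` Pow (states_le \<A> k)" by auto
  then show ?case by (simp add: finite_states_le)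
next
  case (Fn A B)
  then show ?case using finite_subset[OF D_fun_subset] finite_mono_maps by blast
qed

lemmas D_funD = subsetD[OF D_fun_subset, unfolded mono_maps_iff[OF finite_D]]

lemma D_eta: "f \<in> D k (A \<rightarrow>\<^sub>t B) \<Longrightarrow> vlam (D k A) (vapp f) = f"
  using D_funD by metis

lemma D_app: "f \<in> D k (A \<rightarrow>\<^sub>t B) \<Longrightarrow> x \<in> D k A \<Longrightarrow> vapp f x \<in> D k B"
  using D_funD by blast

lemma D_app_mono:
  "f \<in> D k (A \<rightarrow>\<^sub>t B) \<Longrightarrow> x \<in> D k A \<Longrightarrow> x' \<in> D k A \<Longrightarrow> vle A x x' \<Longrightarrow> vle B (vapp f x) (vapp f x')"
  using D_funD by blast

lemma vdom_D: "f \<in> D k (A \<rightarrow>\<^sub>t B) \<Longrightarrow> vdom f = D k A"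
  using D_eta vdom_vlam[OF finite_D] by metis

lemma app_lam: "x \<in> D k A \<Longrightarrow> vapp (vlam (D k A) h) x = h x"
  by (rule vapp_vlam[OF finite_D])

lemma vle_fun: "f \<in> D k (A \<rightarrow>\<^sub>t B) \<Longrightarrow>
    vle (A \<rightarrow>\<^sub>t B) f g \<longleftrightarrow> (\<forall>x \<in> D k A. vle B (vapp f x) (vapp g x))"
  by (simp add: vdom_D)

lemma vle_app: "f \<in> D k (A \<rightarrow>\<^sub>t B) \<Longrightarrow> vle (A \<rightarrow>\<^sub>t B) f g \<Longrightarrow> x \<in> D k A \<Longrightarrow> vle B (vapp f x) (vapp g x)"
  by (simp add: vdom_D)

lemma vle_lam: "vle (A \<rightarrow>\<^sub>t B) (vlam (D k A) h) g \<longleftrightarrow> (\<forall>x \<in> D k A. vle B (h x) (vapp g x))"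
  by (simp add: vdom_vlam[OF finite_D] app_lam)

lemma vle_refl: "x \<in> D k A \<Longrightarrow> vle A x x"
  by (induction A arbitrary: x) (auto simp: vdom_D intro: D_app)

lemma vle_trans: "x \<in> D k A \<Longrightarrow> y \<in> D k A \<Longrightarrow> vle A x y \<Longrightarrow> vle A y z \<Longrightarrow> vle A x z"
proof (induction A arbitrary: x y z)
  case (Fn A B)
  then show ?case by (simp add: vdom_D) (meson D_app)
qed auto

lemma vle_antisym: "x \<in> D k A \<Longrightarrow> y \<in> D k A \<Longrightarrow> vle A x y \<Longrightarrow> vle A y x \<Longrightarrow> x = y"
proof (induction A arbitrary: x y)
  case (Fn A B)
  have "vlam (D k A) (vapp x) = vlam (D k A) (vapp y)"
    using Fn by (intro vlam_cong) (simp add: vdom_D D_app)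
  then show ?case using Fn.prems by (simp add: D_eta)
qed auto

lemma L_D: "(d, e) \<in> L k A \<Longrightarrow> d \<in> D k A \<and> e \<in> D (Suc k) A"
  by (cases A) (auto simp: states_le_def)

lemma L_app: "(f1, f2) \<in> L k (A \<rightarrow>\<^sub>t B) \<Longrightarrow> (g1, g2) \<in> L k A \<Longrightarrow> (vapp f1 g1, vapp f2 g2) \<in> L k B"
  by auto

lemma L_exists: "e \<in> D (Suc k) A \<Longrightarrow> \<exists>d. (d, e) \<in> L k A"
  by (cases A) auto

text \<open>The way into a function domain of level \<open>Suc k\<close>: the witness
  \<open>f1\<close>, existentially hidden in \<open>Dom\<close>, is supplied explicitly, and
  membership then follows by \<open>L_D\<close>.\<close>

lemma L_funI:
  assumes "f1 \<in> D k (A \<rightarrow>\<^sub>t B)" and "\<And>x. x \<in> D (Suc k) A \<Longrightarrow> h x \<in> D (Suc k) B"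
    and "\<And>x x'. x \<in> D (Suc k) A \<Longrightarrow> x' \<in> D (Suc k) A \<Longrightarrow> vle A x x' \<Longrightarrow> vle B (h x) (h x')"
    and "\<And>g1 g2. (g1, g2) \<in> L k A \<Longrightarrow> (vapp f1 g1, h g2) \<in> L k B"
  shows "(f1, vlam (D (Suc k) A) h) \<in> L k (A \<rightarrow>\<^sub>t B)"
proof -
  have "vlam (D (Suc k) A) h \<in> mono_maps A B (D (Suc k) A) (D (Suc k) B)"
    using assms by (intro vlam_in_mono_maps finite_D)
  moreover have "(vapp f1 g1, vapp (vlam (D (Suc k) A) h) g2) \<in> L k B" if "(g1, g2) \<in> L k A" for g1 g2
    using assms(4)[OF that] L_D[OF that] by (simp add: app_lam)
  ultimately show ?thesis using assms(1) by auto
qed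

section \<open>Adjunctions between consecutive levels\<close>

declare Dom.simps(2,3) [simp del] Lrel.simps(3) [simp del] vle.simps(2) [simp del]

text \<open>The three claims need each other at function types. Monotonicity of the projection tests
  functions at an arbitrary lower argument, which must have something above it
  (\<open>ex_lower\<close> for \<open>A\<close>). The two liftings of a function need the projection
  on \<open>A\<close> to be single-valued and monotone (\<open>L_mono\<close> for
  \<open>A\<close>).\<close>

lemma galois:
  shows L_mono: "(d, e) \<in> L k A \<Longrightarrow> (d', e') \<in> L k A \<Longrightarrow> vle A e e' \<Longrightarrow> vle A d d'"
    and ex_lower: "d \<in> D k A \<Longrightarrow> \<exists>e. (d, e) \<in> L k A \<and> (\<forall>(d', e') \<in> L k A. vle A d d' \<longrightarrow> vle A e e')"
    and ex_upper: "d \<in> D k A \<Longrightarrow> \<exists>e. (d, e) \<in> L k A \<and> (\<forall>(d', e') \<in> L k A. vle A d' d \<longrightarrow> vle A e' e)"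
proof (induction A arbitrary: d e d' e')
  case TO
  { case 1 then show ?case by auto }
  { case 2
    then obtain P where P: "d = VO P" "P \<subseteq> states_le \<A> k" by auto
    moreover have "states_le \<A> k \<subseteq> states_le \<A> (Suc k)" by (auto simp: states_le_def)
    ultimately have "(d, d) \<in> L k TO" by auto
    moreover have "\<forall>(d', e') \<in> L k TO. vle TO d d' \<longrightarrow> vle TO d e'" by auto
    ultimately show ?case by blast }
  { case 3
    then obtain P where P: "d = VO P" "P \<subseteq> states_le \<A> k" by auto
    \<comment> \<open>All states of rank exactly \<open>Suc k\<close> are added: the projection
      forgets them, so this is the largest set over \<open>P\<close>.\<close>
    let ?e = "VO (P \<union> (states_le \<A> (Suc k) - states_le \<A> k))"
    have "states_le \<A> k \<subseteq> states_le \<A> (Suc k)" by (auto simp: states_le_def)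
    then have "(d, ?e) \<in> L k TO" using P by auto
    moreover have "\<forall>(d', e') \<in> L k TO. vle TO d' d \<longrightarrow> vle TO e' ?e" using P by auto
    ultimately show ?case by blast }
next
  case (Fn A B)
  { case 1
    show ?case
      unfolding vle_fun[OF conjunct1[OF L_D[OF 1(1)]]]
    proof
      fix g assume "g \<in> D k A"
      then obtain g2 where g2: "(g, g2) \<in> L k A" using Fn.IH(2) by blast
      have "vle B (vapp e g2) (vapp e' g2)"
        using vle_app[OF _ 1(3)] L_D[OF 1(1)] L_D[OF g2] by blast
      then show "vle B (vapp d g) (vapp d' g)"
        using Fn.IH(4) L_app[OF 1(1) g2] L_app[OF 1(2) g2] by blast
    qed }
  \<comment> \<open>The projection on the argument type, chosen as a function; by
    \<open>L_mono\<close> for \<open>A\<close> it is independent of the choice and monotone.\<close>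
  have "\<forall>e \<in> D (Suc k) A. \<exists>d. (d, e) \<in> L k A"
    using L_exists by blast
  from bchoice[OF this] obtain dn where dn: "\<And>e. e \<in> D (Suc k) A \<Longrightarrow> (dn e, e) \<in> L k A"
    by blast
  then have dn_eq: "dn e = d" if "(d, e) \<in> L k A" for d e
  proof -
    have e: "e \<in> D (Suc k) A" "d \<in> D k A" using L_D[OF that] by auto
    note dn = dn[OF e(1)]
    show ?thesis
      using vle_antisym[OF _ e(2) Fn.IH(1)[OF dn that] Fn.IH(1)[OF that dn]] L_D[OF dn] vle_refl[OF e(1)]
      by blast
  qed
  have dn_mono: "vle A (dn x) (dn y)" if "x \<in> D (Suc k) A" "y \<in> D (Suc k) A" "vle A x y" for x y
    using Fn.IH(1) dn that by blast
  have dn_D: "dn x \<in> D k A" if "x \<in> D (Suc k) A" for x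
    using dn that L_D by blast
  { case 2
    have "\<forall>d \<in> D k B. \<exists>e. (d, e) \<in> L k B \<and> (\<forall>(d', e') \<in> L k B. vle B d d' \<longrightarrow> vle B e e')"
      using Fn.IH(5) by blast
    from bchoice[OF this] obtain u where u: "\<And>d. d \<in> D k B \<Longrightarrow> (d, u d) \<in> L k B"
        "\<And>d d' e'. d \<in> D k B \<Longrightarrow> (d', e') \<in> L k B \<Longrightarrow> vle B d d' \<Longrightarrow> vle B (u d) e'"
      by blast
    \<comment> \<open>Conjugation: project the argument, apply \<open>d\<close>, lift the result
      with the adjoint \<open>u\<close> of the result type. The other lifting differs only in
      \<open>u\<close>.\<close>
    let ?f = "vlam (D (Suc k) A) (\<lambda>x. u (vapp d (dn x)))"
    have "(d, ?f) \<in> L k (A \<rightarrow>\<^sub>t B)"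
    proof (rule L_funI)
      show "u (vapp d (dn x)) \<in> D (Suc k) B" if "x \<in> D (Suc k) A" for x
        using u(1) L_D D_app[OF 2 dn_D[OF that]] by blast
      show "vle B (u (vapp d (dn x))) (u (vapp d (dn x')))"
        if x: "x \<in> D (Suc k) A" "x' \<in> D (Suc k) A" "vle A x x'" for x x'
      proof -
        note dnx = dn_D[OF x(1)] dn_D[OF x(2)]
        note app = D_app[OF 2 dnx(1)] D_app[OF 2 dnx(2)] D_app_mono[OF 2 dnx dn_mono[OF x]]
        show ?thesis by (rule u(2)) (use app u(1) in blast)+
      qed
      show "(vapp d g1, u (vapp d (dn g2))) \<in> L k B" if "(g1, g2) \<in> L k A" for g1 g2
        using u(1) D_app[OF 2] dn_eq[OF that] L_D[OF that] by simp
    qed (rule 2)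
    moreover have "vle (A \<rightarrow>\<^sub>t B) ?f e'" if "(d', e') \<in> L k (A \<rightarrow>\<^sub>t B)" "vle (A \<rightarrow>\<^sub>t B) d d'" for d' e'
      unfolding vle_lam
    proof
      fix x assume x: "x \<in> D (Suc k) A"
      then have "vle B (vapp d (dn x)) (vapp d' (dn x))"
        using vle_app[OF 2 that(2)] dn_D by blast
      then show "vle B (u (vapp d (dn x))) (vapp e' x)"
        using u(2) L_app[OF that(1) dn[OF x]] 2 dn_D D_app x by blast
    qed
    ultimately show ?case by blast }
  { case 3
    have "\<forall>d \<in> D k B. \<exists>e. (d, e) \<in> L k B \<and> (\<forall>(d', e') \<in> L k B. vle B d' d \<longrightarrow> vle B e' e)"
      using Fn.IH(6) by blast
    from bchoice[OF this] obtain u where u: "\<And>d. d \<in> D k B \<Longrightarrow> (d, u d) \<in> L k B"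
        "\<And>d d' e'. d \<in> D k B \<Longrightarrow> (d', e') \<in> L k B \<Longrightarrow> vle B d' d \<Longrightarrow> vle B e' (u d)"
      by blast
    let ?f = "vlam (D (Suc k) A) (\<lambda>x. u (vapp d (dn x)))"
    have "(d, ?f) \<in> L k (A \<rightarrow>\<^sub>t B)"
    proof (rule L_funI)
      show "u (vapp d (dn x)) \<in> D (Suc k) B" if "x \<in> D (Suc k) A" for x
        using u(1) L_D D_app[OF 3 dn_D[OF that]] by blast
      show "vle B (u (vapp d (dn x))) (u (vapp d (dn x')))"
        if x: "x \<in> D (Suc k) A" "x' \<in> D (Suc k) A" "vle A x x'" for x x'
      proof -
        note dnx = dn_D[OF x(1)] dn_D[OF x(2)]
        note app = D_app[OF 3 dnx(1)] D_app[OF 3 dnx(2)] D_app_mono[OF 3 dnx dn_mono[OF x]]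
        show ?thesis by (rule u(2)) (use app u(1) in blast)+
      qed
      show "(vapp d g1, u (vapp d (dn g2))) \<in> L k B" if "(g1, g2) \<in> L k A" for g1 g2
        using u(1) D_app[OF 3] dn_eq[OF that] L_D[OF that] by simp
    qed (rule 3)
    moreover have "vle (A \<rightarrow>\<^sub>t B) e' ?f" if L': "(d', e') \<in> L k (A \<rightarrow>\<^sub>t B)" "vle (A \<rightarrow>\<^sub>t B) d' d" for d' e'
      unfolding vle_fun[OF conjunct2[OF L_D[OF L'(1)]]]
    proof
      fix x assume x: "x \<in> D (Suc k) A"
      then have "vle B (vapp d' (dn x)) (vapp d (dn x))"
        using vle_app[OF _ L'(2)] L_D[OF L'(1)] dn_D by blast
      then show "vle B (vapp e' x) (vapp ?f x)"
        using u(2) L_app[OF L'(1) dn[OF x]] 3 dn_D D_app x by (simp add: app_lam)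
    qed
    ultimately show ?case by blast }
qed

lemma L_unique: "(d, e) \<in> L k A \<Longrightarrow> (d', e) \<in> L k A \<Longrightarrow> d = d'"
  by (meson L_D L_mono vle_antisym vle_refl)

lemma down_L: "(d, e) \<in> L k A \<Longrightarrow> down \<A> (Suc k) A e = d"
  unfolding down_def using L_unique by blast

lemma L_down: "e \<in> D (Suc k) A \<Longrightarrow> (down \<A> (Suc k) A e, e) \<in> L k A"
  using L_exists down_L by metis

text \<open>By definition \<open>up_bot\<close> is least only among the elements over
  \<open>d\<close> itself. The comparison with elements over any larger \<open>d'\<close> makes it a
  left adjoint, and is inherited from the witness of \<open>ex_lower\<close>.\<close>

lemma up_bot_galois:
  assumes "d \<in> D k A"
  shows L_up_bot: "(d, up_bot \<A> (Suc k) A d) \<in> L k A"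
    and up_bot_least: "(d', e') \<in> L k A \<Longrightarrow> vle A d d' \<Longrightarrow> vle A (up_bot \<A> (Suc k) A d) e'"
proof -
  obtain e where e: "(d, e) \<in> L k A" "\<And>d' e'. (d', e') \<in> L k A \<Longrightarrow> vle A d d' \<Longrightarrow> vle A e e'"
    using ex_lower[OF assms] by blast
  have "up_bot \<A> (Suc k) A d = e"
    unfolding up_bot_def
  proof (rule the_equality)
    show "least (DL \<A> (Suc k) A) e {e. (d, e) \<in> L k A}"
      using e L_D vle_refl[OF assms] by (auto simp: least_def)
    show "e' = e" if "least (DL \<A> (Suc k) A) e' {e. (d, e) \<in> L k A}" for e'
    proof -
      have "(d, e') \<in> L k A" "vle A e' e" using that e(1) by (auto simp: least_def)
      then show ?thesis using vle_antisym e L_D vle_refl[OF assms] by meson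
    qed
  qed
  with e show "(d, up_bot \<A> (Suc k) A d) \<in> L k A"
    and "(d', e') \<in> L k A \<Longrightarrow> vle A d d' \<Longrightarrow> vle A (up_bot \<A> (Suc k) A d) e'" by auto
qed

lemma up_top_galois:
  assumes "d \<in> D k A"
  shows L_up_top: "(d, up_top \<A> (Suc k) A d) \<in> L k A"
    and up_top_greatest: "(d', e') \<in> L k A \<Longrightarrow> vle A d' d \<Longrightarrow> vle A e' (up_top \<A> (Suc k) A d)"
proof -
  obtain e where e: "(d, e) \<in> L k A" "\<And>d' e'. (d', e') \<in> L k A \<Longrightarrow> vle A d' d \<Longrightarrow> vle A e' e"
    using ex_upper[OF assms] by blast
  have "up_top \<A> (Suc k) A d = e"
    unfolding up_top_def
  proof (rule the_equality)
    show "greatest (DL \<A> (Suc k) A) e {e. (d, e) \<in> L k A}"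
      using e L_D vle_refl[OF assms] by (auto simp: greatest_def)
    show "e' = e" if "greatest (DL \<A> (Suc k) A) e' {e. (d, e) \<in> L k A}" for e'
    proof -
      have "(d, e') \<in> L k A" "vle A e e'" using that e(1) by (auto simp: greatest_def)
      then show ?thesis using vle_antisym e L_D vle_refl[OF assms] by meson
    qed
  qed
  with e show "(d, up_top \<A> (Suc k) A d) \<in> L k A"
    and "(d', e') \<in> L k A \<Longrightarrow> vle A d' d \<Longrightarrow> vle A e' (up_top \<A> (Suc k) A d)" by auto
qed


subsection \<open>Joins\<close>

text \<open>The join of \<open>DL\<close> is picked by a choice operator, so an explicit candidate
  has to be exhibited before anything is known about it.\<close>

primrec vsup :: "nat \<Rightarrow> ty \<Rightarrow> 'q val set \<Rightarrow> 'q val" where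
  "vsup k TO X = VO (\<Union> (base ` X))"
| "vsup k (A \<rightarrow>\<^sub>t B) X = vlam (D k A) (\<lambda>h. vsup k B ((\<lambda>f. vapp f h) ` X))"

abbreviation vbot :: "nat \<Rightarrow> ty \<Rightarrow> 'q val" where "vbot k A \<equiv> vsup k A {}"

lemma vsup_upper: "X \<subseteq> D k A \<Longrightarrow> x \<in> X \<Longrightarrow> vle A x (vsup k A X)"
proof (induction A arbitrary: X x)
  case (Fn A B)
  then have x: "x \<in> D k (A \<rightarrow>\<^sub>t B)" by blast
  have "vle B (vapp x h) (vsup k B ((\<lambda>f. vapp f h) ` X))" if "h \<in> D k A" for h
    using Fn.IH(2)[of "(\<lambda>f. vapp f h) ` X" "vapp x h"] Fn.prems that D_app by blast
  then show ?case by (simp add: vle_fun[OF x] app_lam)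
qed auto

lemma vsup_least: "X \<subseteq> D k A \<Longrightarrow> (\<And>x. x \<in> X \<Longrightarrow> vle A x y) \<Longrightarrow> vle A (vsup k A X) y"
proof (induction A arbitrary: X y)
  case (Fn A B)
  have "vle B (vsup k B ((\<lambda>f. vapp f h) ` X)) (vapp y h)" if h: "h \<in> D k A" for h
  proof (rule Fn.IH(2))
    show "(\<lambda>f. vapp f h) ` X \<subseteq> D k B" using Fn.prems(1) h D_app by blast
    show "vle B x (vapp y h)" if x: "x \<in> (\<lambda>f. vapp f h) ` X" for x
    proof -
      obtain f where f: "f \<in> X" "x = vapp f h" using x by blast
      then have "f \<in> D k (A \<rightarrow>\<^sub>t B)" using Fn.prems(1) by blast
      from vle_app[OF this Fn.prems(2)[OF f(1)] h] show ?thesis using f by simp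
    qed
  qed
  then show ?case by (simp only: vsup.simps vle_lam) blast
qed auto

lemma vsup_app: "h \<in> D k A \<Longrightarrow> vapp (vsup k (A \<rightarrow>\<^sub>t B) X) h = vsup k B ((\<lambda>f. vapp f h) ` X)"
  by (simp add: app_lam)

text \<open>The step from \<open>k\<close> to \<open>Suc k\<close> in closure under joins.
  \<open>IH\<close> supplies the lower component, which at a function type must already be an
  element of \<open>D k\<close>.\<close>

lemma L_vsup_step:
  assumes IH: "\<And>A X. X \<subseteq> D k A \<Longrightarrow> vsup k A X \<in> D k A"
  shows "R \<subseteq> L k A \<Longrightarrow> (vsup k A (fst ` R), vsup (Suc k) A (snd ` R)) \<in> L k A"
proof (induction A arbitrary: R)
  case TO
  have "base (fst r) = base (snd r) \<inter> states_le \<A> k \<and> base (snd r) \<subseteq> states_le \<A> (Suc k)" if "r \<in> R" for r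
    using subsetD[OF TO that] by auto
  then show ?case by simp blast
next
  case (Fn A B)
  have R1: "fst ` R \<subseteq> D k (A \<rightarrow>\<^sub>t B)" and R2: "snd ` R \<subseteq> D (Suc k) (A \<rightarrow>\<^sub>t B)"
    using Fn.prems L_D by (metis (no_types, lifting) image_subsetI prod.collapse subsetD)+
  have B: "vsup (Suc k) B X \<in> D (Suc k) B" if "X \<subseteq> D (Suc k) B" for X
  proof -
    \<comment> \<open>Every set at level \<open>Suc k\<close> is the upper half of a family of
      related pairs, so relatedness of joins yields closure under joins.\<close>
    let ?R = "(\<lambda>e. (down \<A> (Suc k) B e, e)) ` X"
    have "?R \<subseteq> L k B" using that L_down by blast
    from L_D[OF Fn.IH(2)[OF this]] show ?thesis by (simp add: image_image)
  qed
  have sub: "(\<lambda>f. vapp f h) ` snd ` R \<subseteq> D (Suc k) B" if "h \<in> D (Suc k) A" for h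
    using R2 that D_app by blast
  show ?case
    unfolding vsup.simps(2)[of "Suc k"]
  proof (rule L_funI)
    show "vsup k (A \<rightarrow>\<^sub>t B) (fst ` R) \<in> D k (A \<rightarrow>\<^sub>t B)" using IH R1 by blast
    show "vsup (Suc k) B ((\<lambda>f. vapp f h) ` snd ` R) \<in> D (Suc k) B" if "h \<in> D (Suc k) A" for h
      using B sub that by blast
    show "vle B (vsup (Suc k) B ((\<lambda>f. vapp f h) ` snd ` R)) (vsup (Suc k) B ((\<lambda>f. vapp f h') ` snd ` R))"
      if h: "h \<in> D (Suc k) A" "h' \<in> D (Suc k) A" "vle A h h'" for h h'
    proof (rule vsup_least[OF sub[OF h(1)]])
      fix x assume "x \<in> (\<lambda>f. vapp f h) ` snd ` R"
      then obtain f where f: "f \<in> snd ` R" "x = vapp f h" by blast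
      then have fD: "f \<in> D (Suc k) (A \<rightarrow>\<^sub>t B)" using R2 by blast
      have "vle B (vapp f h') (vsup (Suc k) B ((\<lambda>f. vapp f h') ` snd ` R))"
        by (rule vsup_upper[OF sub[OF h(2)]]) (use f in blast)
      then show "vle B x (vsup (Suc k) B ((\<lambda>f. vapp f h') ` snd ` R))"
        using vle_trans[OF D_app[OF fD h(1)] D_app[OF fD h(2)] D_app_mono[OF fD h]] f by blast
    qed
    show "(vapp (vsup k (A \<rightarrow>\<^sub>t B) (fst ` R)) g1, vsup (Suc k) B ((\<lambda>f. vapp f g2) ` snd ` R)) \<in> L k B"
      if g: "(g1, g2) \<in> L k A" for g1 g2
    proof -
      let ?R = "(\<lambda>(f1, f2). (vapp f1 g1, vapp f2 g2)) ` R"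
      have "?R \<subseteq> L k B" using Fn.prems L_app[OF _ g] by fastforce
      from Fn.IH(2)[OF this] show ?thesis
        using L_D[OF g] by (simp add: vsup_app image_image case_prod_unfold del: vsup.simps)
    qed
  qed
qed

lemma vsup_D: "X \<subseteq> D k A \<Longrightarrow> vsup k A X \<in> D k A"
proof (induction k arbitrary: A X)
  case 0
  then show ?case
  proof (induction A arbitrary: X)
    case TO
    have "base x \<subseteq> states_le \<A> 0" if "x \<in> X" for x using subsetD[OF TO that] by auto
    then show ?case by simp blast
  next
    case (Fn A B)
    have sub: "(\<lambda>f. vapp f h) ` X \<subseteq> D 0 B" if "h \<in> D 0 A" for h
      using Fn.prems that D_app by blast
    have "vlam (D 0 A) (\<lambda>h. vsup 0 B ((\<lambda>f. vapp f h) ` X)) \<in> mono_maps A B (D 0 A) (D 0 B)"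
    proof (rule vlam_in_mono_maps[OF finite_D])
      fix h h' assume h: "h \<in> D 0 A" "h' \<in> D 0 A" "vle A h h'"
      show "vle B (vsup 0 B ((\<lambda>f. vapp f h) ` X)) (vsup 0 B ((\<lambda>f. vapp f h') ` X))"
      proof (rule vsup_least[OF sub[OF h(1)]])
        fix x assume "x \<in> (\<lambda>f. vapp f h) ` X"
        then obtain f where f: "f \<in> X" "x = vapp f h" by blast
        then have fD: "f \<in> D 0 (A \<rightarrow>\<^sub>t B)" using Fn.prems by blast
        have "vle B (vapp f h') (vsup 0 B ((\<lambda>f. vapp f h') ` X))"
          by (rule vsup_upper[OF sub[OF h(2)]]) (use f in blast)
        then show "vle B x (vsup 0 B ((\<lambda>f. vapp f h') ` X))"
          using vle_trans[OF D_app[OF fD h(1)] D_app[OF fD h(2)] D_app_mono[OF fD h]] f by blast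
      qed
    qed (use Fn.IH(2) sub in blast)
    then show ?case by (simp add: Dom.simps)
  qed
next
  case (Suc k)
  let ?R = "(\<lambda>e. (down \<A> (Suc k) A e, e)) ` X"
  have "?R \<subseteq> L k A" using Suc.prems L_down by blast
  from L_D[OF L_vsup_step[OF Suc.IH this]] show ?case by (simp add: image_image)
qed

lemma L_vsup: "R \<subseteq> L k A \<Longrightarrow> (vsup k A (fst ` R), vsup (Suc k) A (snd ` R)) \<in> L k A"
  using L_vsup_step vsup_D by blast

lemma vbot_D: "vbot k A \<in> D k A"
  by (simp add: vsup_D)

lemma vbot_le: "vle A (vbot k A) y"
  by (rule vsup_least) auto

lemma L_vbot: "(vbot k A, vbot (Suc k) A) \<in> L k A"
  using L_vsup[where R = "{}"] by simp

lemma Sup_eq_vsup: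
  assumes "X \<subseteq> D k A"
  shows "\<Squnion>\<^bsub>DL \<A> k A\<^esub> X = vsup k A X"
  unfolding Lattice.sup_def
proof (rule some_equality)
  show *: "least (DL \<A> k A) (vsup k A X) (Upper (DL \<A> k A) X)"
    using assms vsup_D[OF assms] vsup_upper[OF assms]
    by (auto simp: least_def Upper_def intro!: vsup_least[OF assms])
  fix y assume "least (DL \<A> k A) y (Upper (DL \<A> k A) X)"
  with * show "y = vsup k A X"
    by (auto simp: least_def Upper_def intro: vle_antisym)
qed

lemma bottom_eq_vbot: "\<bottom>\<^bsub>DL \<A> k A\<^esub> = vbot k A"
  unfolding bottom_def
proof (rule some_equality)
  show *: "least (DL \<A> k A) (vbot k A) (carrier (DL \<A> k A))"
    using vbot_D vbot_le by (auto simp: least_def)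
  fix y assume "least (DL \<A> k A) y (carrier (DL \<A> k A))"
  with * show "y = vbot k A"
    by (auto simp: least_def intro: vle_antisym)
qed

lemma top_greatest: "\<top>\<^bsub>DL \<A> k A\<^esub> \<in> D k A \<and> (\<forall>x \<in> D k A. vle A x \<top>\<^bsub>DL \<A> k A\<^esub>)"
proof -
  have "greatest (DL \<A> k A) (vsup k A (D k A)) (carrier (DL \<A> k A))"
    using vsup_D vsup_upper by (auto simp: greatest_def)
  then have "greatest (DL \<A> k A) \<top>\<^bsub>DL \<A> k A\<^esub> (carrier (DL \<A> k A))"
    unfolding top_def by (rule someI)
  then show ?thesis by (auto simp: greatest_def)
qed

text \<open>The suprema and infima in \<open>fixp\<close> range over iterates that stabilise, so
  they are attained.\<close>

lemma Sup_eq_max: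
  assumes "y \<in> X" "y \<in> D k A" "\<And>x. x \<in> X \<Longrightarrow> vle A x y"
  shows "\<Squnion>\<^bsub>DL \<A> k A\<^esub> X = y"
  unfolding Lattice.sup_def using assms
  by (intro some_equality) (auto simp: least_def Upper_def intro: vle_antisym)

lemma Inf_eq_min:
  assumes "y \<in> X" "y \<in> D k A" "\<And>x. x \<in> X \<Longrightarrow> vle A y x"
  shows "\<Sqinter>\<^bsub>DL \<A> k A\<^esub> X = y"
  unfolding Lattice.inf_def using assms
  by (intro some_equality) (auto simp: greatest_def Lower_def intro: vle_antisym)


subsection \<open>Fixpoints\<close>

lemma funpow_D: "f \<in> D k (A \<rightarrow>\<^sub>t A) \<Longrightarrow> a \<in> D k A \<Longrightarrow> (vapp f ^^ n) a \<in> D k A"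
  by (induction n) (auto intro: D_app)

lemma L_funpow:
  "(f1, f2) \<in> L k (A \<rightarrow>\<^sub>t A) \<Longrightarrow> (a1, a2) \<in> L k A \<Longrightarrow> ((vapp f1 ^^ n) a1, (vapp f2 ^^ n) a2) \<in> L k A"
  by (induction n) (auto intro: L_app)

lemma Inf_iterate:
  assumes f: "f \<in> D k (A \<rightarrow>\<^sub>t A)" and a: "a \<in> D k A" and "vle A (vapp f a) a"
  obtains N where "\<Sqinter>\<^bsub>DL \<A> k A\<^esub> (range (\<lambda>n. (vapp f ^^ n) a)) = (vapp f ^^ N) a"
    "vapp f ((vapp f ^^ N) a) = (vapp f ^^ N) a"
proof -
  obtain N where N: "vapp f ((vapp f ^^ N) a) = (vapp f ^^ N) a"
      "\<And>n. vle A ((vapp f ^^ N) a) ((vapp f ^^ n) a)"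
  proof (rule iterate_stabilises[of "D k A" a "vapp f" "vle A", OF finite_D a])
    show "vapp f x \<in> D k A" "vle A x x" if "x \<in> D k A" for x
      using D_app[OF f that] vle_refl[OF that] by auto
    show "vle A x z" if "x \<in> D k A" "y \<in> D k A" "z \<in> D k A" "vle A x y" "vle A y z" for x y z
      by (rule vle_trans[OF that(1,2,4,5)])
  qed (use D_app_mono[OF f] vle_antisym assms(3) in blast)+
  have "\<Sqinter>\<^bsub>DL \<A> k A\<^esub> (range (\<lambda>n. (vapp f ^^ n) a)) = (vapp f ^^ N) a"
    by (rule Inf_eq_min) (use N funpow_D[OF f a] in auto)
  with N show thesis using that by blast
qed

lemma Sup_iterate:
  assumes f: "f \<in> D k (A \<rightarrow>\<^sub>t A)" and a: "a \<in> D k A" and "vle A a (vapp f a)"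
  obtains N where "\<Squnion>\<^bsub>DL \<A> k A\<^esub> (range (\<lambda>n. (vapp f ^^ n) a)) = (vapp f ^^ N) a"
    "vapp f ((vapp f ^^ N) a) = (vapp f ^^ N) a"
proof -
  obtain N where N: "vapp f ((vapp f ^^ N) a) = (vapp f ^^ N) a"
      "\<And>n. vle A ((vapp f ^^ n) a) ((vapp f ^^ N) a)"
  proof (rule iterate_stabilises[of "D k A" a "vapp f" "\<lambda>x y. vle A y x", OF finite_D a])
    show "vapp f x \<in> D k A" "vle A x x" if "x \<in> D k A" for x
      using D_app[OF f that] vle_refl[OF that] by auto
    show "vle A z x" if "x \<in> D k A" "y \<in> D k A" "z \<in> D k A" "vle A y x" "vle A z y" for x y z
      by (rule vle_trans[OF that(3,2,5,4)])
  qed (use D_app_mono[OF f] vle_antisym assms(3) in blast)+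
  have "\<Squnion>\<^bsub>DL \<A> k A\<^esub> (range (\<lambda>n. (vapp f ^^ n) a)) = (vapp f ^^ N) a"
    by (rule Sup_eq_max) (use N funpow_D[OF f a] in auto)
  with N show thesis using that by blast
qed

text \<open>Applied at the index where the iteration stops, this makes the limit the greatest
  post-fixpoint below the start.\<close>

lemma postfix_le_funpow:
  assumes f: "f \<in> D k (A \<rightarrow>\<^sub>t A)" and a: "a \<in> D k A" and e: "e \<in> D k A"
    and "vle A e (vapp f e)" "vle A e a"
  shows "vle A e ((vapp f ^^ n) a)"
proof (induction n)
  case (Suc n)
  have "vle A (vapp f e) (vapp f ((vapp f ^^ n) a))"
    by (rule D_app_mono[OF f e funpow_D[OF f a] Suc])
  then show ?case using vle_trans[OF e D_app[OF f e] assms(4)] by simp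
qed (use assms in simp)

lemma funpow_le_prefix:
  assumes f: "f \<in> D k (A \<rightarrow>\<^sub>t A)" and a: "a \<in> D k A" and e: "e \<in> D k A"
    and "vle A (vapp f e) e" "vle A a e"
  shows "vle A ((vapp f ^^ n) a) e"
proof (induction n)
  case (Suc n)
  have "vle A (vapp f ((vapp f ^^ n) a)) (vapp f e)"
    by (rule D_app_mono[OF f funpow_D[OF f a] e Suc])
  then show ?case using vle_trans[OF D_app[OF f funpow_D[OF f a]] D_app[OF f e] _ assms(4)] by simp
qed (use assms in simp)

text \<open>The fixpoint property at level \<open>k\<close> is a hypothesis here, so that this can
  serve as the induction step of \<open>fixp_D_unfold\<close>.\<close>

lemma fixp_Suc_iterate:
  assumes L: "(f1, f2) \<in> L k (A \<rightarrow>\<^sub>t A)"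
    and p: "fixp \<A> k A f1 \<in> D k A" "vapp f1 (fixp \<A> k A f1) = fixp \<A> k A f1"
  obtains N where
    "fixp \<A> (Suc k) A f2 = (vapp f2 ^^ N)
       ((if even (Suc k) then up_top else up_bot) \<A> (Suc k) A (fixp \<A> k A f1))"
    "vapp f2 (fixp \<A> (Suc k) A f2) = fixp \<A> (Suc k) A f2"
    "(fixp \<A> k A f1, fixp \<A> (Suc k) A f2) \<in> L k A"
proof -
  let ?p = "fixp \<A> k A f1"
  let ?a = "(if even (Suc k) then up_top else up_bot) \<A> (Suc k) A ?p"
  have f2: "f2 \<in> D (Suc k) (A \<rightarrow>\<^sub>t A)" and down: "down \<A> (Suc k) (A \<rightarrow>\<^sub>t A) f2 = f1"
    using L L_D down_L by auto
  have a: "(?p, ?a) \<in> L k A" "?a \<in> D (Suc k) A"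
    using L_up_top[OF p(1)] L_up_bot[OF p(1)] L_D by auto
  \<comment> \<open>Since \<open>f1\<close> fixes \<open>?p\<close>, applying \<open>f2\<close> does
    not leave the fibre over \<open>?p\<close>. As \<open>?a\<close> is extremal there, it is
    comparable with \<open>vapp f2 ?a\<close>.\<close>
  then have fa: "(?p, vapp f2 ?a) \<in> L k A"
    using L_app[OF L a(1)] p(2) by simp
  have "\<exists>N. fixp \<A> (Suc k) A f2 = (vapp f2 ^^ N) ?a \<and>
      vapp f2 ((vapp f2 ^^ N) ?a) = (vapp f2 ^^ N) ?a"
  proof (cases "even (Suc k)")
    case True
    then have "vle A (vapp f2 ?a) ?a"
      using up_top_greatest[OF p(1) fa vle_refl[OF p(1)]] by simp
    then obtain N where
      "\<Sqinter>\<^bsub>DL \<A> (Suc k) A\<^esub> (range (\<lambda>n. (vapp f2 ^^ n) ?a)) = (vapp f2 ^^ N) ?a"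
      "vapp f2 ((vapp f2 ^^ N) ?a) = (vapp f2 ^^ N) ?a"
      using Inf_iterate[OF f2 a(2)] by blast
    moreover have "fixp \<A> (Suc k) A f2 = \<Sqinter>\<^bsub>DL \<A> (Suc k) A\<^esub> (range (\<lambda>n. (vapp f2 ^^ n) ?a))"
      using True by (simp add: Let_def down)
    ultimately show ?thesis by auto
  next
    case False
    then have "vle A ?a (vapp f2 ?a)"
      using up_bot_least[OF p(1) fa vle_refl[OF p(1)]] by simp
    then obtain N where
      "\<Squnion>\<^bsub>DL \<A> (Suc k) A\<^esub> (range (\<lambda>n. (vapp f2 ^^ n) ?a)) = (vapp f2 ^^ N) ?a"
      "vapp f2 ((vapp f2 ^^ N) ?a) = (vapp f2 ^^ N) ?a"
      using Sup_iterate[OF f2 a(2)] by blast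
    moreover have "fixp \<A> (Suc k) A f2 = \<Squnion>\<^bsub>DL \<A> (Suc k) A\<^esub> (range (\<lambda>n. (vapp f2 ^^ n) ?a))"
      using False by (simp add: Let_def down)
    ultimately show ?thesis by auto
  qed
  then obtain N where N: "fixp \<A> (Suc k) A f2 = (vapp f2 ^^ N) ?a"
      "vapp f2 ((vapp f2 ^^ N) ?a) = (vapp f2 ^^ N) ?a" by blast
  have "(vapp f1 ^^ N) ?p = ?p" by (induction N) (simp_all add: p(2))
  then have "(?p, fixp \<A> (Suc k) A f2) \<in> L k A"
    using L_funpow[OF L a(1), of N] N(1) by simp
  then show thesis using N by (intro that[of N]) simp_all
qed

lemma fixp_0_iterate:
  assumes "f \<in> D 0 (A \<rightarrow>\<^sub>t A)"
  obtains N where "fixp \<A> 0 A f = (vapp f ^^ N) \<top>\<^bsub>DL \<A> 0 A\<^esub>" "vapp f (fixp \<A> 0 A f) = fixp \<A> 0 A f"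
proof -
  have "\<top>\<^bsub>DL \<A> 0 A\<^esub> \<in> D 0 A" "vle A (vapp f \<top>\<^bsub>DL \<A> 0 A\<^esub>) \<top>\<^bsub>DL \<A> 0 A\<^esub>"
    using top_greatest[of 0 A] D_app[OF assms] by auto
  then show thesis by (rule Inf_iterate[OF assms]) (simp add: that)
qed

lemma fixp_D_unfold: "f \<in> D k (A \<rightarrow>\<^sub>t A) \<Longrightarrow> fixp \<A> k A f \<in> D k A \<and> vapp f (fixp \<A> k A f) = fixp \<A> k A f"
proof (induction k arbitrary: f)
  case 0
  obtain N where "fixp \<A> 0 A f = (vapp f ^^ N) \<top>\<^bsub>DL \<A> 0 A\<^esub>" "vapp f (fixp \<A> 0 A f) = fixp \<A> 0 A f"
    using fixp_0_iterate[OF 0] .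
  then show ?case using funpow_D[OF 0] top_greatest by simp
next
  case (Suc k)
  note L = L_down[OF Suc.prems]
  have "down \<A> (Suc k) (A \<rightarrow>\<^sub>t A) f \<in> D k (A \<rightarrow>\<^sub>t A)" using L_D[OF L] by blast
  note IH = Suc.IH[OF this]
  show ?case
    by (rule fixp_Suc_iterate[OF L conjunct1[OF IH] conjunct2[OF IH]]) (use L_D in blast)
qed

lemma fixp_D: "f \<in> D k (A \<rightarrow>\<^sub>t A) \<Longrightarrow> fixp \<A> k A f \<in> D k A"
  and fixp_unfold: "f \<in> D k (A \<rightarrow>\<^sub>t A) \<Longrightarrow> vapp f (fixp \<A> k A f) = fixp \<A> k A f"
  using fixp_D_unfold by auto

lemma L_fixp:
  assumes "(f1, f2) \<in> L k (A \<rightarrow>\<^sub>t A)"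
  shows "(fixp \<A> k A f1, fixp \<A> (Suc k) A f2) \<in> L k A"
proof -
  have f1: "f1 \<in> D k (A \<rightarrow>\<^sub>t A)" using L_D assms by blast
  show ?thesis by (rule fixp_Suc_iterate[OF assms fixp_D[OF f1] fixp_unfold[OF f1]])
qed

lemma fixp_odd:
  assumes "even k" "(f1, f2) \<in> L k (A \<rightarrow>\<^sub>t A)"
  obtains N where "fixp \<A> (Suc k) A f2 = (vapp f2 ^^ N) (up_bot \<A> (Suc k) A (fixp \<A> k A f1))"
proof -
  have f1: "f1 \<in> D k (A \<rightarrow>\<^sub>t A)" using L_D assms(2) by blast
  show thesis
    by (rule fixp_Suc_iterate[OF assms(2) fixp_D[OF f1] fixp_unfold[OF f1]])
      (use that assms(1) in simp)
qed

text \<open>Adjointness turns the bound on the projection into a bound of the starting point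
  \<open>up_bot\<close> by \<open>e\<close>; from there the iterates cannot pass a pre-fixpoint.
  \<open>fixp_even_greatest\<close> is the dual.\<close>

lemma fixp_odd_least:
  assumes k: "even k" and L: "(f1, f2) \<in> L k (A \<rightarrow>\<^sub>t A)" and e: "(d, e) \<in> L k A"
    and "vle A (vapp f2 e) e" "vle A (fixp \<A> k A f1) d"
  shows "vle A (fixp \<A> (Suc k) A f2) e"
proof -
  obtain N where N: "fixp \<A> (Suc k) A f2 = (vapp f2 ^^ N) (up_bot \<A> (Suc k) A (fixp \<A> k A f1))"
    using fixp_odd[OF k L] .
  have p: "fixp \<A> k A f1 \<in> D k A" using fixp_D L_D[OF L] by blast
  show ?thesis
    unfolding N using up_bot_least[OF p e assms(5)] L_D[OF L_up_bot[OF p]] L_D[OF L] L_D[OF e] assms(4)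
    by (intro funpow_le_prefix) auto
qed

lemma fixp_0_greatest:
  assumes f: "f \<in> D 0 (A \<rightarrow>\<^sub>t A)" and "e \<in> D 0 A" "vle A e (vapp f e)"
  shows "vle A e (fixp \<A> 0 A f)"
proof -
  obtain N where N: "fixp \<A> 0 A f = (vapp f ^^ N) \<top>\<^bsub>DL \<A> 0 A\<^esub>"
    using fixp_0_iterate[OF f] .
  show ?thesis
    unfolding N using assms top_greatest by (intro postfix_le_funpow) auto
qed

lemma fixp_even_greatest:
  assumes k: "odd k" and L: "(f1, f2) \<in> L k (A \<rightarrow>\<^sub>t A)" and e: "(d, e) \<in> L k A"
    and "vle A e (vapp f2 e)" "vle A d (fixp \<A> k A f1)"
  shows "vle A e (fixp \<A> (Suc k) A f2)"
proof -
  have f1: "f1 \<in> D k (A \<rightarrow>\<^sub>t A)" using L_D L by blast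
  obtain N where N: "fixp \<A> (Suc k) A f2 = (vapp f2 ^^ N) (up_top \<A> (Suc k) A (fixp \<A> k A f1))"
    by (rule fixp_Suc_iterate[OF L fixp_D[OF f1] fixp_unfold[OF f1]]) (use k in simp)
  have p: "fixp \<A> k A f1 \<in> D k A" using fixp_D L_D[OF L] by blast
  show ?thesis
    unfolding N using up_top_greatest[OF p e assms(5)] L_D[OF L_up_top[OF p]] L_D[OF L] L_D[OF e] assms(4)
    by (intro postfix_le_funpow) auto
qed

text \<open>Extremality does the work: at an odd level the fixpoint of \<open>g\<close> is a
  pre-fixpoint of \<open>f\<close>, at an even level the fixpoint of \<open>f\<close> is a
  post-fixpoint of \<open>g\<close>. Above level 0 the side condition on projections is the claim
  one level lower.\<close>

lemma fixp_mono:
  "f \<in> D k (A \<rightarrow>\<^sub>t A) \<Longrightarrow> g \<in> D k (A \<rightarrow>\<^sub>t A) \<Longrightarrow> vle (A \<rightarrow>\<^sub>t A) f g \<Longrightarrow>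
    vle A (fixp \<A> k A f) (fixp \<A> k A g)"
proof (induction k arbitrary: f g)
  case 0
  have "vle A (fixp \<A> 0 A f) (vapp g (fixp \<A> 0 A f))"
    using vle_app[OF 0(1,3) fixp_D[OF 0(1)]] by (simp only: fixp_unfold[OF 0(1)])
  then show ?case by (rule fixp_0_greatest[OF 0(2) fixp_D[OF 0(1)]])
next
  case (Suc k)
  let ?f1 = "down \<A> (Suc k) (A \<rightarrow>\<^sub>t A) f" and ?g1 = "down \<A> (Suc k) (A \<rightarrow>\<^sub>t A) g"
  have Lf: "(?f1, f) \<in> L k (A \<rightarrow>\<^sub>t A)" and Lg: "(?g1, g) \<in> L k (A \<rightarrow>\<^sub>t A)"
    using L_down Suc.prems by auto
  have le: "vle A (fixp \<A> k A ?f1) (fixp \<A> k A ?g1)"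
    using Suc.IH L_D[OF Lf] L_D[OF Lg] L_mono[OF Lf Lg Suc.prems(3)] by blast
  show ?case
  proof (cases "even k")
    case True
    have "vle A (vapp f (fixp \<A> (Suc k) A g)) (fixp \<A> (Suc k) A g)"
      using vle_app[OF Suc.prems(1,3) fixp_D[OF Suc.prems(2)]]
      by (simp only: fixp_unfold[OF Suc.prems(2)])
    then show ?thesis by (rule fixp_odd_least[OF True Lf L_fixp[OF Lg] _ le])
  next
    case False
    have "vle A (fixp \<A> (Suc k) A f) (vapp g (fixp \<A> (Suc k) A f))"
      using vle_app[OF Suc.prems(1,3) fixp_D[OF Suc.prems(1)]]
      by (simp only: fixp_unfold[OF Suc.prems(1)])
    then show ?thesis by (rule fixp_even_greatest[OF False Lg L_fixp[OF Lf] _ le])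
  qed
qed

subsection \<open>Interpretation of terms\<close>

lemma lam_D0:
  assumes "\<And>x. x \<in> D 0 A \<Longrightarrow> h x \<in> D 0 B"
    and "\<And>x x'. x \<in> D 0 A \<Longrightarrow> x' \<in> D 0 A \<Longrightarrow> vle A x x' \<Longrightarrow> vle B (h x) (h x')"
  shows "vlam (D 0 A) h \<in> D 0 (A \<rightarrow>\<^sub>t B)"
  unfolding Dom.simps by (rule vlam_in_mono_maps[OF finite_D]) (use assms in auto)

section \<open>Constants of the signature\<close>

lemma sig_cases:
  assumes "sig \<A> c = Some A"
  obtains "A = TO" | "A = TO \<rightarrow>\<^sub>t TO \<rightarrow>\<^sub>t TO"
  using weak assms by (auto simp: weak_automaton_def ran_def)

definition const2_app :: "nat \<Rightarrow> 'c \<Rightarrow> 'q val \<Rightarrow> 'q val \<Rightarrow> 'q val" where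
  "const2_app k a u0 u1 = VO {q \<in> states_le \<A> k.
     (base u0 \<inter> states_le \<A> (rank \<A> q), base u1 \<inter> states_le \<A> (rank \<A> q)) \<in> delta2 \<A> q a}"

lemma const2_val_eq:
  "const2_val \<A> k a = vlam (D k TO) (\<lambda>u0. vlam (D k TO) (const2_app k a u0))"
  by (simp add: const2_val_def const2_app_def[abs_def])

lemma const2_app_D: "const2_app k a u0 u1 \<in> D k TO"
  by (auto simp: const2_app_def)

text \<open>Truncation puts all arguments inside \<open>states_le \<A> (rank \<A> q)\<close>, the
  range in which transitions are closed under enlargement.\<close>

lemma const2_app_mono:
  assumes a: "sig \<A> a = Some (TO \<rightarrow>\<^sub>t TO \<rightarrow>\<^sub>t TO)" and "vle TO u0 u0'" "vle TO u1 u1'"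
  shows "vle TO (const2_app k a u0 u1) (const2_app k a u0' u1')"
proof -
  have "(base u0' \<inter> states_le \<A> (rank \<A> q), base u1' \<inter> states_le \<A> (rank \<A> q)) \<in> delta2 \<A> q a"
    if "q \<in> states_le \<A> k"
      "(base u0 \<inter> states_le \<A> (rank \<A> q), base u1 \<inter> states_le \<A> (rank \<A> q)) \<in> delta2 \<A> q a" for q
  proof -
    have "monotone_transitions \<A>" "q \<in> states \<A>"
      using weak that(1) by (auto simp: weak_automaton_def states_le_def)
    moreover have "base u0 \<inter> states_le \<A> (rank \<A> q) \<subseteq> base u0' \<inter> states_le \<A> (rank \<A> q)"
      "base u1 \<inter> states_le \<A> (rank \<A> q) \<subseteq> base u1' \<inter> states_le \<A> (rank \<A> q)"
      using assms(2,3) by auto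
    ultimately show ?thesis
      using a that(2) unfolding monotone_transitions_def by blast
  qed
  then show ?thesis by (auto simp: const2_app_def)
qed

text \<open>A state of level \<open>k\<close> inspects only states of rank at most its own, on which
  related arguments agree; states of rank \<open>Suc k\<close> are invisible to it.\<close>

lemma L_const2_app:
  assumes "(u0, v0) \<in> L k TO" "(u1, v1) \<in> L k TO"
  shows "(const2_app k a u0 u1, const2_app (Suc k) a v0 v1) \<in> L k TO"
proof -
  have "base u0 \<inter> states_le \<A> (rank \<A> q) = base v0 \<inter> states_le \<A> (rank \<A> q)"
    "base u1 \<inter> states_le \<A> (rank \<A> q) = base v1 \<inter> states_le \<A> (rank \<A> q)"
    if "q \<in> states_le \<A> k" for q
    using that assms by (auto simp: states_le_def)
  moreover have "states_le \<A> k \<subseteq> states_le \<A> (Suc k)"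
    by (auto simp: states_le_def)
  ultimately show ?thesis by (auto simp: const2_app_def)
qed

lemma const2_val_mono:
  assumes "sig \<A> a = Some (TO \<rightarrow>\<^sub>t TO \<rightarrow>\<^sub>t TO)" "vle TO u u'"
  shows "vle (TO \<rightarrow>\<^sub>t TO) (vlam (D k TO) (const2_app k a u)) (vlam (D k TO) (const2_app k a u'))"
  unfolding vle_lam by (metis app_lam const2_app_mono assms vle_refl)

lemma L_const2_val_step:
  assumes a: "sig \<A> a = Some (TO \<rightarrow>\<^sub>t TO \<rightarrow>\<^sub>t TO)"
    and IH: "const2_val \<A> k a \<in> D k (TO \<rightarrow>\<^sub>t TO \<rightarrow>\<^sub>t TO)"
  shows "(const2_val \<A> k a, const2_val \<A> (Suc k) a) \<in> L k (TO \<rightarrow>\<^sub>t TO \<rightarrow>\<^sub>t TO)"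
proof -
  have inner: "(vapp (const2_val \<A> k a) g1, vlam (D (Suc k) TO) (const2_app (Suc k) a g2)) \<in> L k (TO \<rightarrow>\<^sub>t TO)"
    if g: "(g1, g2) \<in> L k TO" for g1 g2
  proof (rule L_funI)
    have g1: "g1 \<in> D k TO" using L_D[OF g] by blast
    show "vapp (const2_val \<A> k a) g1 \<in> D k (TO \<rightarrow>\<^sub>t TO)" by (rule D_app[OF IH g1])
    show "(vapp (vapp (const2_val \<A> k a) g1) h1, const2_app (Suc k) a g2 h2) \<in> L k TO"
      if h: "(h1, h2) \<in> L k TO" for h1 h2
      using L_const2_app[OF g h] g1 L_D[OF h] by (simp only: const2_val_eq app_lam)
  qed (use const2_app_D const2_app_mono[OF a] in auto)
  show ?thesis
    unfolding const2_val_eq[of "Suc k"]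
  proof (rule L_funI[OF IH])
    show "vlam (D (Suc k) TO) (const2_app (Suc k) a x) \<in> D (Suc k) (TO \<rightarrow>\<^sub>t TO)" if "x \<in> D (Suc k) TO" for x
      using L_D[OF inner[OF L_down[OF that]]] by blast
  qed (use inner const2_val_mono[OF a] in blast)+
qed

lemma const2_val_D: "sig \<A> a = Some (TO \<rightarrow>\<^sub>t TO \<rightarrow>\<^sub>t TO) \<Longrightarrow> const2_val \<A> k a \<in> D k (TO \<rightarrow>\<^sub>t TO \<rightarrow>\<^sub>t TO)"
proof (induction k)
  case 0
  show ?case
    unfolding const2_val_eq
    by (intro lam_D0 const2_app_D const2_val_mono[OF 0] const2_app_mono[OF 0]) simp_all
next
  case (Suc k)
  then show ?case using L_const2_val_step L_D by blast
qed

lemma L_const2_val: "sig \<A> a = Some (TO \<rightarrow>\<^sub>t TO \<rightarrow>\<^sub>t TO) \<Longrightarrow>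
    (const2_val \<A> k a, const2_val \<A> (Suc k) a) \<in> L k (TO \<rightarrow>\<^sub>t TO \<rightarrow>\<^sub>t TO)"
  using L_const2_val_step const2_val_D by blast

lemma L_const0_val: "(const0_val \<A> k c, const0_val \<A> (Suc k) c) \<in> L k TO"
  by (auto simp: const0_val_def states_le_def)

lemma const0_val_D: "const0_val \<A> k c \<in> D k TO"
  by (auto simp: const0_val_def)

lemma L_const:
  assumes "sig \<A> c = Some A"
  shows "(interp \<A> k (Cst c) v, interp \<A> (Suc k) (Cst c) v') \<in> L k A"
  by (cases rule: sig_cases[OF assms])
    (use assms in \<open>auto simp del: Dom.simps Lrel.simps intro: L_const0_val L_const2_val\<close>)

lemma const_D:
  assumes "sig \<A> c = Some A"
  shows "interp \<A> k (Cst c) v \<in> D k A"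
  by (cases rule: sig_cases[OF assms])
    (use assms in \<open>auto simp del: Dom.simps intro: const0_val_D const2_val_D\<close>)

lemma const_mono:
  assumes "sig \<A> c = Some A"
  shows "vle A (interp \<A> k (Cst c) v) (interp \<A> k (Cst c) v')"
  using vle_refl[OF const_D[OF assms, of k v]] by (simp only: interp.simps)

lemma L_fixp_val_step:
  assumes "vlam (D k (A \<rightarrow>\<^sub>t A)) (fixp \<A> k A) \<in> D k ((A \<rightarrow>\<^sub>t A) \<rightarrow>\<^sub>t A)"
  shows "(vlam (D k (A \<rightarrow>\<^sub>t A)) (fixp \<A> k A), vlam (D (Suc k) (A \<rightarrow>\<^sub>t A)) (fixp \<A> (Suc k) A))
    \<in> L k ((A \<rightarrow>\<^sub>t A) \<rightarrow>\<^sub>t A)"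
proof (rule L_funI[OF assms])
  show "(vapp (vlam (D k (A \<rightarrow>\<^sub>t A)) (fixp \<A> k A)) g1, fixp \<A> (Suc k) A g2) \<in> L k A"
    if "(g1, g2) \<in> L k (A \<rightarrow>\<^sub>t A)" for g1 g2
    using L_fixp[OF that] L_D[OF that] by (simp add: app_lam del: fixp.simps)
qed (auto simp del: fixp.simps intro: fixp_D fixp_mono)

lemma fixp_val_D: "vlam (D k (A \<rightarrow>\<^sub>t A)) (fixp \<A> k A) \<in> D k ((A \<rightarrow>\<^sub>t A) \<rightarrow>\<^sub>t A)"
proof (induction k)
  case 0
  show ?case by (rule lam_D0) (auto simp del: fixp.simps intro: fixp_D fixp_mono)
next
  case (Suc k)
  then show ?case using L_fixp_val_step L_D by blast
qed

text \<open>Membership of an abstraction is monotonicity of its body, and monotonicity of an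
  application needs membership of its parts; hence one simultaneous induction.\<close>

lemma interp_0:
  assumes "has_type (sig \<A>) M A"
  shows "\<forall>y \<in> fv M. v y \<in> D 0 (snd y) \<Longrightarrow> interp \<A> 0 M v \<in> D 0 A"
    and "\<forall>y \<in> fv M. v y \<in> D 0 (snd y) \<and> v' y \<in> D 0 (snd y) \<and> vle (snd y) (v y) (v' y) \<Longrightarrow>
      vle A (interp \<A> 0 M v) (interp \<A> 0 M v')"
  using assms
proof (induction arbitrary: v v' rule: has_type.induct)
  case (ht_Var x A)
  { case 1 then show ?case by simp }
  { case 2 then show ?case by simp }
next
  case (ht_Cst c A)
  { case 1 then show ?case using const_D[OF ht_Cst] by blast }
  { case 2 then show ?case using const_mono[OF ht_Cst] by blast }
next
  case (ht_Y A)
  { case 1 then show ?case using fixp_val_D by (simp del: fixp.simps) }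
  { case 2 then show ?case using vle_refl[OF fixp_val_D] by (simp only: interp.simps) }
next
  case (ht_App M A B N)
  { case 1
    have "interp \<A> 0 M v \<in> D 0 (A \<rightarrow>\<^sub>t B)" "interp \<A> 0 N v \<in> D 0 A"
      using ht_App.IH(1,3) 1 by auto
    then show ?case using D_app by simp }
  { case 2
    have M: "interp \<A> 0 M v \<in> D 0 (A \<rightarrow>\<^sub>t B)" "interp \<A> 0 M v' \<in> D 0 (A \<rightarrow>\<^sub>t B)"
      "vle (A \<rightarrow>\<^sub>t B) (interp \<A> 0 M v) (interp \<A> 0 M v')"
      using ht_App.IH(1,2) 2 by auto
    have N: "interp \<A> 0 N v \<in> D 0 A" "interp \<A> 0 N v' \<in> D 0 A" "vle A (interp \<A> 0 N v) (interp \<A> 0 N v')"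
      using ht_App.IH(3,4) 2 by auto
    show ?case
      using vle_trans[OF D_app[OF M(1) N(1)] D_app[OF M(1) N(2)] D_app_mono[OF M(1) N] vle_app[OF M(1,3) N(2)]]
      by simp }
next
  case (ht_Lam M B x A)
  { case 1
    show ?case
      unfolding interp.simps
    proof (rule lam_D0)
      show "interp \<A> 0 M (v((x, A) := d)) \<in> D 0 B" if "d \<in> D 0 A" for d
        by (rule ht_Lam.IH(1)) (use 1 that in auto)
      show "vle B (interp \<A> 0 M (v((x, A) := d))) (interp \<A> 0 M (v((x, A) := d')))"
        if "d \<in> D 0 A" "d' \<in> D 0 A" "vle A d d'" for d d'
        by (rule ht_Lam.IH(2)) (use 1 that vle_refl in auto)
    qed }
  { case 2
    have "vle B (interp \<A> 0 M (v((x, A) := d))) (interp \<A> 0 M (v'((x, A) := d)))" if "d \<in> D 0 A" for d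
      by (rule ht_Lam.IH(2)) (use 2 that vle_refl in auto)
    then show ?case by (simp add: vle_lam app_lam) }
qed

text \<open>\<open>IH\<close> provides the lower component of an abstraction as an element of
  \<open>D k\<close>. Monotonicity at \<open>Suc k\<close> travels along because
  \<open>L_funI\<close> asks for it in the abstraction case.\<close>

lemma interp_step:
  assumes IH: "\<And>M A v. has_type (sig \<A>) M A \<Longrightarrow> \<forall>y \<in> fv M. v y \<in> D k (snd y) \<Longrightarrow> interp \<A> k M v \<in> D k A"
    and "has_type (sig \<A>) M A"
  shows "\<forall>y \<in> fv M. (v1 y, v2 y) \<in> L k (snd y) \<Longrightarrow> (interp \<A> k M v1, interp \<A> (Suc k) M v2) \<in> L k A"
    and "\<forall>y \<in> fv M. v1 y \<in> D (Suc k) (snd y) \<and> v2 y \<in> D (Suc k) (snd y) \<and> vle (snd y) (v1 y) (v2 y) \<Longrightarrow>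
      vle A (interp \<A> (Suc k) M v1) (interp \<A> (Suc k) M v2)"
  using assms(2)
proof (induction arbitrary: v1 v2 rule: has_type.induct)
  case (ht_Var x A)
  { case 1 then show ?case by simp }
  { case 2 then show ?case by simp }
next
  case (ht_Cst c A)
  { case 1 then show ?case using L_const[OF ht_Cst] by blast }
  { case 2 then show ?case using const_mono[OF ht_Cst] by blast }
next
  case (ht_Y A)
  { case 1 then show ?case using L_fixp_val_step[OF fixp_val_D] by (simp del: fixp.simps) }
  { case 2 then show ?case using vle_refl[OF fixp_val_D] by (simp only: interp.simps) }
next
  case (ht_App M A B N)
  { case 1 then show ?case using ht_App.IH(1,3) by (auto intro!: L_app[of _ _ k A B]) }
  { case 2
    \<comment> \<open>The induction carries relatedness and monotonicity only; membership at
      \<open>Suc k\<close> is recovered by relating \<open>w\<close> to its pointwise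
      projection.\<close>
    have D: "interp \<A> (Suc k) P w \<in> D (Suc k) C"
      if "\<And>v1 v2. \<forall>y \<in> fv P. (v1 y, v2 y) \<in> L k (snd y) \<Longrightarrow> (interp \<A> k P v1, interp \<A> (Suc k) P v2) \<in> L k C"
        "\<forall>y \<in> fv P. w y \<in> D (Suc k) (snd y)" for P C w
      using L_D[OF that(1)[of "\<lambda>y. down \<A> (Suc k) (snd y) (w y)" w]] that(2) L_down by blast
    have M: "interp \<A> (Suc k) M v1 \<in> D (Suc k) (A \<rightarrow>\<^sub>t B)" "interp \<A> (Suc k) M v2 \<in> D (Suc k) (A \<rightarrow>\<^sub>t B)"
      by (rule D[OF ht_App.IH(1)]; use 2 in auto)+
    have M': "vle (A \<rightarrow>\<^sub>t B) (interp \<A> (Suc k) M v1) (interp \<A> (Suc k) M v2)"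
      using ht_App.IH(2) 2 by auto
    have N: "interp \<A> (Suc k) N v1 \<in> D (Suc k) A" "interp \<A> (Suc k) N v2 \<in> D (Suc k) A"
      by (rule D[OF ht_App.IH(3)]; use 2 in auto)+
    have N': "vle A (interp \<A> (Suc k) N v1) (interp \<A> (Suc k) N v2)"
      using ht_App.IH(4) 2 by auto
    show ?case
      using vle_trans[OF D_app[OF M(1) N(1)] D_app[OF M(1) N(2)] D_app_mono[OF M(1) N N'] vle_app[OF M(1) M' N(2)]]
      by simp }
next
  case (ht_Lam M B x A)
  { case 1
    have body: "(interp \<A> k M (v1((x, A) := d1)), interp \<A> (Suc k) M (v2((x, A) := d2))) \<in> L k B"
      if "(d1, d2) \<in> L k A" for d1 d2
      by (rule ht_Lam.IH(1)) (use 1 that in auto)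
    show ?case
      unfolding interp.simps(5)[of \<A> "Suc k"]
    proof (rule L_funI)
      show "interp \<A> k (Lam x A M) v1 \<in> D k (A \<rightarrow>\<^sub>t B)"
        by (rule IH[OF has_type.ht_Lam[OF ht_Lam.hyps]]) (use 1 L_D in blast)
      show "interp \<A> (Suc k) M (v2((x, A) := d)) \<in> D (Suc k) B" if "d \<in> D (Suc k) A" for d
        using L_D[OF body[OF L_down[OF that]]] by blast
      show "vle B (interp \<A> (Suc k) M (v2((x, A) := d))) (interp \<A> (Suc k) M (v2((x, A) := d')))"
        if d: "d \<in> D (Suc k) A" "d' \<in> D (Suc k) A" "vle A d d'" for d d'
      proof (rule ht_Lam.IH(2), rule ballI)
        fix y assume y: "y \<in> fv M"
        show "(v2((x, A) := d)) y \<in> D (Suc k) (snd y) \<and> (v2((x, A) := d')) y \<in> D (Suc k) (snd y) \<and>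
            vle (snd y) ((v2((x, A) := d)) y) ((v2((x, A) := d')) y)"
        proof (cases "y = (x, A)")
          case False
          then have "v2 y \<in> D (Suc k) (snd y)" using 1 y L_D by fastforce
          then show ?thesis using False vle_refl by auto
        qed (use d in simp)
      qed
      show "(vapp (interp \<A> k (Lam x A M) v1) g1, interp \<A> (Suc k) M (v2((x, A) := g2))) \<in> L k B"
        if "(g1, g2) \<in> L k A" for g1 g2
        using body[OF that] L_D[OF that] by (simp add: app_lam)
    qed }
  { case 2
    have "vle B (interp \<A> (Suc k) M (v1((x, A) := d))) (interp \<A> (Suc k) M (v2((x, A) := d)))"
      if "d \<in> D (Suc k) A" for d
      by (rule ht_Lam.IH(2)) (use 2 that vle_refl in auto)
    then show ?case by (simp add: vle_lam app_lam) }
qed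

lemma interp_D:
  "has_type (sig \<A>) M A \<Longrightarrow> \<forall>y \<in> fv M. v y \<in> D k (snd y) \<Longrightarrow> interp \<A> k M v \<in> D k A"
proof (induction k arbitrary: M A v)
  case 0
  then show ?case using interp_0(1) by blast
next
  case (Suc k)
  have "(interp \<A> k M (\<lambda>y. down \<A> (Suc k) (snd y) (v y)), interp \<A> (Suc k) M v) \<in> L k A"
    by (rule interp_step(1)[OF Suc.IH Suc.prems(1)]) (use Suc.prems(2) L_down in blast)+
  then show ?case using L_D by blast
qed

lemma L_interp:
  assumes "has_type (sig \<A>) M A" "\<forall>y \<in> fv M. (v1 y, v2 y) \<in> L k (snd y)"
  shows "(interp \<A> k M v1, interp \<A> (Suc k) M v2) \<in> L k A"
  using interp_step(1)[OF _ assms] interp_D by blast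


section \<open>Intersection types in the model\<close>

text \<open>A type has a value at every level, also below its own, so most facts are stated without
  a level bound. By \<open>all_itypes_eq\<close> this is the same bound as in \<open>d_sub\<close>
  and \<open>environment\<close>.\<close>

definition all_itypes :: "ty \<Rightarrow> 'q ity set" where "all_itypes A = (\<Union>l. tau \<A> l A)"

abbreviation tv :: "nat \<Rightarrow> ty \<Rightarrow> 'q ity \<Rightarrow> 'q val" where "tv \<equiv> type_val \<A>"

abbreviation tsv :: "nat \<Rightarrow> ty \<Rightarrow> 'q ity set \<Rightarrow> 'q val" where "tsv \<equiv> types_val \<A>"

lemma itypes_subset: "itypes \<A> k A \<subseteq> all_itypes A"
  by (auto simp: itypes_def all_itypes_def)

lemma tau_subset: "tau \<A> k A \<subseteq> all_itypes A"
  by (auto simp: all_itypes_def)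

lemma itypes_mono: "k \<le> l \<Longrightarrow> itypes \<A> k A \<subseteq> itypes \<A> l A"
  by (fastforce simp: itypes_def)

lemma itypes_Suc: "itypes \<A> (Suc k) A = itypes \<A> k A \<union> tau \<A> (Suc k) A"
  by (auto simp: itypes_def le_Suc_eq)

lemma tau_ArrD: "Arr U t \<in> tau \<A> k (A \<rightarrow>\<^sub>t B) \<Longrightarrow> fset U \<subseteq> itypes \<A> k A \<and> t \<in> tau \<A> k B"
  by (auto simp: itypes_def)

lemma tau_ArrI: "fset U \<subseteq> itypes \<A> k A \<Longrightarrow> t \<in> tau \<A> k B \<Longrightarrow> Arr U t \<in> tau \<A> k (A \<rightarrow>\<^sub>t B)"
  by (auto simp: itypes_def)

lemma itypes_ArrD: "Arr U t \<in> itypes \<A> k (A \<rightarrow>\<^sub>t B) \<Longrightarrow> fset U \<subseteq> itypes \<A> k A \<and> t \<in> itypes \<A> k B"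
  by (fastforce simp: itypes_def)

lemma all_itypes_ArrD:
  "Arr U t \<in> all_itypes (A \<rightarrow>\<^sub>t B) \<Longrightarrow> fset U \<subseteq> all_itypes A \<and> t \<in> all_itypes B"
  by (auto simp: all_itypes_def)

lemma all_itypes_ArrE:
  assumes "s \<in> all_itypes (A \<rightarrow>\<^sub>t B)"
  obtains U t where "s = Arr U t" "fset U \<subseteq> all_itypes A" "t \<in> all_itypes B"
proof -
  obtain U t where s: "s = Arr U t" using assms by (auto simp: all_itypes_def)
  with assms all_itypes_ArrD[of U t A B] that show thesis by blast
qed

text \<open>The facts form one induction: an arrow above level \<open>k\<close> is bottom because
  its target is, relatedness of an arrow uses adjointness of its premise types, and its adjointness
  also uses that of the target.\<close>

lemma type_val_props:
  "t \<in> tau \<A> l A \<Longrightarrow> tv k A t \<in> D k A \<and> (k < l \<longrightarrow> tv k A t = vbot k A) \<and>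
    (tv k A t, tv (Suc k) A t) \<in> L k A \<and>
    (l \<le> k \<longrightarrow> (\<forall>d e. (d, e) \<in> L k A \<longrightarrow> vle A (tv k A t) d \<longrightarrow> vle A (tv (Suc k) A t) e))"
proof (induction A arbitrary: l t k)
  case TO
  then obtain q where q: "t = St q" "q \<in> states \<A>" "rank \<A> q = l" by auto
  then show ?case by (auto simp: states_le_def)
next
  case (Fn A B)
  then obtain T s where t: "t = Arr T s" and T: "fset T \<subseteq> (\<Union>l\<le>l. tau \<A> l A)" and s: "s \<in> tau \<A> l B"
    by auto
  have A: "tv k A u \<in> D k A" "(tv k A u, tv (Suc k) A u) \<in> L k A"
    "j \<le> k \<Longrightarrow> (d, e) \<in> L k A \<Longrightarrow> vle A (tv k A u) d \<Longrightarrow> vle A (tv (Suc k) A u) e"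
    if "u \<in> tau \<A> j A" for u j k d e
    using Fn.IH(1)[OF that] by blast+
  have B: "tv k B s \<in> D k B" "k < l \<Longrightarrow> tv k B s = vbot k B" "(tv k B s, tv (Suc k) B s) \<in> L k B"
    "l \<le> k \<Longrightarrow> (d, e) \<in> L k B \<Longrightarrow> vle B (tv k B s) d \<Longrightarrow> vle B (tv (Suc k) B s) e" for k d e
    using Fn.IH(2)[OF s] by blast+
  let ?X = "\<lambda>k. vsup k A (tv k A ` fset T)"
  have TD: "tv k A ` fset T \<subseteq> D k A" for k using T A(1) by blast
  have eq: "tv k (A \<rightarrow>\<^sub>t B) t = vlam (D k A) (\<lambda>h. if vle A (?X k) h then tv k B s else vbot k B)" for k
    by (simp add: t step_def Sup_eq_vsup[OF TD] bottom_eq_vbot cong: if_cong)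
  have LX: "(?X k, ?X (Suc k)) \<in> L k A" for k
  proof -
    have "(\<lambda>t. (tv k A t, tv (Suc k) A t)) ` fset T \<subseteq> L k A" using T A(2) by blast
    from L_vsup[OF this] show ?thesis by (simp add: image_image)
  qed
  \<comment> \<open>The premise is met at level \<open>Suc k\<close> exactly when it is met at the
    projected argument, so related arguments select the same branch.\<close>
  have XG: "vle A (?X (Suc k)) e \<longleftrightarrow> vle A (?X k) d" if "l \<le> k" and L: "(d, e) \<in> L k A" for k d e
  proof
    assume "vle A (?X (Suc k)) e"
    then show "vle A (?X k) d" using L_mono[OF LX L] by blast
  next
    assume X: "vle A (?X k) d"
    show "vle A (?X (Suc k)) e"
    proof (rule vsup_least[OF TD])
      fix x assume "x \<in> tv (Suc k) A ` fset T"
      then obtain u j where u: "x = tv (Suc k) A u" "u \<in> fset T" "u \<in> tau \<A> j A" "j \<le> l"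
        using T by blast
      have "vle A (tv k A u) (?X k)" by (rule vsup_upper[OF TD]) (use u in blast)
      then have "vle A (tv k A u) d"
        using vle_trans[OF A(1)[OF u(3)] vsup_D[OF TD] _ X] by blast
      then show "vle A x e"
        using A(3)[OF u(3) _ L] u \<open>l \<le> k\<close> by simp
    qed
  qed
  have mono: "vle B (if vle A (?X k) h then tv k B s else vbot k B) (if vle A (?X k) h' then tv k B s else vbot k B)"
    if h: "h \<in> D k A" "h' \<in> D k A" "vle A h h'" for k h h'
    using vle_trans[OF vsup_D[OF TD] h(1) _ h(3)] vbot_le vle_refl[OF B(1)] by auto
  have D: "(if vle A (?X k) h then tv k B s else vbot k B) \<in> D k B" for k h
    using B(1) vbot_D by simp
  have step: "(tv k (A \<rightarrow>\<^sub>t B) t, tv (Suc k) (A \<rightarrow>\<^sub>t B) t) \<in> L k (A \<rightarrow>\<^sub>t B)"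
    if "tv k (A \<rightarrow>\<^sub>t B) t \<in> D k (A \<rightarrow>\<^sub>t B)" for k
    unfolding eq[of "Suc k"]
  proof (rule L_funI[OF that D mono])
    fix g1 g2 assume g: "(g1, g2) \<in> L k A"
    have app: "vapp (tv k (A \<rightarrow>\<^sub>t B) t) g1 = (if vle A (?X k) g1 then tv k B s else vbot k B)"
      using L_D[OF g] by (simp add: eq app_lam)
    show "(vapp (tv k (A \<rightarrow>\<^sub>t B) t) g1, if vle A (?X (Suc k)) g2 then tv (Suc k) B s else vbot (Suc k) B) \<in> L k B"
    proof (cases "l \<le> k")
      case True
      then show ?thesis
        using B(3) L_vbot XG[OF True g] app by simp
    next
      \<comment> \<open>Here the branches may differ, but both values at \<open>Suc k\<close> lie
        over bottom. This includes \<open>l = Suc k\<close>, where \<open>tv (Suc k) B s\<close>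
        need not be bottom.\<close>
      case False
      then have "vapp (tv k (A \<rightarrow>\<^sub>t B) t) g1 = vbot k B" "(vbot k B, tv (Suc k) B s) \<in> L k B"
        using B(2)[of k] B(3)[of k] app by auto
      then show ?thesis using L_vbot by simp
    qed
  qed
  have tvD: "tv k (A \<rightarrow>\<^sub>t B) t \<in> D k (A \<rightarrow>\<^sub>t B)" for k
  proof (induction k)
    case 0
    show ?case unfolding eq by (rule lam_D0[OF D mono])
  next
    case (Suc k)
    then show ?case using step L_D by blast
  qed
  have "tv k (A \<rightarrow>\<^sub>t B) t = vbot k (A \<rightarrow>\<^sub>t B)" if "k < l"
    unfolding eq using B(2)[OF that] by (auto intro!: vlam_cong)
  moreover have "vle (A \<rightarrow>\<^sub>t B) (tv (Suc k) (A \<rightarrow>\<^sub>t B) t) e"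
    if lk: "l \<le> k" and L: "(d, e) \<in> L k (A \<rightarrow>\<^sub>t B)" and le: "vle (A \<rightarrow>\<^sub>t B) (tv k (A \<rightarrow>\<^sub>t B) t) d" for d e
    unfolding eq vle_lam
  proof
    fix h assume h: "h \<in> D (Suc k) A"
    note Lh = L_down[OF h]
    have hD: "down \<A> (Suc k) A h \<in> D k A" using L_D[OF Lh] by blast
    show "vle B (if vle A (?X (Suc k)) h then tv (Suc k) B s else vbot (Suc k) B) (vapp e h)"
    proof (cases "vle A (?X (Suc k)) h")
      case True
      then have "vle A (?X k) (down \<A> (Suc k) A h)" using XG[OF lk Lh] by blast
      then have "vle B (tv k B s) (vapp d (down \<A> (Suc k) A h))"
        using vle_app[OF tvD le hD] hD by (simp add: eq app_lam)
      then show ?thesis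
        using True B(4)[OF lk L_app[OF L Lh]] by simp
    qed (simp add: vbot_le)
  qed
  ultimately show ?case using tvD step[OF tvD] by blast
qed

lemma type_val_D: "t \<in> tau \<A> l A \<Longrightarrow> tv k A t \<in> D k A"
  and type_val_vbot: "t \<in> tau \<A> l A \<Longrightarrow> k < l \<Longrightarrow> tv k A t = vbot k A"
  and L_type_val: "t \<in> tau \<A> l A \<Longrightarrow> (tv k A t, tv (Suc k) A t) \<in> L k A"
  and type_val_galois: "t \<in> tau \<A> l A \<Longrightarrow> l \<le> k \<Longrightarrow> (d, e) \<in> L k A \<Longrightarrow> vle A (tv k A t) d \<Longrightarrow>
    vle A (tv (Suc k) A t) e"
  using type_val_props by blast+

lemma tv_D: "t \<in> all_itypes A \<Longrightarrow> tv k A t \<in> D k A"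
  using type_val_D by (auto simp: all_itypes_def)

lemma tv_image_D: "S \<subseteq> all_itypes A \<Longrightarrow> tv k A ` S \<subseteq> D k A"
  using tv_D by blast

lemma tsv_eq:
  assumes "S \<subseteq> all_itypes A"
  shows "tsv k A S = vsup k A (tv k A ` S)"
  unfolding types_val_def by (rule Sup_eq_vsup[OF tv_image_D[OF assms]])

lemma tsv_D: "S \<subseteq> all_itypes A \<Longrightarrow> tsv k A S \<in> D k A"
  by (simp add: tsv_eq vsup_D tv_image_D)

lemma tv_le_tsv:
  assumes "S \<subseteq> all_itypes A" "t \<in> S"
  shows "vle A (tv k A t) (tsv k A S)"
  unfolding tsv_eq[OF assms(1)] by (rule vsup_upper[OF tv_image_D]) (use assms in auto)

lemma tsv_le_iff:
  assumes "S \<subseteq> all_itypes A" "y \<in> D k A"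
  shows "vle A (tsv k A S) y \<longleftrightarrow> (\<forall>t \<in> S. vle A (tv k A t) y)"
proof
  assume y: "vle A (tsv k A S) y"
  show "\<forall>t \<in> S. vle A (tv k A t) y"
    using vle_trans[OF tv_D tsv_D[OF assms(1)] tv_le_tsv[OF assms(1)] y] assms(1) by blast
next
  assume y: "\<forall>t \<in> S. vle A (tv k A t) y"
  show "vle A (tsv k A S) y"
    unfolding tsv_eq[OF assms(1)] by (rule vsup_least[OF tv_image_D[OF assms(1)]]) (use y in auto)
qed

lemma base_tsv:
  assumes "P \<subseteq> states_le \<A> l" "l \<le> k"
  shows "base (tsv k TO (St ` P)) = P"
proof -
  have "St ` P \<subseteq> all_itypes TO" using assms(1) by (auto simp: all_itypes_def states_le_def)
  moreover have "base (tv k TO (St p)) = {p}" if "p \<in> P" for p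
    using subsetD[OF assms(1) that] assms(2) by (simp add: states_le_def)
  ultimately show ?thesis by (simp add: tsv_eq image_image del: type_val.simps)
qed

lemma tsv_mono:
  assumes "T \<subseteq> all_itypes A" "S \<subseteq> T"
  shows "vle A (tsv k A S) (tsv k A T)"
proof -
  have "S \<subseteq> all_itypes A" using assms by blast
  then show ?thesis using tsv_le_iff tsv_D[OF assms(1)] tv_le_tsv[OF assms(1)] assms(2) by blast
qed

lemma L_tsv:
  assumes "S \<subseteq> all_itypes A"
  shows "(tsv k A S, tsv (Suc k) A S) \<in> L k A"
proof -
  have "(\<lambda>t. (tv k A t, tv (Suc k) A t)) ` S \<subseteq> L k A"
    using assms L_type_val unfolding all_itypes_def by blast
  from L_vsup[OF this] show ?thesis by (simp add: image_image tsv_eq[OF assms])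
qed

lemma tv_galois:
  assumes "t \<in> itypes \<A> k A" "(d, e) \<in> L k A"
  shows "vle A (tv (Suc k) A t) e \<longleftrightarrow> vle A (tv k A t) d"
proof -
  obtain l where l: "l \<le> k" "t \<in> tau \<A> l A" using assms(1) by (auto simp: itypes_def)
  show ?thesis
    using type_val_galois[OF l(2,1) assms(2)] L_mono[OF L_type_val[OF l(2)] assms(2)] by blast
qed

lemma tsv_galois:
  assumes "S \<subseteq> itypes \<A> k A" "(d, e) \<in> L k A"
  shows "vle A (tsv (Suc k) A S) e \<longleftrightarrow> vle A (tsv k A S) d"
proof -
  have S: "S \<subseteq> all_itypes A" using assms itypes_subset by blast
  note D = L_D[OF assms(2)]
  show ?thesis
    unfolding tsv_le_iff[OF S conjunct1[OF D]] tsv_le_iff[OF S conjunct2[OF D]]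
    using tv_galois[OF _ assms(2)] assms(1) by blast
qed

lemma tsv_up_bot:
  assumes "S \<subseteq> itypes \<A> k A"
  shows "tsv (Suc k) A S = up_bot \<A> (Suc k) A (tsv k A S)"
proof -
  have S: "S \<subseteq> all_itypes A" using assms itypes_subset by blast
  note D = tsv_D[OF S, of k]
  note Lu = L_up_bot[OF D]
  have "vle A (tsv (Suc k) A S) (up_bot \<A> (Suc k) A (tsv k A S))"
    using tsv_galois[OF assms Lu] vle_refl[OF D] by blast
  moreover have "vle A (up_bot \<A> (Suc k) A (tsv k A S)) (tsv (Suc k) A S)"
    by (rule up_bot_least[OF D L_tsv[OF S] vle_refl[OF D]])
  ultimately show ?thesis using vle_antisym[OF tsv_D[OF S]] L_D[OF Lu] by blast
qed

lemma tsv_above: "S \<subseteq> tau \<A> l A \<Longrightarrow> k < l \<Longrightarrow> tsv k A S = vbot k A"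
proof -
  assume S: "S \<subseteq> tau \<A> l A" "k < l"
  then have S': "S \<subseteq> all_itypes A" using tau_subset by blast
  have "vle A (tsv k A S) (vbot k A)"
    unfolding tsv_le_iff[OF S' vbot_D]
    using type_val_vbot S vle_refl[OF vbot_D] by (metis subsetD)
  then show ?thesis using vle_antisym[OF tsv_D[OF S'] vbot_D _ vbot_le] by blast
qed

lemma type_val_Arr:
  assumes "Arr U t \<in> all_itypes (A \<rightarrow>\<^sub>t B)"
  shows "tv k (A \<rightarrow>\<^sub>t B) (Arr U t) = vlam (D k A) (\<lambda>h. if vle A (tsv k A (fset U)) h then tv k B t else vbot k B)"
  by (simp add: step_def bottom_eq_vbot types_val_def cong: if_cong)

text \<open>A step function is the least monotone map reaching a given value at a given point, so
  the comparison is decided at that point.\<close>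

lemma Arr_le_iff:
  assumes "Arr U t \<in> all_itypes (A \<rightarrow>\<^sub>t B)" "f \<in> D k (A \<rightarrow>\<^sub>t B)"
  shows "vle (A \<rightarrow>\<^sub>t B) (tv k (A \<rightarrow>\<^sub>t B) (Arr U t)) f \<longleftrightarrow> vle B (tv k B t) (vapp f (tsv k A (fset U)))"
proof -
  have U: "fset U \<subseteq> all_itypes A" and t: "t \<in> all_itypes B" using all_itypes_ArrD[OF assms(1)] by auto
  note UD = tsv_D[OF U, of k]
  show ?thesis
    unfolding type_val_Arr[OF assms(1)] vle_lam
  proof
    assume "\<forall>h \<in> D k A. vle B (if vle A (tsv k A (fset U)) h then tv k B t else vbot k B) (vapp f h)"
    then show "vle B (tv k B t) (vapp f (tsv k A (fset U)))"
      using UD vle_refl[OF UD] by auto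
  next
    assume *: "vle B (tv k B t) (vapp f (tsv k A (fset U)))"
    have "vle B (tv k B t) (vapp f h)" if "h \<in> D k A" "vle A (tsv k A (fset U)) h" for h
      using vle_trans[OF tv_D[OF t] D_app[OF assms(2) UD] * D_app_mono[OF assms(2) UD that]] .
    then show "\<forall>h \<in> D k A. vle B (if vle A (tsv k A (fset U)) h then tv k B t else vbot k B) (vapp f h)"
      using vbot_le by simp
  qed
qed

text \<open>The semantic counterpart of \<open>appl\<close>: premises are tested by their values
  instead of by \<open>sle\<close>.\<close>

lemma tsv_app:
  assumes "S \<subseteq> all_itypes (A \<rightarrow>\<^sub>t B)" "h \<in> D k A"
  shows "vapp (tsv k (A \<rightarrow>\<^sub>t B) S) h = tsv k B {t. \<exists>U. Arr U t \<in> S \<and> vle A (tsv k A (fset U)) h}"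
    (is "_ = tsv k B ?T")
proof -
  have T: "?T \<subseteq> all_itypes B" using assms(1) all_itypes_ArrD by blast
  note fD = tsv_D[OF assms(1), of k]
  have "vle B (vapp (tsv k (A \<rightarrow>\<^sub>t B) S) h) (tsv k B ?T)"
    unfolding tsv_eq[OF assms(1)] vsup_app[OF assms(2)]
  proof (rule vsup_least)
    show "(\<lambda>f. vapp f h) ` tv k (A \<rightarrow>\<^sub>t B) ` S \<subseteq> D k B"
      using assms tv_D D_app by blast
    fix x assume "x \<in> (\<lambda>f. vapp f h) ` tv k (A \<rightarrow>\<^sub>t B) ` S"
    then obtain u where u: "u \<in> S" "x = vapp (tv k (A \<rightarrow>\<^sub>t B) u) h" by blast
    then obtain U t where ut: "u = Arr U t" using assms(1) all_itypes_ArrE by blast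
    have uA: "Arr U t \<in> all_itypes (A \<rightarrow>\<^sub>t B)" using u(1) ut assms(1) by blast
    show "vle B x (tsv k B ?T)"
    proof (cases "vle A (tsv k A (fset U)) h")
      case True
      then have "t \<in> ?T" using u(1) ut by blast
      from tv_le_tsv[OF T this] show ?thesis
        using True assms(2) unfolding u(2) ut type_val_Arr[OF uA] by (simp add: app_lam)
    next
      case False
      then show ?thesis
        using assms(2) vbot_le unfolding u(2) ut type_val_Arr[OF uA] by (simp add: app_lam)
    qed
  qed
  moreover have "vle B (tsv k B ?T) (vapp (tsv k (A \<rightarrow>\<^sub>t B) S) h)"
    unfolding tsv_le_iff[OF T D_app[OF fD assms(2)]]
  proof
    fix t assume "t \<in> ?T"
    then obtain U where U: "Arr U t \<in> S" "vle A (tsv k A (fset U)) h" by blast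
    then have A: "Arr U t \<in> all_itypes (A \<rightarrow>\<^sub>t B)" using assms(1) by blast
    note UD = tsv_D[OF conjunct1[OF all_itypes_ArrD[OF A]]]
    have "vle B (tv k B t) (vapp (tsv k (A \<rightarrow>\<^sub>t B) S) (tsv k A (fset U)))"
      using Arr_le_iff[OF A fD] tv_le_tsv[OF assms(1) U(1)] by blast
    then show "vle B (tv k B t) (vapp (tsv k (A \<rightarrow>\<^sub>t B) S) h)"
      using vle_trans[OF tv_D D_app[OF fD UD] _ D_app_mono[OF fD UD assms(2) U(2)]]
        all_itypes_ArrD[OF A] by blast
  qed
  ultimately show ?thesis
    using vle_antisym[OF D_app[OF fD assms(2)] tsv_D[OF T]] by blast
qed

section \<open>The syntactic order on types against the semantic one\<close>

lemma sle_iff: "sle S T \<longleftrightarrow> (\<forall>s \<in> S. \<exists>t \<in> T. tle s t)"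
  by (simp add: sle.simps)

lemma tle_Arr_iff: "tle (Arr S s) (Arr T t) \<longleftrightarrow> sle (fset T) (fset S) \<and> tle s t"
  by (auto elim: tle.cases intro: tle_sle.tle_Arr)

lemma tle_sound: "s \<in> all_itypes A \<Longrightarrow> t \<in> all_itypes A \<Longrightarrow> tle s t \<Longrightarrow> vle A (tv k A s) (tv k A t)"
proof (induction A arbitrary: s t)
  case TO
  then obtain q q' where "s = St q" "t = St q'" by (auto simp: all_itypes_def)
  with TO(3) have "s = t" by (auto elim: tle.cases)
  then show ?case using vle_refl[OF tv_D[OF TO(1)]] by simp
next
  case (Fn A B)
  then obtain U u V v where st: "s = Arr U u" "t = Arr V v" by (meson all_itypes_ArrE)
  note A = Fn.prems(1,2)[unfolded st]
  have le: "sle (fset V) (fset U)" "tle u v" using Fn.prems(3) st tle_Arr_iff by auto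
  have UV: "fset U \<subseteq> all_itypes A" "fset V \<subseteq> all_itypes A" "u \<in> all_itypes B" "v \<in> all_itypes B"
    using A[THEN all_itypes_ArrD] by auto
  have "vle A (tsv k A (fset V)) (tsv k A (fset U))"
    unfolding tsv_le_iff[OF UV(2) tsv_D[OF UV(1)]]
  proof
    fix x assume x: "x \<in> fset V"
    then obtain y where y: "y \<in> fset U" "tle x y" using le(1) sle_iff by blast
    have xy: "x \<in> all_itypes A" "y \<in> all_itypes A" using x y UV by auto
    show "vle A (tv k A x) (tsv k A (fset U))"
      by (rule vle_trans[OF tv_D[OF xy(1)] tv_D[OF xy(2)] Fn.IH(1)[OF xy y(2)] tv_le_tsv[OF UV(1) y(1)]])
  qed
  then have "vapp (tv k (A \<rightarrow>\<^sub>t B) t) (tsv k A (fset U)) = tv k B v"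
    using tsv_D[OF UV(1)] unfolding st type_val_Arr[OF A(2)] by (simp add: app_lam)
  then show ?case
    using Arr_le_iff[OF A(1) tv_D[OF Fn.prems(2)]] Fn.IH(2)[OF UV(3,4) le(2)] st by simp
qed

lemma sle_sound:
  assumes "S \<subseteq> all_itypes A" "T \<subseteq> all_itypes A" "sle S T"
  shows "vle A (tsv k A S) (tsv k A T)"
  unfolding tsv_le_iff[OF assms(1) tsv_D[OF assms(2)]]
proof
  fix s assume s: "s \<in> S"
  then obtain t where t: "t \<in> T" "tle s t" using assms(3) sle_iff by blast
  have st: "s \<in> all_itypes A" "t \<in> all_itypes A" using s t assms by auto
  show "vle A (tv k A s) (tsv k A T)"
    by (rule vle_trans[OF tv_D[OF st(1)] tv_D[OF st(2)] tle_sound[OF st t(2)] tv_le_tsv[OF assms(2) t(1)]])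
qed

text \<open>Types are join-prime. For an arrow, evaluating at its own premise leaves only the
  members of \<open>T\<close> whose premise is met there; induction on the target picks one of them,
  and induction on the source turns its met premise into \<open>sle\<close>. The bound
  \<open>k\<close> matters: types above it denote bottom.\<close>

lemma tle_complete:
  "s \<in> itypes \<A> k A \<Longrightarrow> T \<subseteq> itypes \<A> k A \<Longrightarrow> vle A (tv k A s) (tsv k A T) \<Longrightarrow> \<exists>t \<in> T. tle s t"
proof (induction A arbitrary: s T)
  case TO
  then obtain q where q: "s = St q" "q \<in> states \<A>" "rank \<A> q \<le> k" by (auto simp: itypes_def)
  have "T \<subseteq> all_itypes TO" using TO(2) itypes_subset by blast
  then have "q \<in> \<Union> (base ` tv k TO ` T)" using TO(3) q by (simp add: tsv_eq)
  then obtain t where t: "t \<in> T" "q \<in> base (tv k TO t)" by blast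
  moreover obtain q' where "t = St q'" using t(1) TO(2) by (auto simp: itypes_def)
  ultimately have "t = St q" by (auto split: if_splits)
  then have "tle s t" using q(1) tle_sle.tle_St by simp
  with t(1) show ?case by blast
next
  case (Fn A B)
  obtain U u where s: "s = Arr U u" using Fn.prems(1) by (auto simp: itypes_def)
  have T: "T \<subseteq> all_itypes (A \<rightarrow>\<^sub>t B)" using Fn.prems(2) itypes_subset by blast
  have sA: "Arr U u \<in> all_itypes (A \<rightarrow>\<^sub>t B)" using Fn.prems(1) itypes_subset s by blast
  have Uu: "fset U \<subseteq> itypes \<A> k A" "u \<in> itypes \<A> k B"
    using itypes_ArrD[OF Fn.prems(1)[unfolded s]] by auto
  then have UA: "fset U \<subseteq> all_itypes A" using itypes_subset by blast
  let ?T = "{t. \<exists>V. Arr V t \<in> T \<and> vle A (tsv k A (fset V)) (tsv k A (fset U))}"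
  have "vle B (tv k B u) (tsv k B ?T)"
    using Fn.prems(3) Arr_le_iff[OF sA tsv_D[OF T]] tsv_app[OF T tsv_D[OF UA]] s by simp
  moreover have "?T \<subseteq> itypes \<A> k B" using Fn.prems(2) itypes_ArrD by blast
  ultimately obtain t where "t \<in> ?T" and t: "tle u t" using Fn.IH(2)[OF Uu(2)] by blast
  then obtain V where V: "Arr V t \<in> T" "vle A (tsv k A (fset V)) (tsv k A (fset U))" by blast
  have VA: "fset V \<subseteq> itypes \<A> k A" using V(1) Fn.prems(2) itypes_ArrD by blast
  then have "fset V \<subseteq> all_itypes A" using itypes_subset by blast
  then have "\<forall>v \<in> fset V. vle A (tv k A v) (tsv k A (fset U))"
    using V(2) tsv_le_iff[OF _ tsv_D[OF UA]] by blast
  then have "sle (fset V) (fset U)"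
    unfolding sle_iff using Fn.IH(1)[OF _ Uu(1)] VA by blast
  then show ?case using V(1) t s tle_Arr_iff by blast
qed

lemma sle_iff_tsv:
  assumes "S \<subseteq> itypes \<A> k A" "T \<subseteq> itypes \<A> k A"
  shows "sle S T \<longleftrightarrow> vle A (tsv k A S) (tsv k A T)"
proof -
  have *: "S \<subseteq> all_itypes A" "T \<subseteq> all_itypes A" using assms itypes_subset by blast+
  have "sle S T" if "vle A (tsv k A S) (tsv k A T)"
    using that tle_complete[OF _ assms(2)] assms(1)
    unfolding tsv_le_iff[OF *(1) tsv_D[OF *(2)]] sle_iff by blast
  then show ?thesis using sle_sound[OF *] by blast
qed

lemma tsv_appl:
  assumes "S \<subseteq> itypes \<A> k (A \<rightarrow>\<^sub>t B)" "T \<subseteq> itypes \<A> k A"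
  shows "tsv k B (appl S T) = vapp (tsv k (A \<rightarrow>\<^sub>t B) S) (tsv k A T)"
proof -
  have *: "S \<subseteq> all_itypes (A \<rightarrow>\<^sub>t B)" "T \<subseteq> all_itypes A" using assms itypes_subset by blast+
  have "appl S T = {t. \<exists>U. Arr U t \<in> S \<and> vle A (tsv k A (fset U)) (tsv k A T)}"
  proof -
    have "sle (fset U) T \<longleftrightarrow> vle A (tsv k A (fset U)) (tsv k A T)" if "Arr U t \<in> S" for U t
      by (rule sle_iff_tsv[OF conjunct1[OF itypes_ArrD[OF subsetD[OF assms(1) that]]] assms(2)])
    then show ?thesis unfolding appl_def by blast
  qed
  then show ?thesis using tsv_app[OF *(1) tsv_D[OF *(2)]] by simp
qed

lemma appl_itypes: "S \<subseteq> itypes \<A> k (A \<rightarrow>\<^sub>t B) \<Longrightarrow> appl S T \<subseteq> itypes \<A> k B"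
  using itypes_ArrD unfolding appl_def by blast

section \<open>Finiteness of the type sets and definability of model elements\<close>

lemma finite_tau: "finite (tau \<A> k A)"
proof (induction A arbitrary: k)
  case TO
  have "tau \<A> k TO \<subseteq> St ` states \<A>" by auto
  then show ?case using finite_states finite_subset by blast
next
  case (Fn A B)
  have "tau \<A> k (A \<rightarrow>\<^sub>t B) \<subseteq> (\<lambda>(T, s). Arr (Abs_fset T) s) ` (Pow (\<Union>l\<le>k. tau \<A> l A) \<times> tau \<A> k B)"
  proof
    fix t assume "t \<in> tau \<A> k (A \<rightarrow>\<^sub>t B)"
    then obtain T s where t: "t = Arr T s" "fset T \<subseteq> (\<Union>l\<le>k. tau \<A> l A)" "s \<in> tau \<A> k B" by auto
    then have "t = (\<lambda>(T, s). Arr (Abs_fset T) s) (fset T, s)" by (simp add: fset_inverse)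
    with t show "t \<in> (\<lambda>(T, s). Arr (Abs_fset T) s) ` (Pow (\<Union>l\<le>k. tau \<A> l A) \<times> tau \<A> k B)" by blast
  qed
  then show ?case by (rule finite_subset) (simp add: Fn)
qed

lemma finite_itypes: "finite (itypes \<A> k A)"
  by (simp add: itypes_def finite_tau)

abbreviation below :: "nat \<Rightarrow> ty \<Rightarrow> 'q val \<Rightarrow> 'q ity set" where
  "below k A d \<equiv> {t \<in> itypes \<A> k A. vle A (tv k A t) d}"

lemma obtain_fset:
  assumes "S \<subseteq> itypes \<A> k A"
  obtains U where "fset U = S"
  by (rule that[of "Abs_fset S"]) (simp add: fset_Abs_fset finite_subset[OF assms finite_itypes])

text \<open>Outer induction on the level, inner on the simple type. At a function type it suffices
  to bound each type below \<open>vapp f h\<close>, since by the inner induction these generate the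
  value.\<close>

lemma definability: "d \<in> D k A \<Longrightarrow> tsv k A (below k A d) = d"
proof (induction k arbitrary: A d rule: less_induct)
  case (less k)
  have sub: "below k A d \<subseteq> all_itypes A" for A d using itypes_subset by blast
  have le: "vle A (tsv k A (below k A d)) d" if "d \<in> D k A" for A d
    using tsv_le_iff[OF sub that] by blast
  show ?case using less.prems
  proof (induction A arbitrary: d)
    case TO
    then obtain P where P: "d = VO P" "P \<subseteq> states_le \<A> k" by auto
    have "vle TO d (tsv k TO (below k TO d))"
    proof -
      have "q \<in> \<Union> (base ` tv k TO ` below k TO d)" if "q \<in> P" for q
      proof (rule UN_I[OF imageI])
        show "St q \<in> below k TO d" using P that by (auto simp: itypes_def states_le_def)
        show "q \<in> base (tv k TO (St q))" using P that by (auto simp: states_le_def)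
      qed
      then show ?thesis unfolding tsv_eq[OF sub] by (auto simp: P(1))
    qed
    then show ?case using vle_antisym[OF tsv_D[OF sub] TO le[OF TO]] by blast
  next
    case (Fn A B f)
    let ?F = "below k (A \<rightarrow>\<^sub>t B) f"
    note FD = tsv_D[OF sub, of k "A \<rightarrow>\<^sub>t B" f]
    have "vle B (vapp f h) (vapp (tsv k (A \<rightarrow>\<^sub>t B) ?F) h)" if h: "h \<in> D k A" for h
    proof -
      note fh = D_app[OF Fn.prems h] and Fh = D_app[OF FD h]
      have "vle B (tv k B s) (vapp (tsv k (A \<rightarrow>\<^sub>t B) ?F) h)" if s: "s \<in> below k B (vapp f h)" for s
      proof -
        obtain l where l: "l \<le> k" "s \<in> tau \<A> l B" using s by (auto simp: itypes_def)
        show ?thesis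
        proof (cases "l = k")
          case True
          \<comment> \<open>A target of level exactly \<open>k\<close> accepts every type of level
            at most \<open>k\<close> in its premise, so \<open>h\<close> can be named in
            full.\<close>
          obtain U where U: "fset U = below k A h"
            using obtain_fset[of "below k A h" k A] by blast
          then have Us: "Arr U s \<in> tau \<A> k (A \<rightarrow>\<^sub>t B)"
            using l True by (intro tau_ArrI) auto
          then have A: "Arr U s \<in> all_itypes (A \<rightarrow>\<^sub>t B)" using tau_subset by blast
          have Uh: "tsv k A (fset U) = h" using Fn.IH(1)[OF h] U by simp
          have "vle (A \<rightarrow>\<^sub>t B) (tv k (A \<rightarrow>\<^sub>t B) (Arr U s)) f"
            using Arr_le_iff[OF A Fn.prems] Uh s by simp
          then have "Arr U s \<in> ?F" using Us by (auto simp: itypes_def simp del: tau.simps)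
          from tv_le_tsv[OF sub this] show ?thesis
            using Arr_le_iff[OF A FD] Uh by simp
        next
          case False
          \<comment> \<open>An arrow into \<open>s\<close> has level \<open>l < k\<close>, so its
            premise may be unable to name \<open>h\<close>. The projection of \<open>f\<close> is
            definable at level \<open>j\<close>; by adjointness the types used there are also below
            \<open>f\<close>, and their join at level \<open>k\<close> already bounds
            \<open>s\<close> at \<open>h\<close>.\<close>
          then obtain j where j: "k = Suc j" "l \<le> j" using l by (cases k) auto
          have sj: "s \<in> itypes \<A> j B" using l(2) j(2) by (auto simp: itypes_def)
          let ?f = "down \<A> (Suc j) (A \<rightarrow>\<^sub>t B) f" and ?h = "down \<A> (Suc j) A h"
          let ?S = "below j (A \<rightarrow>\<^sub>t B) ?f"
          have Lf: "(?f, f) \<in> L j (A \<rightarrow>\<^sub>t B)" and Lh: "(?h, h) \<in> L j A"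
            using L_down Fn.prems h j by auto
          have S: "?S \<subseteq> all_itypes (A \<rightarrow>\<^sub>t B)" using itypes_subset by blast
          have eq: "tsv j (A \<rightarrow>\<^sub>t B) ?S = ?f"
            by (rule less.IH) (use j L_D[OF Lf] in auto)
          have LS: "(vapp ?f ?h, vapp (tsv k (A \<rightarrow>\<^sub>t B) ?S) h) \<in> L j B"
            using L_app[OF L_tsv[OF S] Lh] eq j by simp
          have "vle B (tv j B s) (vapp ?f ?h)"
            using tv_galois[OF sj L_app[OF Lf Lh]] s j by simp
          then have le: "vle B (tv k B s) (vapp (tsv k (A \<rightarrow>\<^sub>t B) ?S) h)"
            using tv_galois[OF sj LS] j by simp
          have "?S \<subseteq> ?F"
            using tv_galois[OF _ Lf] j itypes_mono[of j k] by auto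
          then have "vle (A \<rightarrow>\<^sub>t B) (tsv k (A \<rightarrow>\<^sub>t B) ?S) (tsv k (A \<rightarrow>\<^sub>t B) ?F)"
            by (rule tsv_mono[OF sub])
          from vle_app[OF tsv_D[OF S] this h] show ?thesis
            using vle_trans[OF tv_D D_app[OF tsv_D[OF S] h] le] l(2) tau_subset by blast
        qed
      qed
      then have "vle B (tsv k B (below k B (vapp f h))) (vapp (tsv k (A \<rightarrow>\<^sub>t B) ?F) h)"
        using tsv_le_iff[OF sub Fh] by blast
      then show ?thesis using Fn.IH(2)[OF fh] by simp
    qed
    then have "vle (A \<rightarrow>\<^sub>t B) f (tsv k (A \<rightarrow>\<^sub>t B) ?F)"
      using vle_fun[OF Fn.prems] by blast
    then show ?case using vle_antisym[OF FD Fn.prems le[OF Fn.prems]] by blast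
  qed
qed

lemma rank_le_max_rank: "q \<in> states \<A> \<Longrightarrow> rank \<A> q \<le> max_rank \<A>"
  using finite_states by (simp add: max_rank_def)

lemma tau_above_max_rank: "max_rank \<A> < k \<Longrightarrow> tau \<A> k A = {}"
  by (induction A) (use rank_le_max_rank in \<open>auto simp: leD\<close>)

lemma all_itypes_eq: "all_itypes A = itypes \<A> (max_rank \<A>) A"
proof -
  have "tau \<A> k A \<subseteq> itypes \<A> (max_rank \<A>) A" for k
    using tau_above_max_rank[of k A] by (cases "k \<le> max_rank \<A>") (auto simp: itypes_def)
  then show ?thesis using itypes_subset unfolding all_itypes_def by blast
qed

text \<open>Only an inequality, unlike \<open>tsv_appl\<close>: for types above level
  \<open>k\<close>, which denote bottom, \<open>sle\<close> can be strictly stronger than the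
  semantic order.\<close>

lemma appl_le:
  assumes S: "S \<subseteq> all_itypes (A \<rightarrow>\<^sub>t B)" and T: "T \<subseteq> all_itypes A"
    and f: "f \<in> D k (A \<rightarrow>\<^sub>t B)" and h: "h \<in> D k A"
    and le: "vle (A \<rightarrow>\<^sub>t B) (tsv k (A \<rightarrow>\<^sub>t B) S) f" "vle A (tsv k A T) h"
  shows "appl S T \<subseteq> all_itypes B" and "vle B (tsv k B (appl S T)) (vapp f h)"
proof -
  show sub: "appl S T \<subseteq> all_itypes B"
    unfolding appl_def using S all_itypes_ArrD by blast
  show "vle B (tsv k B (appl S T)) (vapp f h)"
    unfolding tsv_le_iff[OF sub D_app[OF f h]]
  proof
    fix t assume "t \<in> appl S T"
    then obtain U where U: "Arr U t \<in> S" "sle (fset U) T" by (auto simp: appl_def)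
    then have Ut: "Arr U t \<in> all_itypes (A \<rightarrow>\<^sub>t B)" using S by blast
    note UA = conjunct1[OF all_itypes_ArrD[OF Ut]] and tB = conjunct2[OF all_itypes_ArrD[OF Ut]]
    have "vle A (tsv k A (fset U)) h"
      by (rule vle_trans[OF tsv_D[OF UA] tsv_D[OF T] sle_sound[OF UA T U(2)] le(2)])
    from D_app_mono[OF f tsv_D[OF UA] h this]
    have app: "vle B (vapp f (tsv k A (fset U))) (vapp f h)" .
    have "vle (A \<rightarrow>\<^sub>t B) (tv k (A \<rightarrow>\<^sub>t B) (Arr U t)) f"
      using tsv_le_iff[OF S f] le(1) U(1) by blast
    then have "vle B (tv k B t) (vapp f (tsv k A (fset U)))"
      using Arr_le_iff[OF Ut f] by blast
    then show "vle B (tv k B t) (vapp f h)"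
      by (rule vle_trans[OF tv_D[OF tB] D_app[OF f tsv_D[OF UA]] _ app])
  qed
qed

lemma arrs_tau: "S \<subseteq> itypes \<A> l A \<Longrightarrow> T \<subseteq> tau \<A> l B \<Longrightarrow> arrs S T \<subseteq> tau \<A> l (A \<rightarrow>\<^sub>t B)"
  unfolding arrs_def using tau_ArrI by blast

lemma arrs_le_iff:
  assumes "S \<subseteq> itypes \<A> l A" "T \<subseteq> tau \<A> l B" and f: "f \<in> D k (A \<rightarrow>\<^sub>t B)"
  shows "vle (A \<rightarrow>\<^sub>t B) (tsv k (A \<rightarrow>\<^sub>t B) (arrs S T)) f \<longleftrightarrow> vle B (tsv k B T) (vapp f (tsv k A S))"
proof -
  obtain U where U: "fset U = S" using obtain_fset[OF assms(1)] .
  then have eq: "arrs S T = Arr U ` T" by (auto simp: arrs_def fset_inject)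
  have sub: "arrs S T \<subseteq> all_itypes (A \<rightarrow>\<^sub>t B)" and T: "T \<subseteq> all_itypes B" and S: "S \<subseteq> all_itypes A"
    using arrs_tau[OF assms(1,2)] assms tau_subset itypes_subset by blast+
  have "vle (A \<rightarrow>\<^sub>t B) (tv k (A \<rightarrow>\<^sub>t B) (Arr U t)) f \<longleftrightarrow> vle B (tv k B t) (vapp f (tsv k A S))" if "t \<in> T" for t
    using Arr_le_iff[OF _ f, of U t] sub eq that U by blast
  moreover have "(\<forall>t \<in> arrs S T. P t) \<longleftrightarrow> (\<forall>t \<in> T. P (Arr U t))" for P unfolding eq by simp
  ultimately show ?thesis
    unfolding tsv_le_iff[OF sub f] tsv_le_iff[OF T D_app[OF f tsv_D[OF S]]] by (simp cong: ball_cong del: type_val.simps)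
qed

section \<open>Environments and the values of terms in them\<close>

lemma env_val_eq: "env_val \<A> k \<Gamma> y = tsv k (snd y) (the (\<Gamma> y))"
  by (cases y) (simp add: env_val_def)

lemma env_val_update: "env_val \<A> k (\<Gamma>((x, A) \<mapsto> S)) = (env_val \<A> k \<Gamma>)((x, A) := tsv k A S)"
  by (rule ext) (simp add: env_val_eq)

lemma environment_update:
  "environment \<A> \<Gamma> \<Longrightarrow> S \<subseteq> all_itypes A \<Longrightarrow> environment \<A> (\<Gamma>((x, A) \<mapsto> S))"
  by (auto simp: environment_def all_itypes_eq)

lemma environment_types: "environment \<A> \<Gamma> \<Longrightarrow> y \<in> dom \<Gamma> \<Longrightarrow> the (\<Gamma> y) \<subseteq> all_itypes (snd y)"
  by (cases y) (fastforce simp: environment_def all_itypes_eq)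

lemma env_val_D:
  assumes "environment \<A> \<Gamma>" "F \<subseteq> dom \<Gamma>"
  shows "\<forall>y \<in> F. env_val \<A> k \<Gamma> y \<in> D k (snd y)"
proof
  fix y assume "y \<in> F"
  then have "y \<in> dom \<Gamma>" using assms(2) by blast
  then show "env_val \<A> k \<Gamma> y \<in> D k (snd y)"
    unfolding env_val_eq by (rule tsv_D[OF environment_types[OF assms(1)]])
qed

lemma L_env_val:
  assumes "environment \<A> \<Gamma>" "F \<subseteq> dom \<Gamma>"
  shows "\<forall>y \<in> F. (env_val \<A> k \<Gamma> y, env_val \<A> (Suc k) \<Gamma> y) \<in> L k (snd y)"
proof
  fix y assume "y \<in> F"
  then have "y \<in> dom \<Gamma>" using assms(2) by blast
  then show "(env_val \<A> k \<Gamma> y, env_val \<A> (Suc k) \<Gamma> y) \<in> L k (snd y)"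
    unfolding env_val_eq by (rule L_tsv[OF environment_types[OF assms(1)]])
qed

abbreviation sem :: "nat \<Rightarrow> 'q env \<Rightarrow> 'c tm \<Rightarrow> 'q val" where
  "sem k \<Gamma> M \<equiv> interp \<A> k M (env_val \<A> k \<Gamma>)"

lemma sem_D: "has_type (sig \<A>) M A \<Longrightarrow> environment \<A> \<Gamma> \<Longrightarrow> fv M \<subseteq> dom \<Gamma> \<Longrightarrow> sem k \<Gamma> M \<in> D k A"
  by (rule interp_D[OF _ env_val_D])

lemma L_sem: "has_type (sig \<A>) M A \<Longrightarrow> environment \<A> \<Gamma> \<Longrightarrow> fv M \<subseteq> dom \<Gamma> \<Longrightarrow>
    (sem k \<Gamma> M, sem (Suc k) \<Gamma> M) \<in> L k A"
  by (rule L_interp[OF _ L_env_val])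

lemma sem_Lam_app:
  "S \<subseteq> all_itypes A \<Longrightarrow> vapp (sem k \<Gamma> (Lam x A M)) (tsv k A S) = sem k (\<Gamma>((x, A) \<mapsto> S)) M"
  by (simp add: env_val_update app_lam tsv_D)

lemma sem_Yb:
  assumes "has_type (sig \<A>) (Lam x A M) (A \<rightarrow>\<^sub>t A)" "environment \<A> \<Gamma>" "fv (Lam x A M) \<subseteq> dom \<Gamma>"
  shows "sem k \<Gamma> (Yb x A M) = fixp \<A> k A (sem k \<Gamma> (Lam x A M))"
  using app_lam[OF sem_D[OF assms], of k "fixp \<A> k A"] by (simp only: interp.simps)

text \<open>Values of types and of terms at consecutive levels are related and projection is
  monotone, so inequalities descend. The abstraction case of completeness moves to the level of the
  type in this way.\<close>

lemma tv_sem_down: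
  assumes "has_type (sig \<A>) M A" "environment \<A> \<Gamma>" "fv M \<subseteq> dom \<Gamma>" "t \<in> all_itypes A"
  shows "l \<le> k \<Longrightarrow> vle A (tv k A t) (sem k \<Gamma> M) \<Longrightarrow> vle A (tv l A t) (sem l \<Gamma> M)"
proof (induction k rule: dec_induct)
  case (step k)
  obtain j where "t \<in> tau \<A> j A" using assms(4) by (auto simp: all_itypes_def)
  from L_mono[OF L_type_val[OF this] L_sem[OF assms(1-3)] step.prems] show ?case by (rule step.IH)
qed


section \<open>Soundness\<close>

text \<open>At level \<open>2 * l\<close>, the join of the value of \<open>S \<union> T\<close> with the fixpoint is a post-fixpoint whose
  projection is the previous fixpoint, so it lies below the fixpoint. Below that level \<open>S\<close> denotes
  bottom, and above it adjointness transports the inequality upwards.\<close>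

lemma rule9_sound:
  assumes M: "has_type (sig \<A>) (Lam x A M) (A \<rightarrow>\<^sub>t A)" "environment \<A> \<Gamma>" "fv (Lam x A M) \<subseteq> dom \<Gamma>"
    and S: "S \<subseteq> tau \<A> (2 * l) A" and T: "T \<subseteq> itypes_below \<A> (2 * l) A"
    and IHS: "\<And>k. vle A (tsv k A S) (vapp (sem k \<Gamma> (Lam x A M)) (tsv k A (S \<union> T)))"
    and IHT: "\<And>k. vle A (tsv k A T) (sem k \<Gamma> (Yb x A M))"
  shows "vle A (tsv k A (S \<union> T)) (sem k \<Gamma> (Yb x A M))"
proof -
  have ST: "S \<union> T \<subseteq> itypes \<A> (2 * l) A"
    using S T by (fastforce simp: itypes_def itypes_below_def)
  then have sub: "S \<union> T \<subseteq> all_itypes A" "S \<subseteq> all_itypes A" "T \<subseteq> all_itypes A"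
    using itypes_subset by blast+
  let ?f = "\<lambda>k. sem k \<Gamma> (Lam x A M)" and ?e = "\<lambda>k. tsv k A (S \<union> T)"
  let ?p = "\<lambda>k. fixp \<A> k A (?f k)"
  have f: "?f k \<in> D k (A \<rightarrow>\<^sub>t A)" for k by (rule sem_D[OF M])
  have Lf: "(?f k, ?f (Suc k)) \<in> L k (A \<rightarrow>\<^sub>t A)" for k by (rule L_sem[OF M])
  have p: "?p k \<in> D k A" for k by (rule fixp_D[OF f])
  have IHT': "vle A (tsv k A T) (?p k)" for k using IHT by (simp only: sem_Yb[OF M])
  have union: "vle A (?e k) y" if "y \<in> D k A" "vle A (tsv k A S) y" "vle A (tsv k A T) y" for k y
    using that unfolding tsv_le_iff[OF sub(1) that(1)] tsv_le_iff[OF sub(2) that(1)] tsv_le_iff[OF sub(3) that(1)]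
    by blast
  have low: "vle A (?e k) (?p k)" if "k < 2 * l" for k
    by (rule union[OF p _ IHT']) (simp add: tsv_above[OF S that] vbot_le)
  have base: "vle A (?e (2 * l)) (?p (2 * l))"
  proof -
    let ?k = "2 * l"
    let ?E = "\<lambda>k. {?e k, ?p k}"
    have E: "?E k \<subseteq> D k A" for k using tsv_D[OF sub(1)] p by simp
    \<comment> \<open>The premise on the abstraction bounds \<open>S\<close> only, and
      \<open>T\<close> is known merely to be below the fixpoint. Joining with the fixpoint absorbs
      \<open>T\<close>: the fixpoint is its own image, hence below the image of
      \<open>e\<close>.\<close>
    define e where "e = vsup ?k A (?E ?k)"
    have eD: "e \<in> D ?k A" unfolding e_def by (rule vsup_D[OF E])
    have le: "vle A (?e ?k) e" "vle A (?p ?k) e" unfolding e_def by (rule vsup_upper[OF E]; simp)+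
    note fe = D_app[OF f eD]
    have pf: "vle A (?p ?k) (vapp (?f ?k) e)"
      using D_app_mono[OF f p eD le(2)] by (simp only: fixp_unfold[OF f])
    have "vle A (tsv ?k A S) (vapp (?f ?k) e)"
      by (rule vle_trans[OF tsv_D[OF sub(2)] D_app[OF f tsv_D[OF sub(1)]] IHS
            D_app_mono[OF f tsv_D[OF sub(1)] eD le(1)]])
    moreover have "vle A (tsv ?k A T) (vapp (?f ?k) e)"
      by (rule vle_trans[OF tsv_D[OF sub(3)] p IHT' pf])
    ultimately have "vle A (?e ?k) (vapp (?f ?k) e)" by (rule union[OF fe])
    then have post: "vle A e (vapp (?f ?k) e)"
      unfolding e_def[symmetric] using pf
      by (subst e_def, intro vsup_least[OF E]) auto
    have "vle A e (?p ?k)"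
    proof (cases ?k)
      case 0
      then show ?thesis using fixp_0_greatest[of "?f 0" A e] f[of 0] eD post by (simp del: fixp.simps)
    next
      case (Suc j)
      let ?R = "{(?e j, ?e (Suc j)), (?p j, ?p (Suc j))}"
      have "?R \<subseteq> L j A" using L_tsv[OF sub(1)] L_fixp[OF Lf] by simp
      from L_vsup[OF this] have L: "(vsup j A (?E j), e) \<in> L j A"
        by (simp add: e_def Suc del: fixp.simps)
      have "vle A (vsup j A (?E j)) (?p j)"
      proof (rule vsup_least[OF E])
        fix y assume "y \<in> ?E j"
        then show "vle A y (?p j)" using low[of j] Suc vle_refl[OF p] by auto
      qed
      moreover have "odd j" using Suc by presburger
      ultimately show ?thesis
        using fixp_even_greatest[OF _ Lf L] post Suc by (simp del: fixp.simps)
    qed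
    with le(1) show ?thesis using vle_trans[OF tsv_D[OF sub(1)] eD] by blast
  qed
  have high: "vle A (?e k) (?p k)" if "2 * l \<le> k" for k
    using that
  proof (induction k rule: dec_induct)
    case (step k)
    have "S \<union> T \<subseteq> itypes \<A> k A" using ST itypes_mono[OF step(1)] by blast
    then show ?case using tsv_galois[OF _ L_fixp[OF Lf]] step.IH by blast
  qed (rule base)
  show ?thesis using low high unfolding sem_Yb[OF M] by (meson not_le)
qed

text \<open>The level must stay universally quantified: \<open>rule9_sound\<close> at level
  \<open>k\<close> draws on its premises at level \<open>2 * l\<close> and below, and
  \<open>l\<close> is unrelated to \<open>k\<close>. Typability of \<open>S\<close> is carried along
  because the semantic comparisons presuppose it.\<close>

lemma soundness:
  "derivable \<A> \<Gamma> M S \<Longrightarrow> has_type (sig \<A>) M A \<Longrightarrow> environment \<A> \<Gamma> \<Longrightarrow> fv M \<subseteq> dom \<Gamma> \<Longrightarrow>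
    S \<subseteq> all_itypes A \<and> (\<forall>k. vle A (tsv k A S) (sem k \<Gamma> M))"
proof (induction arbitrary: A rule: derivable.induct)
  case (d_var \<Gamma> x B S)
  then have "A = B" by (auto elim: has_type_VarE)
  moreover have "S \<subseteq> all_itypes B"
    using environment_types[OF d_var(3), of "(x, B)"] d_var(1) by auto
  ultimately show ?case using d_var(1) vle_refl[OF tsv_D] by (simp add: env_val_eq)
next
  case (d_empty \<Gamma> M)
  then show ?case using vbot_le tsv_eq[of "{}" A] by simp
next
  case (d_union \<Gamma> M S T)
  have S: "S \<subseteq> all_itypes A" "\<And>k. vle A (tsv k A S) (sem k \<Gamma> M)"
    and T: "T \<subseteq> all_itypes A" "\<And>k. vle A (tsv k A T) (sem k \<Gamma> M)"
    using d_union by auto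
  have ST: "S \<union> T \<subseteq> all_itypes A" using S T by blast
  note D = sem_D[OF d_union.prems]
  have "vle A (tsv k A (S \<union> T)) (sem k \<Gamma> M)" for k
    using S(2)[of k] T(2)[of k]
    unfolding tsv_le_iff[OF S(1) D] tsv_le_iff[OF T(1) D] tsv_le_iff[OF ST D] by blast
  with ST show ?case by blast
next
  case (d_sub \<Gamma> M S B T)
  have B: "B = A" using has_type_unique[OF d_sub.hyps(2) d_sub.prems(1)] .
  have S: "S \<subseteq> all_itypes A" "\<And>k. vle A (tsv k A S) (sem k \<Gamma> M)" using d_sub by auto
  have T: "T \<subseteq> all_itypes A" using d_sub.hyps(3) B by (simp add: all_itypes_eq)
  have "vle A (tsv k A T) (sem k \<Gamma> M)" for k
    by (rule vle_trans[OF tsv_D[OF T] tsv_D[OF S(1)] sle_sound[OF T S(1) d_sub.hyps(4)] S(2)])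
  with T show ?case by blast
next
  case (d_const0 c \<Gamma>)
  then have A: "A = TO" by (auto elim: has_type_CstE)
  let ?S = "{St q | q. q \<in> states \<A> \<and> delta0 \<A> q c \<noteq> {}}"
  have S: "?S \<subseteq> all_itypes TO" by (auto simp: all_itypes_def)
  have "vle TO (tsv k TO ?S) (sem k \<Gamma> (Cst c))" for k
    unfolding tsv_le_iff[OF S sem_D[OF d_const0.prems[unfolded A]]]
    using d_const0.hyps by (auto simp: const0_val_def states_le_def split: if_splits)
  with S A show ?case by blast
next
  case (d_const2 a q S0 S1 \<Gamma>)
  then have A: "A = TO \<rightarrow>\<^sub>t TO \<rightarrow>\<^sub>t TO" by (auto elim: has_type_CstE)
  let ?l = "rank \<A> q"
  have le: "S0 \<subseteq> states_le \<A> ?l" "S1 \<subseteq> states_le \<A> ?l"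
    using weak d_const2.hyps by (auto simp: weak_automaton_def weak_transitions_def)
  then have S: "St ` S0 \<subseteq> itypes \<A> ?l TO" "St ` S1 \<subseteq> itypes \<A> ?l TO"
    by (auto simp: itypes_def states_le_def)
  have q: "{St q} \<subseteq> tau \<A> ?l TO" using d_const2.hyps(2) by simp
  note inner = arrs_tau[OF S(2) q]
  note outer = arrs_tau[OF S(1) inner]
  have sub: "St ` S0 \<subseteq> all_itypes TO" "St ` S1 \<subseteq> all_itypes TO" "{St q} \<subseteq> all_itypes TO"
    by (rule subset_trans[OF S(1) itypes_subset] subset_trans[OF S(2) itypes_subset]
        subset_trans[OF q tau_subset])+
  have "vle (TO \<rightarrow>\<^sub>t TO \<rightarrow>\<^sub>t TO) (tsv k (TO \<rightarrow>\<^sub>t TO \<rightarrow>\<^sub>t TO) (arrs (St ` S0) (arrs (St ` S1) {St q})))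
      (sem k \<Gamma> (Cst a))" for k
  proof (cases "?l \<le> k")
    case False
    then have "tsv k (TO \<rightarrow>\<^sub>t TO \<rightarrow>\<^sub>t TO) (arrs (St ` S0) (arrs (St ` S1) {St q})) = vbot k (TO \<rightarrow>\<^sub>t TO \<rightarrow>\<^sub>t TO)"
      by (intro tsv_above[OF outer]) simp
    then show ?thesis by (simp only: vbot_le)
  next
    case True
    note base = base_tsv[OF le(1) True] base_tsv[OF le(2) True]
    have f: "sem k \<Gamma> (Cst a) \<in> D k (TO \<rightarrow>\<^sub>t TO \<rightarrow>\<^sub>t TO)"
      by (rule sem_D[OF d_const2.prems[unfolded A]])
    have "sem k \<Gamma> (Cst a) = const2_val \<A> k a" using d_const2.hyps(1) by simp
    then have "vapp (vapp (sem k \<Gamma> (Cst a)) (tsv k TO (St ` S0))) (tsv k TO (St ` S1)) =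
        const2_app k a (tsv k TO (St ` S0)) (tsv k TO (St ` S1))"
      using tsv_D[OF sub(1), of k] tsv_D[OF sub(2), of k] by (simp only: const2_val_eq app_lam)
    moreover have "q \<in> base (const2_app k a (tsv k TO (St ` S0)) (tsv k TO (St ` S1)))"
      using d_const2.hyps(2,3) True
      unfolding const2_app_def base Int_absorb2[OF le(1)] Int_absorb2[OF le(2)]
      by (simp add: states_le_def Int_absorb2 le[unfolded states_le_def])
    moreover have "base (tsv k TO {St q}) = {q}"
      using base_tsv[of "{q}", OF _ True] d_const2.hyps(2) by (simp add: states_le_def)
    ultimately have "vle TO (tsv k TO {St q})
        (vapp (vapp (sem k \<Gamma> (Cst a)) (tsv k TO (St ` S0))) (tsv k TO (St ` S1)))"
      by simp
    then show ?thesis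
      unfolding arrs_le_iff[OF S(1) inner f] arrs_le_iff[OF S(2) q D_app[OF f tsv_D[OF sub(1)]]] .
  qed
  then show ?case using subset_trans[OF outer tau_subset] unfolding A by blast
next
  case (d_app \<Gamma> M S N T)
  obtain B where M: "has_type (sig \<A>) M (B \<rightarrow>\<^sub>t A)" and N: "has_type (sig \<A>) N B"
    using d_app.prems(1) by (rule has_type_AppE)
  have fv: "fv M \<subseteq> dom \<Gamma>" "fv N \<subseteq> dom \<Gamma>" using d_app.prems(3) by auto
  note IHM = d_app.IH(1)[OF M d_app.prems(2) fv(1)] and IHN = d_app.IH(2)[OF N d_app.prems(2) fv(2)]
  note le = appl_le[OF conjunct1[OF IHM] conjunct1[OF IHN] sem_D[OF M d_app.prems(2) fv(1)]
      sem_D[OF N d_app.prems(2) fv(2)] spec[OF conjunct2[OF IHM]] spec[OF conjunct2[OF IHN]]]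
  show ?case unfolding interp.simps using le(1) le(2) by blast
next
  case (d_lam M B S k' A' T \<Gamma> x)
  have A: "A = A' \<rightarrow>\<^sub>t B" using d_lam.prems(1) d_lam.hyps(1) by (metis has_type_LamE has_type_unique)
  have S: "S \<subseteq> all_itypes A'" using d_lam.hyps(2) itypes_subset by blast
  have "T \<subseteq> all_itypes B \<and> (\<forall>k. vle B (tsv k B T) (sem k (\<Gamma>((x, A') \<mapsto> S)) M))"
    by (rule d_lam.IH[OF d_lam.hyps(1) environment_update[OF d_lam.prems(2) S]]) (use d_lam.prems(3) in auto)
  then have "vle A (tsv k A (arrs S T)) (sem k \<Gamma> (Lam x A' M))" for k
    unfolding A arrs_le_iff[OF d_lam.hyps(2,3) sem_D[OF d_lam.prems[unfolded A]]] sem_Lam_app[OF S] by blast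
  then show ?case using subset_trans[OF arrs_tau[OF d_lam.hyps(2,3)] tau_subset] unfolding A by blast
next
  case (d_Y_odd \<Gamma> x B M S T)
  have A: "A = B" and M: "has_type (sig \<A>) (Lam x A M) (A \<rightarrow>\<^sub>t A)"
    using d_Y_odd.prems(1) by (auto elim!: has_type_AppE has_type_YE)
  have fv: "fv (Lam x A M) \<subseteq> dom \<Gamma>" using d_Y_odd.prems(3) A by auto
  note IHM = d_Y_odd.IH(1)[folded A, OF M d_Y_odd.prems(2) fv]
  note IHY = d_Y_odd.IH(2)[OF d_Y_odd.prems, folded A]
  note M = M d_Y_odd.prems(2) fv
  note le = appl_le[OF conjunct1[OF IHM] conjunct1[OF IHY] sem_D[OF M]
      sem_D[OF d_Y_odd.prems, folded A] spec[OF conjunct2[OF IHM]] spec[OF conjunct2[OF IHY]]]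
  \<comment> \<open>The fixpoint unfolds at every level, not only at odd ones, so
    \<open>d_Y_odd\<close> is sound for types of any level.\<close>
  have "vapp (sem k \<Gamma> (Lam x A M)) (sem k \<Gamma> (Yb x A M)) = sem k \<Gamma> (Yb x A M)" for k
    unfolding sem_Yb[OF M] by (rule fixp_unfold[OF sem_D[OF M]])
  then have "vle A (tsv k A (appl S T)) (sem k \<Gamma> (Yb x A M))" for k using le(2)[of k] by simp
  then show ?case using le(1) unfolding A by blast
next
  case (d_Y_even S l B T \<Gamma> x M)
  have A: "A = B" and M: "has_type (sig \<A>) (Lam x A M) (A \<rightarrow>\<^sub>t A)"
    using d_Y_even.prems(1) by (auto elim!: has_type_AppE has_type_YE)
  have fv: "fv (Lam x A M) \<subseteq> dom \<Gamma>" using d_Y_even.prems(3) A by auto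
  note IHM = d_Y_even.IH(1)[folded A, OF M d_Y_even.prems(2) fv]
  note IHY = d_Y_even.IH(2)[OF d_Y_even.prems, folded A]
  note M = M d_Y_even.prems(2) fv
  note S = d_Y_even.hyps(1)[folded A] and T = d_Y_even.hyps(2)[folded A]
  have ST: "S \<union> T \<subseteq> itypes \<A> (2 * l) A"
    using S T by (fastforce simp: itypes_def itypes_below_def)
  have "vle A (tsv k A S) (vapp (sem k \<Gamma> (Lam x A M)) (tsv k A (S \<union> T)))" for k
    using conjunct2[OF IHM] unfolding arrs_le_iff[OF ST S sem_D[OF M]] by blast
  from rule9_sound[OF M S T this spec[OF conjunct2[OF IHY]]] show ?case
    using subset_trans[OF ST itypes_subset] unfolding A by blast
qed

section \<open>Completeness\<close>

lemma derivable_finite: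
  assumes "finite S" "\<And>s. s \<in> S \<Longrightarrow> derivable \<A> \<Gamma> M {s}"
  shows "derivable \<A> \<Gamma> M S"
  using assms
proof (induction S rule: finite_induct)
  case (insert s S)
  then have "derivable \<A> \<Gamma> M ({s} \<union> S)" by (intro derivable.d_union) auto
  then show ?case by simp
qed (rule derivable.d_empty)

text \<open>Subsumption with its side condition checked in the model, where \<open>sle\<close> is
  the semantic order on types of level at most \<open>k\<close>.\<close>

lemma derivable_tsv:
  assumes "has_type (sig \<A>) M A" "derivable \<A> \<Gamma> M T" "T \<subseteq> itypes \<A> k A" "S \<subseteq> itypes \<A> k A"
    and "vle A (tsv k A S) (tsv k A T)"
  shows "derivable \<A> \<Gamma> M S"
proof (rule derivable.d_sub[OF assms(2,1)])
  show "S \<subseteq> itypes \<A> (max_rank \<A>) A"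
    using assms(4) itypes_subset[of k A] by (auto simp: all_itypes_eq)
  show "sle S T" using sle_iff_tsv[OF assms(4,3)] assms(5) by blast
qed

text \<open>Typability is part of the notion because \<open>d_sub\<close> and \<open>d_lam\<close>
  demand it of the term being typed, which in the end is the expanded one.\<close>

definition complete :: "'c tm \<Rightarrow> ty \<Rightarrow> bool" where
  "complete M A \<longleftrightarrow> has_type (sig \<A>) M A \<and>
    (\<forall>k \<Gamma> S. environment \<A> \<Gamma> \<longrightarrow> fv M \<subseteq> dom \<Gamma> \<longrightarrow> S \<subseteq> itypes \<A> k A \<longrightarrow>
      vle A (tsv k A S) (sem k \<Gamma> M) \<longrightarrow> derivable \<A> \<Gamma> M S)"

lemma completeD:
  assumes "complete M A"
  shows "has_type (sig \<A>) M A"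
    and "environment \<A> \<Gamma> \<Longrightarrow> fv M \<subseteq> dom \<Gamma> \<Longrightarrow> S \<subseteq> itypes \<A> k A \<Longrightarrow>
      vle A (tsv k A S) (sem k \<Gamma> M) \<Longrightarrow> derivable \<A> \<Gamma> M S"
  using assms unfolding complete_def by blast+

lemma below_itypes: "below k A d \<subseteq> itypes \<A> k A"
  by blast

text \<open>The set of all types below the value is both derivable and an exact name of the value,
  so semantic equations transfer to derivable sets.\<close>

lemma complete_below:
  assumes "complete M A" "environment \<A> \<Gamma>" "fv M \<subseteq> dom \<Gamma>"
  shows "derivable \<A> \<Gamma> M (below k A (sem k \<Gamma> M))"
    and "tsv k A (below k A (sem k \<Gamma> M)) = sem k \<Gamma> M"
proof -
  note D = sem_D[OF completeD(1)[OF assms(1)] assms(2,3)]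
  show eq: "tsv k A (below k A (sem k \<Gamma> M)) = sem k \<Gamma> M" by (rule definability[OF D])
  show "derivable \<A> \<Gamma> M (below k A (sem k \<Gamma> M))"
    by (rule completeD(2)[OF assms below_itypes]) (simp only: eq vle_refl[OF D])
qed

lemma complete_Var: "complete (Var x A) A"
  unfolding complete_def
proof (intro conjI allI impI)
  show ty: "has_type (sig \<A>) (Var x A) A" by (rule has_type.ht_Var)
  fix k \<Gamma> S
  assume \<Gamma>: "environment \<A> \<Gamma>" "fv (Var x A :: 'c tm) \<subseteq> dom \<Gamma>" and S: "S \<subseteq> itypes \<A> k A"
    and le: "vle A (tsv k A S) (sem k \<Gamma> (Var x A))"
  obtain T where T: "\<Gamma> (x, A) = Some T" using \<Gamma>(2) by auto
  have TA: "T \<subseteq> all_itypes A" using environment_types[OF \<Gamma>(1), of "(x, A)"] T by auto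
  \<comment> \<open>The declared set may contain types above level \<open>k\<close>. They denote
    bottom there and are dropped before the orders are compared.\<close>
  let ?T = "T \<inter> itypes \<A> k A"
  have T': "?T \<subseteq> all_itypes A" using TA by blast
  have "vle A (tv k A t) (tsv k A ?T)" if t: "t \<in> T" for t
  proof (cases "t \<in> itypes \<A> k A")
    case True
    then show ?thesis using tv_le_tsv[OF T'] t by blast
  next
    case False
    obtain l where l: "t \<in> tau \<A> l A" using t TA by (auto simp: all_itypes_def)
    with False have "k < l" by (force simp: itypes_def not_le[symmetric])
    then show ?thesis using type_val_vbot[OF l] vbot_le by simp
  qed
  then have "vle A (tsv k A T) (tsv k A ?T)" using tsv_le_iff[OF TA tsv_D[OF T']] by blast
  moreover have "vle A (tsv k A S) (tsv k A T)" using le T by (simp add: env_val_eq)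
  ultimately have "vle A (tsv k A S) (tsv k A ?T)"
    using vle_trans[OF tsv_D[OF subset_trans[OF S itypes_subset]] tsv_D[OF TA]] by blast
  then have "sle S ?T" using sle_iff_tsv[OF S, of ?T] by blast
  then have "sle S T" unfolding sle_iff by blast
  moreover have "S \<subseteq> itypes \<A> (max_rank \<A>) A" using S itypes_subset[of k A] by (auto simp: all_itypes_eq)
  ultimately show "derivable \<A> \<Gamma> (Var x A) S"
    using derivable.d_sub[OF derivable.d_var[where \<Gamma> = \<Gamma> and x = x and A = A, OF T] ty] by blast
qed

lemma complete_Cst:
  assumes "sig \<A> c = Some A"
  shows "complete (Cst c) A"
  unfolding complete_def
proof (intro conjI allI impI)
  show ty: "has_type (sig \<A>) (Cst c) A" by (rule has_type.ht_Cst[of "sig \<A>", OF assms])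
  fix k \<Gamma> S
  assume \<Gamma>: "environment \<A> \<Gamma>" "fv (Cst c :: 'c tm) \<subseteq> dom \<Gamma>" and S: "S \<subseteq> itypes \<A> k A"
    and le: "vle A (tsv k A S) (sem k \<Gamma> (Cst c))"
  note D = sem_D[OF ty \<Gamma>]
  have tv: "vle A (tv k A s) (sem k \<Gamma> (Cst c))" if "s \<in> S" for s
    using le that tsv_le_iff[OF subset_trans[OF S itypes_subset] D] by blast
  show "derivable \<A> \<Gamma> (Cst c) S"
  proof (cases rule: sig_cases[OF assms])
    case 1
    let ?T = "{St q | q. q \<in> states \<A> \<and> delta0 \<A> q c \<noteq> {}}"
    have sub: "S \<subseteq> ?T"
    proof
      fix s assume s: "s \<in> S"
      then obtain q where q: "s = St q" "q \<in> states \<A>" "rank \<A> q \<le> k"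
        using S 1 by (auto simp: itypes_def)
      then have "q \<in> base (const0_val \<A> k c)" using tv[OF s] 1 assms by simp
      with q show "s \<in> ?T" by (simp add: const0_val_def)
    qed
    then have "tle s s" if "s \<in> S" for s using that by (auto intro: tle_sle.tle_St)
    with sub have le': "sle S ?T" unfolding sle_iff by blast
    have S': "S \<subseteq> itypes \<A> (max_rank \<A>) A" using S itypes_subset[of k A] by (auto simp: all_itypes_eq)
    have T: "derivable \<A> \<Gamma> (Cst c) ?T" by (rule derivable.d_const0) (use assms 1 in simp)
    show ?thesis by (rule derivable.d_sub[OF T ty S' le'])
  next
    case 2
    show ?thesis
    proof (rule derivable_finite)
      show "finite S" using finite_subset[OF S finite_itypes] .
      fix s assume s: "s \<in> S"
      obtain l where l: "l \<le> k" "s \<in> tau \<A> l (TO \<rightarrow>\<^sub>t TO \<rightarrow>\<^sub>t TO)" using s S 2 by (auto simp: itypes_def)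
      then obtain U V q where sq: "s = Arr U (Arr V (St q))" and q: "q \<in> states \<A>" "rank \<A> q = l"
        and "fset U \<subseteq> itypes \<A> l TO" "fset V \<subseteq> itypes \<A> l TO"
        by (auto simp: itypes_def)
      then have UV: "fset U \<subseteq> St ` states_le \<A> l" "fset V \<subseteq> St ` states_le \<A> l"
        by (auto simp: itypes_def states_le_def)
      then obtain S0 S1 where S01: "fset U = St ` S0" "fset V = St ` S1" "S0 \<subseteq> states_le \<A> l" "S1 \<subseteq> states_le \<A> l"
        by (auto simp: subset_image_iff)
      have "s \<in> all_itypes (TO \<rightarrow>\<^sub>t TO \<rightarrow>\<^sub>t TO)" using l(2) tau_subset by blast
      then have sA: "Arr U (Arr V (St q)) \<in> all_itypes (TO \<rightarrow>\<^sub>t TO \<rightarrow>\<^sub>t TO)" unfolding sq .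
      then have sB: "Arr V (St q) \<in> all_itypes (TO \<rightarrow>\<^sub>t TO)" and UA: "fset U \<subseteq> all_itypes TO"
        using all_itypes_ArrD by blast+
      then have VA: "fset V \<subseteq> all_itypes TO" using all_itypes_ArrD by blast
      note base = base_tsv[OF S01(3) l(1)] base_tsv[OF S01(4) l(1)]
      note D = D[unfolded 2]
      have "vle (TO \<rightarrow>\<^sub>t TO \<rightarrow>\<^sub>t TO) (tv k (TO \<rightarrow>\<^sub>t TO \<rightarrow>\<^sub>t TO) (Arr U (Arr V (St q)))) (sem k \<Gamma> (Cst c))"
        using tv[OF s] unfolding sq 2 .
      then have "vle TO (tv k TO (St q)) (vapp (vapp (sem k \<Gamma> (Cst c)) (tsv k TO (fset U))) (tsv k TO (fset V)))"
        unfolding Arr_le_iff[OF sA D] Arr_le_iff[OF sB D_app[OF D tsv_D[OF UA]]] .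
      moreover have "sem k \<Gamma> (Cst c) = const2_val \<A> k c" using assms 2 by simp
      ultimately have "vle TO (tv k TO (St q)) (const2_app k c (tsv k TO (fset U)) (tsv k TO (fset V)))"
        using tsv_D[OF UA, of k] tsv_D[OF VA, of k] by (simp only: const2_val_eq app_lam)
      then have "(S0 \<inter> states_le \<A> l, S1 \<inter> states_le \<A> l) \<in> delta2 \<A> q c"
        using q l(1) base unfolding S01(1,2) by (simp add: const2_app_def)
      \<comment> \<open>The level \<open>l\<close> of the type is the rank of \<open>q\<close> and
        bounds both premises, so truncation changes nothing.\<close>
      then have "(S0, S1) \<in> delta2 \<A> q c" using S01(3,4) by (simp add: Int_absorb2)
      moreover have "arrs (St ` S0) (arrs (St ` S1) {St q}) = {s}"
        unfolding sq S01(1,2)[symmetric] arrs_def by (auto simp: fset_inject)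
      ultimately show "derivable \<A> \<Gamma> (Cst c) {s}"
        using derivable.d_const2[of \<A> c q S0 S1 \<Gamma>] assms 2 q(1) by simp
    qed
  qed
qed

lemma complete_App:
  assumes M: "complete M (A \<rightarrow>\<^sub>t B)" and N: "complete N A"
  shows "complete (App M N) B"
  unfolding complete_def
proof (intro conjI allI impI)
  show ty: "has_type (sig \<A>) (App M N) B"
    by (rule has_type.ht_App[OF completeD(1)[OF M] completeD(1)[OF N]])
  fix k \<Gamma> S
  assume \<Gamma>: "environment \<A> \<Gamma>" "fv (App M N) \<subseteq> dom \<Gamma>" and S: "S \<subseteq> itypes \<A> k B"
    and le: "vle B (tsv k B S) (sem k \<Gamma> (App M N))"
  have fv: "fv M \<subseteq> dom \<Gamma>" "fv N \<subseteq> dom \<Gamma>" using \<Gamma>(2) by auto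
  let ?U = "below k (A \<rightarrow>\<^sub>t B) (sem k \<Gamma> M)" and ?T = "below k A (sem k \<Gamma> N)"
  have "derivable \<A> \<Gamma> (App M N) (appl ?U ?T)"
    by (rule derivable.d_app[OF complete_below(1)[OF M \<Gamma>(1) fv(1)] complete_below(1)[OF N \<Gamma>(1) fv(2)]])
  moreover have "tsv k B (appl ?U ?T) = sem k \<Gamma> (App M N)"
    unfolding tsv_appl[OF below_itypes below_itypes] complete_below(2)[OF M \<Gamma>(1) fv(1)]
      complete_below(2)[OF N \<Gamma>(1) fv(2)] by simp
  ultimately show "derivable \<A> \<Gamma> (App M N) S"
    using derivable_tsv[OF ty _ appl_itypes[OF below_itypes] S] le by simp
qed

text \<open>\<open>S\<close> may mix levels, whereas \<open>d_lam\<close> uses one level for both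
  premise and target; each type is therefore derived separately, at its own level.\<close>

lemma complete_Lam:
  assumes M: "complete M B"
  shows "complete (Lam x A M) (A \<rightarrow>\<^sub>t B)"
  unfolding complete_def
proof (intro conjI allI impI)
  note tyM = completeD(1)[OF M]
  show ty: "has_type (sig \<A>) (Lam x A M) (A \<rightarrow>\<^sub>t B)" by (rule has_type.ht_Lam[OF tyM])
  fix k \<Gamma> S
  assume \<Gamma>: "environment \<A> \<Gamma>" "fv (Lam x A M) \<subseteq> dom \<Gamma>" and S: "S \<subseteq> itypes \<A> k (A \<rightarrow>\<^sub>t B)"
    and le: "vle (A \<rightarrow>\<^sub>t B) (tsv k (A \<rightarrow>\<^sub>t B) S) (sem k \<Gamma> (Lam x A M))"
  note D = sem_D[OF ty \<Gamma>]
  show "derivable \<A> \<Gamma> (Lam x A M) S"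
  proof (rule derivable_finite)
    show "finite S" using finite_subset[OF S finite_itypes] .
    fix s assume s: "s \<in> S"
    then obtain l where l: "l \<le> k" "s \<in> tau \<A> l (A \<rightarrow>\<^sub>t B)" using S unfolding itypes_def by blast
    then obtain U t where Ut: "s = Arr U t" by auto
    have U: "fset U \<subseteq> itypes \<A> l A" and t: "t \<in> tau \<A> l B" using tau_ArrD[OF l(2)[unfolded Ut]] by auto
    have sA: "Arr U t \<in> all_itypes (A \<rightarrow>\<^sub>t B)" using subsetD[OF tau_subset l(2)] Ut by simp
    have UA: "fset U \<subseteq> all_itypes A" and tB: "{t} \<subseteq> all_itypes B" using all_itypes_ArrD[OF sA] by auto
    let ?\<Gamma> = "\<Gamma>((x, A) \<mapsto> fset U)"
    have \<Gamma>': "environment \<A> ?\<Gamma>" "fv M \<subseteq> dom ?\<Gamma>"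
      using environment_update[OF \<Gamma>(1) UA] \<Gamma>(2) by auto
    have "vle (A \<rightarrow>\<^sub>t B) (tv k (A \<rightarrow>\<^sub>t B) (Arr U t)) (sem k \<Gamma> (Lam x A M))"
      using le s Ut tsv_le_iff[OF subset_trans[OF S itypes_subset] D] by blast
    from tv_sem_down[OF ty \<Gamma> sA l(1) this]
    have "vle B (tv l B t) (sem l ?\<Gamma> M)"
      unfolding Arr_le_iff[OF sA sem_D[OF ty \<Gamma>]] sem_Lam_app[OF UA] .
    then have "vle B (tsv l B {t}) (sem l ?\<Gamma> M)"
      using tsv_le_iff[OF tB sem_D[OF tyM \<Gamma>']] by blast
    moreover have "{t} \<subseteq> itypes \<A> l B" using t by (auto simp: itypes_def)
    ultimately have "derivable \<A> ?\<Gamma> M {t}" using completeD(2)[OF M \<Gamma>'] by blast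
    from derivable.d_lam[OF tyM U _ this] have "derivable \<A> \<Gamma> (Lam x A M) (arrs (fset U) {t})"
      using t by blast
    moreover have "arrs (fset U) {t} = {s}" unfolding Ut arrs_def by (auto simp: fset_inject)
    ultimately show "derivable \<A> \<Gamma> (Lam x A M) {s}" by simp
  qed
qed

lemma complete_Yb:
  assumes M: "complete (Lam x A M) (A \<rightarrow>\<^sub>t A)"
  shows "complete (Yb x A M) A"
  unfolding complete_def
proof (intro conjI allI impI)
  note tyM = completeD(1)[OF M]
  show ty: "has_type (sig \<A>) (Yb x A M) A" by (rule has_type.ht_App[OF has_type.ht_Y tyM])
  fix k \<Gamma> S
  assume \<Gamma>: "environment \<A> \<Gamma>" "fv (Yb x A M) \<subseteq> dom \<Gamma>" and S: "S \<subseteq> itypes \<A> k A"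
    and le: "vle A (tsv k A S) (sem k \<Gamma> (Yb x A M))"
  have fv: "fv (Lam x A M) \<subseteq> dom \<Gamma>" using \<Gamma>(2) by auto
  define f where "f k = sem k \<Gamma> (Lam x A M)" for k
  define p where "p k = fixp \<A> k A (f k)" for k
  have f: "f k \<in> D k (A \<rightarrow>\<^sub>t A)" for k unfolding f_def by (rule sem_D[OF tyM \<Gamma>(1) fv])
  have Lf: "(f k, f (Suc k)) \<in> L k (A \<rightarrow>\<^sub>t A)" for k unfolding f_def by (rule L_sem[OF tyM \<Gamma>(1) fv])
  have p: "p k \<in> D k A" for k unfolding p_def by (rule fixp_D[OF f])
  have fp: "vapp (f k) (p k) = p k" for k unfolding p_def by (rule fixp_unfold[OF f])
  have Lp: "(p k, p (Suc k)) \<in> L k A" for k unfolding p_def by (rule L_fixp[OF Lf])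
  have sem: "sem k \<Gamma> (Yb x A M) = p k" for k
    unfolding p_def f_def by (rule sem_Yb[OF tyM \<Gamma>(1) fv])
  have eq: "tsv k A (below k A (p k)) = p k" for k by (rule definability[OF p])
  have Lam: "derivable \<A> \<Gamma> (Lam x A M) S"
    if "S \<subseteq> itypes \<A> k (A \<rightarrow>\<^sub>t A)" "vle (A \<rightarrow>\<^sub>t A) (tsv k (A \<rightarrow>\<^sub>t A) S) (f k)" for k S
    using that unfolding f_def by (rule completeD(2)[OF M \<Gamma>(1) fv])
  \<comment> \<open>In \<open>d_Y_even\<close> the types of level exactly \<open>k\<close> play the
    role of \<open>S\<close> and the lower ones that of \<open>T\<close>. Together they name
    \<open>p k\<close>, so the premise on the abstraction is the unfolding of
    \<open>p k\<close>.\<close>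
  have even: "derivable \<A> \<Gamma> (Yb x A M) (below k A (p k))"
    if k: "k = 2 * l" and T: "derivable \<A> \<Gamma> (Yb x A M) (below k A (p k) \<inter> itypes_below \<A> k A)" for k l
  proof -
    let ?T = "below k A (p k) \<inter> itypes_below \<A> k A" and ?P = "below k A (p k) \<inter> tau \<A> k A"
    have PT: "?P \<union> ?T = below k A (p k)"
      by (auto simp: itypes_def itypes_below_def le_less)
    have sub: "?P \<union> ?T \<subseteq> itypes \<A> k A" "?P \<subseteq> tau \<A> k A" unfolding PT by blast+
    have "vle A (tsv k A ?P) (vapp (f k) (tsv k A (?P \<union> ?T)))"
      unfolding PT eq fp tsv_le_iff[OF subset_trans[OF sub(2) tau_subset] p] by blast
    then have "vle (A \<rightarrow>\<^sub>t A) (tsv k (A \<rightarrow>\<^sub>t A) (arrs (?P \<union> ?T) ?P)) (f k)"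
      unfolding arrs_le_iff[OF sub f] .
    moreover have "arrs (?P \<union> ?T) ?P \<subseteq> itypes \<A> k (A \<rightarrow>\<^sub>t A)"
      using arrs_tau[OF sub] unfolding itypes_def by blast
    ultimately have lam: "derivable \<A> \<Gamma> (Lam x A M) (arrs (?P \<union> ?T) ?P)" by (intro Lam)
    have "derivable \<A> \<Gamma> (Yb x A M) (?P \<union> ?T)"
      by (rule derivable.d_Y_even[OF _ _ lam T, of l]) (use k in blast)+
    then show ?thesis unfolding PT .
  qed
  have below: "derivable \<A> \<Gamma> (Yb x A M) (below k A (p k))" for k
  proof (induction k)
    case 0
    \<comment> \<open>No type lies below level 0, so the derivation starts from
      \<open>d_empty\<close>.\<close>
    have "below 0 A (p 0) \<inter> itypes_below \<A> 0 A = {}" by (simp add: itypes_below_def)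
    then have "derivable \<A> \<Gamma> (Yb x A M) (below 0 A (p 0) \<inter> itypes_below \<A> 0 A)"
      by (simp only: derivable.d_empty)
    from even[of 0 0, OF _ this] show ?case by simp
  next
    case IH: (Suc k)
    show ?case
    proof (cases "even k")
      case False
      let ?T = "below (Suc k) A (p (Suc k)) \<inter> itypes_below \<A> (Suc k) A"
      have below: "itypes_below \<A> (Suc k) A = itypes \<A> k A"
        by (simp add: itypes_below_def itypes_def lessThan_Suc_atMost)
      \<comment> \<open>By adjointness the types of level at most \<open>k\<close> below the new
        fixpoint are already below the previous one, hence derivable.\<close>
      have "?T \<subseteq> below k A (p k)" unfolding below using tv_galois[OF _ Lp] by blast
      then have "vle A (tsv k A ?T) (tsv k A (below k A (p k)))"
        by (rule tsv_mono[OF subset_trans[OF below_itypes itypes_subset]])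
      moreover have "?T \<subseteq> itypes \<A> k A" unfolding below by blast
      ultimately have T: "derivable \<A> \<Gamma> (Yb x A M) ?T"
        by (intro derivable_tsv[OF ty IH below_itypes])
      obtain l where "Suc k = 2 * l" using False by (metis even_Suc evenE)
      from even[OF this T] show ?thesis .
    next
      case True
      let ?T = "below k A (p k)" and ?U = "below (Suc k) (A \<rightarrow>\<^sub>t A) (f (Suc k))"
      have T: "?T \<subseteq> itypes \<A> (Suc k) A" unfolding itypes_Suc by blast
      have Ueq: "tsv (Suc k) (A \<rightarrow>\<^sub>t A) ?U = f (Suc k)" by (rule definability[OF f])
      have U: "derivable \<A> \<Gamma> (Lam x A M) ?U"
        by (rule Lam[OF below_itypes]) (simp only: Ueq vle_refl[OF f])
      \<comment> \<open>The set derived at level \<open>k\<close>, read one level higher, names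
        exactly the point from which the odd fixpoint is iterated.\<close>
      have start: "tsv (Suc k) A ?T = up_bot \<A> (Suc k) A (p k)"
        using tsv_up_bot[OF below_itypes, of k A "p k"] unfolding eq .
      \<comment> \<open>Each use of \<open>d_Y_odd\<close> mirrors one application of
        \<open>f (Suc k)\<close>.\<close>
      have iter: "derivable \<A> \<Gamma> (Yb x A M) ((appl ?U ^^ n) ?T) \<and> (appl ?U ^^ n) ?T \<subseteq> itypes \<A> (Suc k) A \<and>
          tsv (Suc k) A ((appl ?U ^^ n) ?T) = (vapp (f (Suc k)) ^^ n) (up_bot \<A> (Suc k) A (p k))" for n
      proof (induction n)
        case 0
        show ?case using IH T start by (simp only: funpow_0)
      next
        case (Suc n)
        let ?S = "(appl ?U ^^ n) ?T"
        have S: "?S \<subseteq> itypes \<A> (Suc k) A" using Suc by blast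
        have "derivable \<A> \<Gamma> (Yb x A M) (appl ?U ?S)"
          by (rule derivable.d_Y_odd[OF U conjunct1[OF Suc]])
        moreover have "appl ?U ?S \<subseteq> itypes \<A> (Suc k) A" by (rule appl_itypes[OF below_itypes])
        moreover have "tsv (Suc k) A (appl ?U ?S) = vapp (f (Suc k)) (tsv (Suc k) A ?S)"
          unfolding tsv_appl[OF below_itypes S] Ueq ..
        ultimately show ?case using Suc by (simp only: funpow.simps comp_apply)
      qed
      obtain N where "p (Suc k) = (vapp (f (Suc k)) ^^ N) (up_bot \<A> (Suc k) A (p k))"
        using fixp_odd[OF True Lf] unfolding p_def .
      then have N: "tsv (Suc k) A ((appl ?U ^^ N) ?T) = p (Suc k)"
        using iter[of N] by simp
      show ?thesis
        by (rule derivable_tsv[OF ty conjunct1[OF iter[of N]] conjunct1[OF conjunct2[OF iter[of N]]] below_itypes])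
          (simp only: N eq vle_refl[OF p])
    qed
  qed
  show "derivable \<A> \<Gamma> (Yb x A M) S"
    by (rule derivable_tsv[OF ty below below_itypes S]) (use le in \<open>simp only: eq sem\<close>)
qed


section \<open>Unapplied fixpoint constants\<close>

text \<open>Recovers the general application equation, which the sequential patterns of
  \<open>expand_Y\<close> split over the constructors.\<close>

lemma expand_Y_App:
  "\<not> (\<exists>A x B P. M = YC A \<and> N = Lam x B P) \<Longrightarrow> expand_Y (App M N) = App (expand_Y M) (expand_Y N)"
  by (cases M; cases N) auto

lemma fv_expand_Y: "fv (expand_Y M) = fv M"
  by (induction M rule: expand_Y.induct) auto

lemma complete_expand_Y: "has_type (sig \<A>) M A \<Longrightarrow> complete (expand_Y M) A"
proof (induction M arbitrary: A)
  case (Var x B)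
  then show ?case using complete_Var by (auto elim: has_type_VarE)
next
  case (Cst c)
  then show ?case using complete_Cst by (auto elim: has_type_CstE)
next
  case (YC B)
  then have "A = (B \<rightarrow>\<^sub>t B) \<rightarrow>\<^sub>t B" by (auto elim: has_type_YE)
  moreover have "complete (Lam 0 (B \<rightarrow>\<^sub>t B) (Yb 1 B (App (Var 0 (B \<rightarrow>\<^sub>t B)) (Var 1 B)))) ((B \<rightarrow>\<^sub>t B) \<rightarrow>\<^sub>t B)"
    by (intro complete_Lam complete_Yb complete_App[of _ B] complete_Var)
  ultimately show ?case by simp
next
  case (App M N)
  obtain B where M: "has_type (sig \<A>) M (B \<rightarrow>\<^sub>t A)" and N: "has_type (sig \<A>) N B"
    using App.prems by (rule has_type_AppE)
  show ?case
  proof (cases "\<exists>C x C' P. M = YC C \<and> N = Lam x C' P")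
    case True
    then obtain C x C' P where MN: "M = YC C" "N = Lam x C' P" by blast
    then have "A = C" "B = A \<rightarrow>\<^sub>t A" using M by (auto elim: has_type_YE)
    moreover from this have "C' = A" using N MN by (auto elim: has_type_LamE)
    \<comment> \<open>Only the hypothesis for the argument is used: expansion keeps an abstraction
      an abstraction, which is the form \<open>complete_Yb\<close> expects.\<close>
    ultimately show ?thesis using complete_Yb[of x A "expand_Y P"] App.IH(2)[OF N] MN by simp
  next
    case False
    then show ?thesis unfolding expand_Y_App[OF False] by (intro complete_App[OF App.IH(1)[OF M] App.IH(2)[OF N]])
  qed
next
  case (Lam x B M)
  obtain C where "A = B \<rightarrow>\<^sub>t C" "has_type (sig \<A>) M C" using Lam.prems by (rule has_type_LamE)
  then show ?case using complete_Lam[OF Lam.IH] by simp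
qed

text \<open>Eta-expanding \<open>Y\<close> is harmless because function values are graphs over the
  domain: abstracting the application of \<open>d\<close> gives back \<open>d\<close>
  (\<open>D_eta\<close>).\<close>

lemma interp_expand_Y:
  "has_type (sig \<A>) M A \<Longrightarrow> \<forall>y \<in> fv M. v y \<in> D k (snd y) \<Longrightarrow> interp \<A> k (expand_Y M) v = interp \<A> k M v"
proof (induction M arbitrary: A v)
  case (YC B)
  let ?F = "D k (B \<rightarrow>\<^sub>t B)"
  have "vapp (vlam ?F (fixp \<A> k B)) (vlam (D k B) (vapp d)) = fixp \<A> k B d" if "d \<in> ?F" for d
    using that by (simp add: D_eta app_lam del: fixp.simps)
  then show ?case by (auto intro: vlam_cong simp del: fixp.simps)
next
  case (App M N)
  obtain B where M: "has_type (sig \<A>) M (B \<rightarrow>\<^sub>t A)" and N: "has_type (sig \<A>) N B"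
    using App.prems(1) by (rule has_type_AppE)
  have IH: "interp \<A> k (expand_Y M) v = interp \<A> k M v" "interp \<A> k (expand_Y N) v = interp \<A> k N v"
    using App.IH(1)[OF M] App.IH(2)[OF N] App.prems(2) by auto
  show ?case
  proof (cases "\<exists>C x C' P. M = YC C \<and> N = Lam x C' P")
    case True
    then show ?thesis using IH(2) by (auto simp del: fixp.simps)
  next
    case False
    show ?thesis unfolding expand_Y_App[OF False] using IH by simp
  qed
next
  case (Lam x B M)
  obtain C where C: "has_type (sig \<A>) M C" using Lam.prems(1) by (rule has_type_LamE)
  have "interp \<A> k (expand_Y M) (v((x, B) := d)) = interp \<A> k M (v((x, B) := d))" if "d \<in> D k B" for d
    by (rule Lam.IH[OF C]) (use Lam.prems(2) that in auto)
  then show ?case by (auto intro: vlam_cong)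
qed auto

end

theorem theorem5p5:
  fixes \<A> :: "('q, 'c) automaton" and k :: nat and M :: "'c tm" and A :: ty
    and \<Gamma> :: "'q env" and S :: "'q ity set"
  assumes "weak_automaton \<A>"
    and "k \<le> max_rank \<A>"
    and "has_type (sig \<A>) M A"
    and "environment \<A> \<Gamma>"
    and "fv M \<subseteq> dom \<Gamma>"
    and "S \<subseteq> itypes \<A> k A"
  shows "types_val \<A> k A S \<sqsubseteq>\<^bsub>DL \<A> k A\<^esub> interp \<A> k M (env_val \<A> k \<Gamma>)
    \<longleftrightarrow> derivable \<A> \<Gamma> (expand_Y M) S"
proof -
  interpret automaton_model \<A> by (rule automaton_model.intro[OF assms(1)])
  note complete = complete_expand_Y[OF assms(3)]
  have fv: "fv (expand_Y M) \<subseteq> dom \<Gamma>" using assms(5) by (simp only: fv_expand_Y)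
  have "interp \<A> k (expand_Y M) (env_val \<A> k \<Gamma>) = interp \<A> k M (env_val \<A> k \<Gamma>)"
    by (rule interp_expand_Y[OF assms(3) env_val_D[OF assms(4,5)]])
  moreover have "vle A (types_val \<A> k A S) (interp \<A> k (expand_Y M) (env_val \<A> k \<Gamma>))
      \<longleftrightarrow> derivable \<A> \<Gamma> (expand_Y M) S"
    using soundness[OF _ completeD(1)[OF complete] assms(4) fv]
      completeD(2)[OF complete assms(4) fv assms(6)] by blast
  ultimately show ?thesis by simp
qed

end
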